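(* Let $(M,\omega)$ be a compact connected quantizable Kähler manifold with very ample quantum line bundle $(L,h)$, let $s_0,\dots,s_N$ be an orthonormal basis of $\Gamma_{hol}(M,L)$ and $i:M\to\mathbb{P}^N(\mathbb{C})$ the corresponding coherent state embedding. Let $q,q'\in L_0$ with $\pi(q)=x$, $\pi(q')=y$, and assume that $i(x),i(y)$ lie in the affine chart $V_0=\{(z_0:\cdots:z_N)\mid z_0\neq0\}$. Then $$\langle e_q,e_{q'}\rangle_L=\hat q(s_0)\,\overline{\widehat{q'}(s_0)}\cdot\langle\widehat{i(y)},\widehat{i(x)}\rangle_{\mathbb{C}^{N+1}}=\frac{\hat q(s_0)\,\overline{\widehat{q'}(s_0)}}{F}\cdot\langle e_{i(x)},e_{i(y)}\rangle_{t_0},\qquad F:=\frac{N+1}{\mathrm{vol}(\mathbb{P}^N(\mathbb{C}))},$$ where for a point $p=(1:w)\in V_0$, $\hat p:=(1,w)\in\mathbb{C}^{N+1}$ is its normalized homogeneous representative, and $t_0$ is the section of the hyperplane bundle corresponding to the linear form $Z_0$.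
   Context: Quantum line bundle: a holomorphic line bundle $\pi:L\to M$ over the Kähler manifold $(M,\omega)$ with hermitian metric $h$ whose Chern connection has curvature $-\mathrm{i}\,\omega$; locally $\omega=-\mathrm{i}\,\partial\bar\partial\log\hat h$. $M$ is quantizable if such a bundle exists. $L$ very ample means that a basis of global holomorphic sections of $L$ defines a holomorphic embedding of $M$ into projective space. All hermitian metrics and scalar products are conjugate linear in the first argument; $\langle u,v\rangle_{\mathbb{C}^{N+1}}=\sum_j\bar u_jv_j$. Scalar product on the space $\Gamma_{hol}(M,L)$ of global holomorphic sections: $\langle\varphi,\psi\rangle_L=\int_M h(\varphi,\psi)\,\Omega$, where $\Omega=\frac{1}{n!}\omega^n$, $n=\dim_{\mathbb{C}}M$, is the (positive) Liouville volume form; $\mathrm{vol}(M)=\int_M\Omega$. Coherent vectors: let $L_0$ be the total space of $L$ minus the zero section. For $q\in L_0$ define a linear form $\hat q$ on $\Gamma_{hol}(M,L)$ by $s(\pi(q))=\hat q(s)\,q$. The coherent vector $e_q\in\Gamma_{hol}(M,L)$ is the unique section with $\langle e_q,s\rangle_L=\hat q(s)$ for all $s$. For a holomorphic section $s\not\equiv0$ and points $x,y$ with $s(x)\ne0\neq s(y)$ set $\langle e_x,e_y\rangle_s:=\langle e_{s(x)},e_{s(y)}\rangle$. Coherent state embedding: $i(x)=(s_0(x):\cdots:s_N(x))=(\hat q(s_0):\cdots:\hat q(s_N))$ for any $0\ne q\in\pi^{-1}(x)$. Projective space: $\mathbb{P}^N(\mathbb{C})$ carries the Fubini-Study form $\omega_{FS}=\mathrm{i}\,\partial\bar\partial\log(1+\|w\|^2)$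 (affine coordinates $w_j=z_j/z_0$), with quantum line bundle the hyperplane bundle $H$ (dual of the tautological bundle) whose metric in the affine chart, in the frame $t_0$, is $1/(1+\|w\|^2)$. Global sections of $H$ are the linear forms in the coordinates $Z_0,\dots,Z_N$. The scalar product, volume and coherent vectors for $(\mathbb{P}^N(\mathbb{C}),\omega_{FS},H)$ are defined by the same recipe as for $(M,\omega,L)$. *)

theory Defs
  imports
    "HOL-Analysis.Analysis"
    "HOL-Combinatorics.Permutations"
    "HOL-Algebra.Module"
begin

section \<open>Calculus on open subsets of complex coordinate space\<close>

definition holomorphic_fun_on :: "(complex^'n \<Rightarrow> complex) \<Rightarrow> (complex^'n) set \<Rightarrow> bool" where
  "holomorphic_fun_on f S \<longleftrightarrow>
     (\<forall>z\<in>S. \<exists>D. (f has_derivative D) (at z) \<and> (\<forall>c v. D (c *s v) = c * D v))"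

definition holomorphic_vec_on :: "(complex^'n \<Rightarrow> complex^'m) \<Rightarrow> (complex^'n) set \<Rightarrow> bool" where
  "holomorphic_vec_on f S \<longleftrightarrow> (\<forall>i. holomorphic_fun_on (\<lambda>z. f z $ i) S)"

text \<open>\<open>k\<close>-fold continuous real differentiability, through iterated directional derivatives;
  only used for open \<open>S\<close>.\<close>

primrec Ck_on :: "nat \<Rightarrow> (complex^'n \<Rightarrow> complex) \<Rightarrow> (complex^'n) set \<Rightarrow> bool" where
  "Ck_on 0 f S \<longleftrightarrow> continuous_on S f"
| "Ck_on (Suc k) f S \<longleftrightarrow>
     f differentiable_on S \<and> (\<forall>v. Ck_on k (\<lambda>z. frechet_derivative f (at z) v) S)"

definition smooth_fun_on :: "(complex^'n \<Rightarrow> complex) \<Rightarrow> (complex^'n) set \<Rightarrow> bool" where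
  "smooth_fun_on f S \<longleftrightarrow> (\<forall>k. Ck_on k f S)"

text \<open>The Wirtinger derivatives \<open>\<partial>/\<partial>z\<^sub>j\<close> and \<open>\<partial>/\<partial>\<bar>z\<^sub>j\<close>.\<close>

definition wirtinger :: "'n \<Rightarrow> (complex^'n \<Rightarrow> complex) \<Rightarrow> complex^'n \<Rightarrow> complex" where
  "wirtinger j f z =
     (frechet_derivative f (at z) (axis j 1) - \<i> * frechet_derivative f (at z) (axis j \<i>)) / 2"

definition wirtinger_bar :: "'n \<Rightarrow> (complex^'n \<Rightarrow> complex) \<Rightarrow> complex^'n \<Rightarrow> complex" where
  "wirtinger_bar j f z =
     (frechet_derivative f (at z) (axis j 1) + \<i> * frechet_derivative f (at z) (axis j \<i>)) / 2"


section \<open>Complex manifolds\<close>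

text \<open>The complex dimension is \<open>CARD('n)\<close>, so it is positive.\<close>

type_synonym ('a, 'n) chart = "'a set \<times> ('a \<Rightarrow> complex^'n)"

record ('a, 'n) complex_mfd =
  mtop :: "'a topology"
  atlas :: "('a, 'n) chart set"

abbreviation points :: "('a, 'n) complex_mfd \<Rightarrow> 'a set" where
  "points M \<equiv> topspace (mtop M)"

abbreviation chart_image :: "('a, 'n) chart \<Rightarrow> 'a set \<Rightarrow> (complex^'n) set" where
  "chart_image c U \<equiv> snd c ` (fst c \<inter> U)"

abbreviation chart_inv :: "('a, 'n) chart \<Rightarrow> complex^'n \<Rightarrow> 'a" where
  "chart_inv c \<equiv> inv_into (fst c) (snd c)"

locale complex_manifold =
  fixes M :: "('a, 'n::finite) complex_mfd"
  assumes Hausdorff: "Hausdorff_space (mtop M)"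
    and second_countable: "\<exists>B. countable B \<and> (\<forall>V\<in>B. openin (mtop M) V) \<and>
      (\<forall>U x. openin (mtop M) U \<and> x \<in> U \<longrightarrow> (\<exists>V\<in>B. x \<in> V \<and> V \<subseteq> U))"
    and atlas_cover: "points M = \<Union> (fst ` atlas M)"
    and chart_domain: "c \<in> atlas M \<Longrightarrow> openin (mtop M) (fst c)"
    and chart_range: "c \<in> atlas M \<Longrightarrow> open (snd c ` fst c)"
    and chart_homeomorphic: "c \<in> atlas M \<Longrightarrow>
      homeomorphic_map (subtopology (mtop M) (fst c)) (top_of_set (snd c ` fst c)) (snd c)"
    and chart_transition: "c \<in> atlas M \<Longrightarrow> c' \<in> atlas M \<Longrightarrow>
      holomorphic_vec_on (snd c' \<circ> chart_inv c) (chart_image c (fst c'))"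

definition holomorphic_on_mfd ::
    "('a, 'n::finite) complex_mfd \<Rightarrow> ('a \<Rightarrow> complex) \<Rightarrow> 'a set \<Rightarrow> bool" where
  "holomorphic_on_mfd M f U \<longleftrightarrow>
     (\<forall>c\<in>atlas M. holomorphic_fun_on (f \<circ> chart_inv c) (chart_image c U))"

definition holomorphic_embedding ::
    "('a, 'n::finite) complex_mfd \<Rightarrow> ('b, 'm::finite) complex_mfd \<Rightarrow> ('a \<Rightarrow> 'b) \<Rightarrow> bool" where
  "holomorphic_embedding M M' f \<longleftrightarrow>
     embedding_map (mtop M) (mtop M') f \<and>
     (\<forall>c\<in>atlas M. \<forall>c'\<in>atlas M'.
        holomorphic_vec_on (snd c' \<circ> f \<circ> chart_inv c) (chart_image c (f -` fst c')) \<and>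
        (\<forall>z\<in>chart_image c (f -` fst c').
           inj (frechet_derivative (snd c' \<circ> f \<circ> chart_inv c) (at z))))"


section \<open>Kaehler forms, Liouville volume and integration\<close>

text \<open>A (1,1)-form \<open>\<omega>\<close> is given by its coefficients in the charts: for a chart \<open>c\<close> with
  coordinates \<open>z\<close> and a point \<open>p\<close> in its domain,
  \<open>\<omega> = \<i> \<Sum>\<^sub>j\<^sub>k (\<omega> c p $ j $ k) dz\<^sub>j \<and> d\<bar>z\<^sub>k\<close> at \<open>p\<close>.
  Under a change of charts the coefficients transform with the holomorphic Jacobian.\<close>

type_synonym ('a, 'n) form11 = "('a, 'n) chart \<Rightarrow> 'a \<Rightarrow> complex^'n^'n"

definition jacobian :: "('a, 'n::finite) chart \<Rightarrow> ('a, 'n) chart \<Rightarrow> 'a \<Rightarrow> complex^'n^'n" where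
  "jacobian c c' p = (\<chi> a j. wirtinger j (\<lambda>z. (snd c' \<circ> chart_inv c) z $ a) (snd c p))"

locale kaehler_manifold = complex_manifold M
  for M :: "('a, 'n::finite) complex_mfd" +
  fixes \<omega> :: "('a, 'n) form11"
  assumes form_smooth: "c \<in> atlas M \<Longrightarrow>
      smooth_fun_on (\<lambda>z. \<omega> c (chart_inv c z) $ j $ k) (snd c ` fst c)"
    and form_transition: "c \<in> atlas M \<Longrightarrow> c' \<in> atlas M \<Longrightarrow> p \<in> fst c \<inter> fst c' \<Longrightarrow>
      \<omega> c p $ j $ k = (\<Sum>a\<in>UNIV. \<Sum>b\<in>UNIV.
         jacobian c c' p $ a $ j * \<omega> c' p $ a $ b * cnj (jacobian c c' p $ b $ k))"
    and form_real: "c \<in> atlas M \<Longrightarrow> p \<in> fst c \<Longrightarrow> \<omega> c p $ k $ j = cnj (\<omega> c p $ j $ k)"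
    and form_positive: "c \<in> atlas M \<Longrightarrow> p \<in> fst c \<Longrightarrow> v \<noteq> 0 \<Longrightarrow>
      Re (\<Sum>j\<in>UNIV. \<Sum>k\<in>UNIV. \<omega> c p $ j $ k * v $ j * cnj (v $ k)) > 0"
    and form_del_closed: "c \<in> atlas M \<Longrightarrow> z \<in> snd c ` fst c \<Longrightarrow>
      wirtinger l (\<lambda>z. \<omega> c (chart_inv c z) $ j $ k) z =
      wirtinger j (\<lambda>z. \<omega> c (chart_inv c z) $ l $ k) z"
    and form_delbar_closed: "c \<in> atlas M \<Longrightarrow> z \<in> snd c ` fst c \<Longrightarrow>
      wirtinger_bar l (\<lambda>z. \<omega> c (chart_inv c z) $ j $ k) z =
      wirtinger_bar k (\<lambda>z. \<omega> c (chart_inv c z) $ j $ l) z"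

text \<open>Lebesgue density of the Liouville form \<open>\<omega>\<^sup>n/n!\<close> in a chart. Expanding the wedge power,
  \<open>\<omega>\<^sup>n = (\<Sum>\<sigma> \<tau>. sign \<sigma> sign \<tau> \<Prod>\<^sub>l g (\<sigma> l) (\<tau> l)) \<Prod>\<^sub>l (\<i> dz\<^sub>l \<and> d\<bar>z\<^sub>l)\<close> where
  \<open>g j k\<close> are the coefficients of \<open>\<omega>\<close>, and each factor \<open>\<i> dz\<^sub>l \<and> d\<bar>z\<^sub>l\<close> equals \<open>2 dx\<^sub>l \<and> dy\<^sub>l\<close>.\<close>

definition liouville_density :: "('a, 'n::finite) form11 \<Rightarrow> ('a, 'n) chart \<Rightarrow> 'a \<Rightarrow> real" where
  "liouville_density \<omega> c p =
     2 ^ CARD('n) / fact CARD('n) *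
     Re (\<Sum>\<sigma> | \<sigma> permutes (UNIV :: 'n set). \<Sum>\<tau> | \<tau> permutes (UNIV :: 'n set).
           of_int (sign \<sigma> * sign \<tau>) * (\<Prod>l\<in>UNIV. \<omega> c p $ \<sigma> l $ \<tau> l))"

text \<open>Finite partitions of unity subordinate to charts, as sets of pairs (chart, function).\<close>

definition partition_of_unity ::
    "('a, 'n::finite) complex_mfd \<Rightarrow> (('a, 'n) chart \<times> ('a \<Rightarrow> real)) set \<Rightarrow> bool" where
  "partition_of_unity M P \<longleftrightarrow> finite P \<and>
     (\<forall>(c, \<rho>)\<in>P. c \<in> atlas M \<and> continuous_map (mtop M) euclideanreal \<rho> \<and>
        (\<forall>x\<in>points M. 0 \<le> \<rho> x) \<and>
        mtop M closure_of {x \<in> points M. \<rho> x \<noteq> 0} \<subseteq> fst c) \<and>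
     (\<forall>x\<in>points M. (\<Sum>(c, \<rho>)\<in>P. \<rho> x) = 1)"

text \<open>\<open>\<integral>\<^sub>M f \<Omega>\<close> for compact \<open>M\<close> and continuous \<open>f\<close>; by the change of variables formula the
  value does not depend on the chosen partition of unity.\<close>

definition liouville_integral ::
    "('a, 'n::finite) complex_mfd \<Rightarrow> ('a, 'n) form11 \<Rightarrow>
     ('a \<Rightarrow> 'b::{banach, second_countable_topology}) \<Rightarrow> 'b" where
  "liouville_integral M \<omega> f =
     (\<Sum>(c, \<rho>)\<in>(SOME P. partition_of_unity M P).
        LINT z : snd c ` fst c | lborel.
          (\<rho> (chart_inv c z) * liouville_density \<omega> c (chart_inv c z)) *\<^sub>R f (chart_inv c z))"

definition liouville_volume :: "('a, 'n::finite) complex_mfd \<Rightarrow> ('a, 'n) form11 \<Rightarrow> real" where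
  "liouville_volume M \<omega> = liouville_integral M \<omega> (\<lambda>x. 1)"


section \<open>Holomorphic line bundles\<close>

definition complex_ring :: "complex ring" where
  "complex_ring = \<lparr>carrier = UNIV, mult = (*), one = 1, zero = 0, add = (+)\<rparr>"

text \<open>The total space is the union of the carriers of the fibres over the points of the base,
  with projection \<open>bproj\<close>. The holomorphic structure is given by local frames: pairs of an
  open set and a nowhere vanishing section on it.\<close>

record ('a, 'e) line_bundle =
  bproj :: "'e \<Rightarrow> 'a"
  fibre :: "'a \<Rightarrow> (complex, 'e) module"
  frames :: "('a set \<times> ('a \<Rightarrow> 'e)) set"

text \<open>The quotient \<open>v/u\<close> of two vectors in a one-dimensional space, for \<open>u \<noteq> 0\<close>.\<close>

definition ratio :: "(complex, 'e) module \<Rightarrow> 'e \<Rightarrow> 'e \<Rightarrow> complex" where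
  "ratio V u v = (THE c. v = c \<odot>\<^bsub>V\<^esub> u)"

locale holomorphic_line_bundle = complex_manifold M
  for M :: "('a, 'n::finite) complex_mfd" +
  fixes L :: "('a, 'e) line_bundle"
  assumes fibre_vector_space: "x \<in> points M \<Longrightarrow> Module.module complex_ring (fibre L x)"
    and fibre_bproj: "x \<in> points M \<Longrightarrow> u \<in> carrier (fibre L x) \<Longrightarrow> bproj L u = x"
    and frames_cover: "points M = \<Union> (fst ` frames L)"
    and frame_domain: "(U, t) \<in> frames L \<Longrightarrow> openin (mtop M) U"
    and frame_in_fibre: "(U, t) \<in> frames L \<Longrightarrow> x \<in> U \<Longrightarrow> t x \<in> carrier (fibre L x)"
    and frame_basis: "(U, t) \<in> frames L \<Longrightarrow> x \<in> U \<Longrightarrow>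
      bij_betw (\<lambda>c. c \<odot>\<^bsub>fibre L x\<^esub> t x) UNIV (carrier (fibre L x))"
    and frame_transition: "(U, t) \<in> frames L \<Longrightarrow> (U', t') \<in> frames L \<Longrightarrow>
      holomorphic_on_mfd M (\<lambda>x. ratio (fibre L x) (t x) (t' x)) (U \<inter> U')"

locale hermitian_line_bundle = holomorphic_line_bundle M L
  for M :: "('a, 'n::finite) complex_mfd" and L :: "('a, 'e) line_bundle" +
  fixes h :: "'e \<Rightarrow> 'e \<Rightarrow> complex"
  assumes metric_add: "x \<in> points M \<Longrightarrow>
      u \<in> carrier (fibre L x) \<Longrightarrow> v \<in> carrier (fibre L x) \<Longrightarrow> w \<in> carrier (fibre L x) \<Longrightarrow>
      h u (v \<oplus>\<^bsub>fibre L x\<^esub> w) = h u v + h u w"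
    and metric_scale: "x \<in> points M \<Longrightarrow>
      u \<in> carrier (fibre L x) \<Longrightarrow> v \<in> carrier (fibre L x) \<Longrightarrow>
      h u (a \<odot>\<^bsub>fibre L x\<^esub> v) = a * h u v"
    and metric_hermitian: "x \<in> points M \<Longrightarrow>
      u \<in> carrier (fibre L x) \<Longrightarrow> v \<in> carrier (fibre L x) \<Longrightarrow> h v u = cnj (h u v)"
    and metric_positive: "x \<in> points M \<Longrightarrow>
      u \<in> carrier (fibre L x) \<Longrightarrow> u \<noteq> \<zero>\<^bsub>fibre L x\<^esub> \<Longrightarrow> Re (h u u) > 0"
    and metric_smooth: "(U, t) \<in> frames L \<Longrightarrow> c \<in> atlas M \<Longrightarrow>
      smooth_fun_on (\<lambda>z. h (t (chart_inv c z)) (t (chart_inv c z))) (chart_image c U)"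

text \<open>In a local frame \<open>t\<close> the connection form of the Chern connection is
  \<open>\<theta> = \<partial>H / H\<close> with \<open>H = h(t, t)\<close>, and its curvature is
  \<open>d\<theta> = - \<Sum>\<^sub>j\<^sub>k (\<partial>\<theta>\<^sub>j/\<partial>\<bar>z\<^sub>k) dz\<^sub>j \<and> d\<bar>z\<^sub>k\<close>; the (2,0)-part vanishes as \<open>\<theta> = \<partial> log H\<close>.\<close>

definition chern_connection ::
    "('e \<Rightarrow> 'e \<Rightarrow> complex) \<Rightarrow> ('a \<Rightarrow> 'e) \<Rightarrow> ('a, 'n::finite) chart \<Rightarrow> 'n \<Rightarrow> complex^'n \<Rightarrow> complex" where
  "chern_connection h t c j z =
     wirtinger j (\<lambda>z. h (t (chart_inv c z)) (t (chart_inv c z))) z /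
     h (t (chart_inv c z)) (t (chart_inv c z))"

definition chern_curvature ::
    "('e \<Rightarrow> 'e \<Rightarrow> complex) \<Rightarrow> ('a \<Rightarrow> 'e) \<Rightarrow> ('a, 'n::finite) chart \<Rightarrow> 'a \<Rightarrow> complex^'n^'n" where
  "chern_curvature h t c p = (\<chi> j k. - wirtinger_bar k (chern_connection h t c j) (snd c p))"

text \<open>The curvature equals \<open>-\<i>\<omega>\<close>; the coefficient of \<open>dz\<^sub>j \<and> d\<bar>z\<^sub>k\<close> in \<open>\<omega>\<close> is \<open>\<i> * \<omega> c p $ j $ k\<close>.\<close>

locale quantum_line_bundle = kaehler_manifold M \<omega> + hermitian_line_bundle M L h
  for M :: "('a, 'n::finite) complex_mfd" and \<omega> :: "('a, 'n) form11"
    and L :: "('a, 'e) line_bundle" and h :: "'e \<Rightarrow> 'e \<Rightarrow> complex" +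
  assumes quantum_condition: "(U, t) \<in> frames L \<Longrightarrow> c \<in> atlas M \<Longrightarrow> p \<in> U \<inter> fst c \<Longrightarrow>
      chern_curvature h t c p $ j $ k = - \<i> * (\<i> * \<omega> c p $ j $ k)"


section \<open>Sections and coherent vectors\<close>

definition hol_section ::
    "('a, 'n::finite) complex_mfd \<Rightarrow> ('a, 'e) line_bundle \<Rightarrow> ('a \<Rightarrow> 'e) \<Rightarrow> bool" where
  "hol_section M L s \<longleftrightarrow>
     s \<in> (\<Pi>\<^sub>E x\<in>points M. carrier (fibre L x)) \<and>
     (\<forall>(U, t)\<in>frames L. holomorphic_on_mfd M (\<lambda>x. ratio (fibre L x) (t x) (s x)) U)"

text \<open>The multiplicative part of the module record is irrelevant and left unspecified.\<close>

definition hol_sections ::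
    "('a, 'n::finite) complex_mfd \<Rightarrow> ('a, 'e) line_bundle \<Rightarrow> (complex, 'a \<Rightarrow> 'e) module" where
  "hol_sections M L =
     \<lparr>carrier = {s. hol_section M L s}, mult = undefined, one = undefined,
      zero = (\<lambda>x\<in>points M. \<zero>\<^bsub>fibre L x\<^esub>),
      add = (\<lambda>s s'. \<lambda>x\<in>points M. s x \<oplus>\<^bsub>fibre L x\<^esub> s' x),
      smult = (\<lambda>c s. \<lambda>x\<in>points M. c \<odot>\<^bsub>fibre L x\<^esub> s x)\<rparr>"

definition section_inner ::
    "('a, 'n::finite) complex_mfd \<Rightarrow> ('a, 'n) form11 \<Rightarrow> ('e \<Rightarrow> 'e \<Rightarrow> complex) \<Rightarrow>
     ('a \<Rightarrow> 'e) \<Rightarrow> ('a \<Rightarrow> 'e) \<Rightarrow> complex" where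
  "section_inner M \<omega> h \<phi> \<psi> = liouville_integral M \<omega> (\<lambda>x. h (\<phi> x) (\<psi> x))"

definition section_basis ::
    "('a, 'n::finite) complex_mfd \<Rightarrow> ('a, 'e) line_bundle \<Rightarrow> ('i::finite \<Rightarrow> 'a \<Rightarrow> 'e) \<Rightarrow> bool" where
  "section_basis M L s \<longleftrightarrow>
     (\<forall>j. s j \<in> carrier (hol_sections M L)) \<and>
     (\<forall>\<phi>\<in>carrier (hol_sections M L).
        \<exists>!a. \<phi> = finsum (hol_sections M L) (\<lambda>j. a j \<odot>\<^bsub>hol_sections M L\<^esub> s j) UNIV)"

definition orthonormal_section_basis ::
    "('a, 'n::finite) complex_mfd \<Rightarrow> ('a, 'n) form11 \<Rightarrow> ('a, 'e) line_bundle \<Rightarrow>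
     ('e \<Rightarrow> 'e \<Rightarrow> complex) \<Rightarrow> ('i::finite \<Rightarrow> 'a \<Rightarrow> 'e) \<Rightarrow> bool" where
  "orthonormal_section_basis M \<omega> L h s \<longleftrightarrow>
     section_basis M L s \<and>
     (\<forall>j k. section_inner M \<omega> h (s j) (s k) = (if j = k then 1 else 0))"

definition nonzero_vectors ::
    "('a, 'n::finite) complex_mfd \<Rightarrow> ('a, 'e) line_bundle \<Rightarrow> 'e set" where
  "nonzero_vectors M L = (\<Union>x\<in>points M. carrier (fibre L x) - {\<zero>\<^bsub>fibre L x\<^esub>})"

text \<open>The linear form \<open>q^\<close> on sections determined by \<open>s (\<pi> q) = q^ s \<cdot> q\<close>.\<close>

definition point_form :: "('a, 'e) line_bundle \<Rightarrow> 'e \<Rightarrow> ('a \<Rightarrow> 'e) \<Rightarrow> complex" where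
  "point_form L q s = ratio (fibre L (bproj L q)) q (s (bproj L q))"

definition coherent_vector ::
    "('a, 'n::finite) complex_mfd \<Rightarrow> ('a, 'n) form11 \<Rightarrow> ('a, 'e) line_bundle \<Rightarrow>
     ('e \<Rightarrow> 'e \<Rightarrow> complex) \<Rightarrow> 'e \<Rightarrow> 'a \<Rightarrow> 'e" where
  "coherent_vector M \<omega> L h q =
     (THE e. e \<in> carrier (hol_sections M L) \<and>
        (\<forall>s\<in>carrier (hol_sections M L). section_inner M \<omega> h e s = point_form L q s))"

definition coherent_inner_along ::
    "('a, 'n::finite) complex_mfd \<Rightarrow> ('a, 'n) form11 \<Rightarrow> ('a, 'e) line_bundle \<Rightarrow>
     ('e \<Rightarrow> 'e \<Rightarrow> complex) \<Rightarrow> ('a \<Rightarrow> 'e) \<Rightarrow> 'a \<Rightarrow> 'a \<Rightarrow> complex" where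
  "coherent_inner_along M \<omega> L h s x y =
     section_inner M \<omega> h (coherent_vector M \<omega> L h (s x)) (coherent_vector M \<omega> L h (s y))"


section \<open>Projective space\<close>

text \<open>\<open>\<P>\<^sup>N(\<complex>)\<close> with \<open>N = CARD('N)\<close>. The homogeneous coordinates \<open>z\<^sub>0, \<dots>, z\<^sub>N\<close> are indexed by
  \<^typ>\<open>'N option\<close>, the index \<open>0\<close> being \<^const>\<open>None\<close>. Points are the one-dimensional
  subspaces themselves.\<close>

definition line :: "complex^'m \<Rightarrow> (complex^'m) set" where
  "line v = range (\<lambda>c. c *s v)"

definition proj_points :: "(complex^'N::finite option) set set" where
  "proj_points = line ` (- {0})"

definition affine_patch :: "'N::finite option \<Rightarrow> (complex^'N option) set set" where
  "affine_patch k = {l \<in> proj_points. \<exists>v\<in>l. v $ k \<noteq> 0}"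

text \<open>The homogeneous representative with \<open>k\<close>-th coordinate 1.\<close>

definition homog_rep :: "'N::finite option \<Rightarrow> (complex^'N option) set \<Rightarrow> complex^'N option" where
  "homog_rep k l = (THE v. v \<in> l \<and> v $ k = 1)"

text \<open>\<open>affine_index k\<close> enumerates all homogeneous indices except \<open>k\<close>; for \<open>k = 0\<close> the affine
  coordinates are \<open>w\<^sub>j = z\<^sub>j/z\<^sub>0\<close>.\<close>

definition affine_index :: "'N option \<Rightarrow> 'N \<Rightarrow> 'N option" where
  "affine_index k j = (if k = Some j then None else Some j)"

definition affine_coords :: "'N::finite option \<Rightarrow> (complex^'N option) set \<Rightarrow> complex^'N" where
  "affine_coords k l = (\<chi> j. homog_rep k l $ affine_index k j)"

definition projective_space :: "((complex^'N::finite option) set, 'N) complex_mfd" where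
  "projective_space =
     \<lparr>mtop = topology (\<lambda>U. U \<subseteq> proj_points \<and> open {v. v \<noteq> 0 \<and> line v \<in> U}),
      atlas = range (\<lambda>k. (affine_patch k, affine_coords k))\<rparr>"

text \<open>The Fubini-Study form \<open>\<i> \<partial>\<bar>\<partial> log (1 + \<parallel>w\<parallel>\<^sup>2)\<close>; it is given by the same formula in the
  affine coordinates of each patch.\<close>

definition fubini_study :: "((complex^'N::finite option) set, 'N) form11" where
  "fubini_study c p = (\<chi> j k. wirtinger j
     (wirtinger_bar k (\<lambda>w. complex_of_real (ln (1 + (norm w)\<^sup>2)))) (snd c p))"

text \<open>The hyperplane bundle, dual to the tautological bundle: the fibre over the line \<open>l\<close> consists
  of the pairs \<open>(l, f)\<close> with \<open>f\<close> a linear form on \<open>l\<close>.\<close>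

type_synonym 'N hyperplane_vector =
  "(complex^'N option) set \<times> (complex^'N option \<Rightarrow> complex)"

definition linear_forms :: "(complex^'m) set \<Rightarrow> (complex^'m \<Rightarrow> complex) set" where
  "linear_forms l = {f \<in> extensional l.
     (\<forall>u\<in>l. \<forall>v\<in>l. f (u + v) = f u + f v) \<and> (\<forall>a. \<forall>v\<in>l. f (a *s v) = a * f v)}"

definition form_section ::
    "(complex^'N::finite option \<Rightarrow> complex) \<Rightarrow> (complex^'N option) set \<Rightarrow> 'N hyperplane_vector" where
  "form_section f = (\<lambda>l\<in>proj_points. (l, restrict f l))"

definition hyperplane_bundle ::
    "((complex^'N::finite option) set, 'N hyperplane_vector) line_bundle" where
  "hyperplane_bundle =
     \<lparr>bproj = fst,
      fibre = (\<lambda>l.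
        \<lparr>carrier = {l} \<times> linear_forms l, mult = undefined, one = undefined,
         zero = (l, \<lambda>v\<in>l. 0),
         add = (\<lambda>u u'. (l, \<lambda>v\<in>l. snd u v + snd u' v)),
         smult = (\<lambda>a u. (l, \<lambda>v\<in>l. a * snd u v))\<rparr>),
      frames = range (\<lambda>k. (affine_patch k, form_section (\<lambda>v. v $ k)))\<rparr>"

text \<open>The metric dual to the standard one on the tautological bundle, independent of the choice of
  \<open>v\<close>; for \<open>v = (1, w)\<close> the frame \<open>Z\<^sub>0\<close> has squared length \<open>1 / (1 + \<parallel>w\<parallel>\<^sup>2)\<close>.\<close>

definition hyperplane_metric ::
    "'N::finite hyperplane_vector \<Rightarrow> 'N hyperplane_vector \<Rightarrow> complex" where
  "hyperplane_metric u u' =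
     (let v = (SOME v. v \<in> fst u \<and> v \<noteq> 0)
      in cnj (snd u v) * snd u' v / of_real ((norm v)\<^sup>2))"

definition hermitian_inner :: "complex^'m::finite \<Rightarrow> complex^'m \<Rightarrow> complex" where
  "hermitian_inner u v = (\<Sum>j\<in>UNIV. cnj (u $ j) * v $ j)"


section \<open>Maps to projective space\<close>

text \<open>\<open>x \<mapsto> (s\<^sub>0(x) : \<dots> : s\<^sub>N(x))\<close>, independent of the choice of \<open>q\<close> over \<open>x\<close>. If all \<open>s\<^sub>j\<close> vanish at
  \<open>x\<close> the value is \<open>{0}\<close>, which is not a point of projective space.\<close>

definition map_to_proj ::
    "('a, 'n::finite) complex_mfd \<Rightarrow> ('a, 'e) line_bundle \<Rightarrow> ('N::finite option \<Rightarrow> 'a \<Rightarrow> 'e) \<Rightarrow>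
     'a \<Rightarrow> (complex^'N option) set" where
  "map_to_proj M L s x =
     (let q = (SOME q. q \<in> nonzero_vectors M L \<and> bproj L q = x)
      in line (\<chi> j. point_form L q (s j)))"

text \<open>The type argument fixes the number \<open>N + 1\<close> of basis sections.\<close>

definition very_ample ::
    "'N::finite itself \<Rightarrow> ('a, 'n::finite) complex_mfd \<Rightarrow> ('a, 'e) line_bundle \<Rightarrow> bool" where
  "very_ample T M L \<longleftrightarrow>
     (\<exists>b :: 'N option \<Rightarrow> 'a \<Rightarrow> 'e. section_basis M L b \<and>
        holomorphic_embedding M projective_space (map_to_proj M L b))"

end

(* With e_q = sum_j cnj (q^ s_j) s_j for an orthonormal basis s, the product <e_q, e_q'> is
   sum_j (q^ s_j) cnj (q'^ s_j), and dividing by the entries at index 0 gives the first identity.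
   The second one is the same computation on projective space. There the linear forms exhaust the
   holomorphic sections: in each affine chart a section is an entire function of at most linear
   growth, hence affine by Liouville's theorem on complex lines. The coordinates Z_j are orthogonal
   with common square norm vol/(N+1): in affine coordinates the Fubini-Study volume has density
   2^N / (1 + |w|^2)^(N+1), which is a multiple of the image of Lebesgue measure on the unit ball of
   C^(N+1), so reflections and transpositions of the coordinates act by measure-preserving maps. *)
theory Submission
  imports Defs "HOL-Complex_Analysis.Cauchy_Integral_Formula"
begin

text \<open>\<open>liouville_integral\<close> is defined through a partition of unity picked by
  choice, and coherent vectors by a definite description; both shape the proof. On M all integrands
  share the one chosen partition, so once a partition is known to exist, linearity and hermitian
  symmetry hold chart by chart. On projective space the value of the integral matters. There every
  chart integral is turned into an integral over the same unit ball of C^(N+1), where the weights of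
  the partition add up to 1 whatever it is. The ball has symmetries that a chart hides, and the
  constant between ball and chart enters the volume and the scalar product alike. A coherent vector
  has to be unique among all holomorphic sections, which is why the linear forms must be shown to
  exhaust them. If the scalar product is \<kappa> times the standard one on coefficients, coherent
  vectors carry a factor 1/\<kappa> and their scalar products \<kappa>/\<kappa>^2 = 1/\<kappa>; for
  \<kappa> = vol/(N+1) this is F.\<close>

section \<open>Lebesgue measure under linear similarities\<close>

text \<open>Scaling of norms makes the kernel trivial, and equality of dimensions turns injectivity
  into surjectivity. Domain and codomain are different types because one such map will go from
  \<open>complex \<times> complex^'N\<close> to \<open>complex^'N option\<close>.\<close>

lemma linear_similarity_surj:
  fixes T :: "'a::euclidean_space \<Rightarrow> 'b::euclidean_space"
  assumes "linear T" "\<And>x. norm (T x) = r * norm x" "r > 0" "DIM('a) = DIM('b)"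
  shows "surj T"
proof -
  have "inj T"
    using assms by (subst linear_injective_0) (auto, metis mult_eq_0_iff norm_eq_zero norm_zero
      less_irrefl)
  hence "dim (range T) = DIM('b)"
    using dim_image_eq[OF assms(1), of UNIV] assms(4) by (simp add: dim_UNIV)
  hence "span (range T) = UNIV" by (simp add: dim_eq_full)
  moreover have "subspace (range T)" using assms(1) by (simp add: linear_subspace_image)
  ultimately show ?thesis by (metis span_eq_iff)
qed

text \<open>The uniqueness argument for Haar measure: integrating \<open>1\<^sub>A(y) 1\<^sub>B(T x - y)\<close> in both orders
  compares Lebesgue measure with its image under \<open>T\<close>, and the unit ball fixes the constant.\<close>

lemma distr_lborel_similarity:
  fixes T :: "'a::euclidean_space \<Rightarrow> 'b::euclidean_space"
  assumes "linear T" "\<And>x. norm (T x) = r * norm x" "r > 0" "DIM('a) = DIM('b)"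
  shows "distr lborel borel T = density lborel (\<lambda>_. ennreal (1 / r ^ DIM('a)))"
proof (rule measure_eqI)
  show "sets (distr lborel borel T) = sets (density lborel (\<lambda>_. ennreal (1 / r ^ DIM('a))))"
    by simp
next
  fix A assume "A \<in> sets (distr lborel borel T)"
  hence A[measurable]: "A \<in> sets borel" by simp
  have T[measurable]: "T \<in> borel_measurable borel"
    using assms(1) by (intro borel_measurable_continuous_onI linear_continuous_on) (simp add:
      linear_conv_bounded_linear)
  define B where "B = ball (0::'b) 1"
  have B[measurable]: "B \<in> sets borel" by (simp add: B_def)
  define \<nu> where "\<nu> = (\<lambda>A. \<integral>\<^sup>+x. indicator A (T x) \<partial>(lborel::'a measure))"
  \<comment> \<open>By surjectivity the translation by \<open>y\<close> is the image of a
    translation by some \<open>x0\<close> in the domain, so it leaves the integral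
    unchanged.\<close>
  have transl: "(\<integral>\<^sup>+x. indicator X (T x - y) \<partial>(lborel::'a measure)) = \<nu> X"
    if [measurable]: "X \<in> sets borel" for X y
  proof -
    from linear_similarity_surj[OF assms] obtain x0 where x0: "y = T x0" by (metis surjD)
    have "\<nu> X = (\<integral>\<^sup>+x. indicator X (T x) \<partial>(distr lborel borel ((+) (-x0)) :: 'a measure))"
      by (simp add: lborel_distr_plus \<nu>_def)
    also have "\<dots> = (\<integral>\<^sup>+x. indicator X (T (-x0 + x)) \<partial>lborel)"
      by (subst nn_integral_distr) auto
    finally show ?thesis using linear_diff[OF assms(1)] by (simp add: x0)
  qed
  \<comment> \<open>The substitution of \<open>T x - y\<close> for \<open>y\<close> moves the
    argument \<open>T x - y\<close> from \<open>B\<close> to \<open>A\<close> in the double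
    integral.\<close>
  have reflect: "(\<integral>\<^sup>+y. f y \<partial>lborel) = (\<integral>\<^sup>+y. f (z - y) \<partial>lborel)"
    if [measurable]: "f \<in> borel_measurable borel"
    for f :: "'b \<Rightarrow> ennreal" and z
  proof -
    have "(lborel :: 'b measure) = distr lborel borel (\<lambda>y. z + (-1) *\<^sub>R y)"
      by (subst lborel_affine[of "-1" z]) (simp_all add: density_1)
    hence "(\<integral>\<^sup>+y. f y \<partial>lborel) = (\<integral>\<^sup>+y. f y \<partial>(distr lborel borel (\<lambda>y. z + (-1) *\<^sub>R y)))"
      by metis
    also have "\<dots> = (\<integral>\<^sup>+y. f (z - y) \<partial>lborel)"
      by (simp add: nn_integral_distr)
    finally show ?thesis .
  qed
  have "emeasure lborel A * \<nu> B =
    (\<integral>\<^sup>+y. (\<integral>\<^sup>+x. indicator A y * indicator B (T x - y) \<partial>(lborel::'a measure)) \<partial>lborel)"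
    by (simp add: nn_integral_cmult transl nn_integral_multc)
  also have "\<dots> = (\<integral>\<^sup>+x. (\<integral>\<^sup>+y. indicator A y * indicator B (T x - y) \<partial>lborel) \<partial>(lborel::'a measure))"
    by (rule lborel_pair.Fubini') (measurable)
  also have "\<dots> = (\<integral>\<^sup>+x. (\<integral>\<^sup>+y. indicator A (T x - y) * indicator B y \<partial>lborel) \<partial>(lborel::'a measure))"
  proof (rule nn_integral_cong)
    fix x :: 'a
    show "(\<integral>\<^sup>+y. indicator A y * indicator B (T x - y) \<partial>lborel) =
      (\<integral>\<^sup>+y. indicator A (T x - y) * indicator B y \<partial>lborel)"
      using reflect[of "\<lambda>y. indicator A y * indicator B (T x - y)" "T x"] by simp
  qed
  also have "\<dots> = (\<integral>\<^sup>+y. (\<integral>\<^sup>+x. indicator A (T x - y) * indicator B y \<partial>(lborel::'a measure)) \<partial>lborel)"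
    by (rule lborel_pair.Fubini'[symmetric]) (measurable)
  also have "\<dots> = \<nu> A * emeasure lborel B"
    by (simp add: nn_integral_cmult transl nn_integral_multc)
  finally have main: "emeasure lborel A * \<nu> B = \<nu> A * emeasure lborel B" .
  \<comment> \<open>The preimage of the unit ball is the ball of radius \<open>1/r\<close>, and the
    volume of a unit ball depends on the dimension alone, which is the same for both spaces.\<close>
  have "\<nu> B = (\<integral>\<^sup>+x. indicator (ball 0 (1/r)) x \<partial>(lborel::'a measure))"
    unfolding \<nu>_def using assms(2,3)
    by (intro nn_integral_cong) (auto simp: B_def indicator_def field_simps)
  also have "\<dots> = ennreal (1 / r ^ DIM('a)) * emeasure lborel B"
    using assms(3,4) unfolding B_def
    by (simp add: emeasure_ball ennreal_mult'[symmetric] power_divide mult.commute)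
  finally have "(ennreal (1 / r ^ DIM('a)) * emeasure lborel A) * emeasure lborel B =
    \<nu> A * emeasure lborel B"
    using main by (simp add: mult_ac)
  moreover have "emeasure lborel B \<noteq> 0" "emeasure lborel B \<noteq> \<infinity>"
    by (auto simp: B_def emeasure_ball unit_ball_vol_pos less_imp_neq[symmetric] simp flip: ennreal_0)
  ultimately have "\<nu> A = ennreal (1 / r ^ DIM('a)) * emeasure lborel A"
    by (metis ennreal_mult_cancel_left infinity_ennreal_def mult.commute)
  moreover have "emeasure (distr lborel borel T) A = \<nu> A"
    unfolding \<nu>_def by (subst nn_integral_indicator[symmetric], simp, subst nn_integral_distr) simp_all
  ultimately show "emeasure (distr lborel borel T) A =
    emeasure (density lborel (\<lambda>_. ennreal (1 / r ^ DIM('a)))) A"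
    by (simp add: emeasure_density nn_integral_cmult)
qed

corollary distr_lborel_isometry:
  fixes T :: "'a::euclidean_space \<Rightarrow> 'b::euclidean_space"
  assumes "linear T" "\<And>x. norm (T x) = norm x" "DIM('a) = DIM('b)"
  shows "distr lborel borel T = lborel"
  using distr_lborel_similarity[of T 1] assms by (simp add: density_1)

lemma borel_measurable_vec_lambda:
  fixes f :: "'a \<Rightarrow> 'n::finite \<Rightarrow> complex"
  assumes "\<And>j. (\<lambda>x. f x j) \<in> borel_measurable M"
  shows "(\<lambda>x. \<chi> j. f x j) \<in> borel_measurable M"
  using assms by (subst borel_measurable_euclidean_space) (auto simp: Basis_vec_def inner_axis)

lemma norm_vec_square: "(norm (v :: complex^'m))\<^sup>2 = (\<Sum>i\<in>UNIV. (norm (v $ i))\<^sup>2)"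
  by (simp add: norm_vec_def L2_set_def sum_nonneg)

lemma norm_scale_vec: "norm (a *s (w::complex^'m)) = norm a * norm w"
proof -
  have "(norm (a *s w))\<^sup>2 = (norm a * norm w)\<^sup>2"
    by (simp add: norm_vec_square power_mult_distrib norm_mult sum_distrib_left)
  thus ?thesis by (simp add: power2_eq_iff_nonneg)
qed

section \<open>Splitting off one homogeneous coordinate\<close>

lemma bij_affine_index: "bij_betw (affine_index k) (UNIV :: 'N set) (- {k :: 'N option})"
proof (rule bij_betw_imageI)
  show "inj (affine_index k)" by (auto simp: inj_on_def affine_index_def split: if_splits)
  show "range (affine_index k) = - {k}"
  proof (intro equalityI subsetI)
    fix i assume "i \<in> - {k}"
    thus "i \<in> range (affine_index k)"
      by (cases i; cases k) (auto simp: affine_index_def image_iff split: if_splits)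
  qed (auto simp: affine_index_def split: if_splits)
qed

lemma sum_option_split:
  fixes f :: "'N::finite option \<Rightarrow> 'b::comm_monoid_add"
  shows "(\<Sum>i\<in>UNIV. f i) = f k + (\<Sum>j\<in>UNIV. f (affine_index k j))"
proof -
  have "(\<Sum>i\<in>UNIV. f i) = f k + (\<Sum>i\<in>-{k}. f i)"
    by (subst sum.remove[of _ k]) (auto simp: Compl_eq_Diff_UNIV)
  also have "(\<Sum>i\<in>-{k}. f i) = (\<Sum>j\<in>UNIV. f (affine_index k j))"
    by (rule sum.reindex_bij_betw[OF bij_affine_index, symmetric])
  finally show ?thesis .
qed

text \<open>For \<open>a = 1\<close> this is the normalized representative of the point of patch
  \<open>k\<close> with affine coordinates \<open>w\<close>; as a function of the pair it is the
  isometry through which Fubini's theorem is applied.\<close>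

definition join_coords :: "'N::finite option \<Rightarrow> complex \<Rightarrow> complex^'N \<Rightarrow> complex^'N option" where
  "join_coords k a w = (\<chi> i. if i = k then a else w $ inv_into UNIV (affine_index k) i)"

lemma affine_index_neq [simp]: "affine_index k j \<noteq> k" "k \<noteq> affine_index k j"
  by (auto simp: affine_index_def split: if_splits)

lemma join_coords_nth [simp]:
  "join_coords k a w $ k = a" "join_coords k a w $ affine_index k j = w $ j"
  using bij_affine_index[of k] by (auto simp: join_coords_def bij_betw_def inv_f_f)

lemma vec_eq_affine:
  "v = w \<longleftrightarrow> v $ k = w $ k \<and> (\<forall>j. v $ affine_index k j = w $ affine_index k j)"
proof
  assume *: "v $ k = w $ k \<and> (\<forall>j. v $ affine_index k j = w $ affine_index k j)"
  have "v $ i = w $ i" for i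
    using * bij_affine_index[of k] by (cases "i = k") (auto simp: bij_betw_def dest!: equalityD2)
  thus "v = w" by (simp add: vec_eq_iff)
qed auto

lemma join_coords_scale: "c *s join_coords k a w = join_coords k (c * a) (c *s w)"
  by (simp add: vec_eq_affine[of _ _ k])

lemma norm_join_coords: "(norm (join_coords k a w))\<^sup>2 = (norm a)\<^sup>2 + (norm w)\<^sup>2"
  by (simp add: norm_vec_square sum_option_split[of _ k])

lemma linear_join_coords: "linear (\<lambda>p. join_coords k (fst p) (snd p))"
  by (rule linearI) (auto simp: vec_eq_affine[of _ _ k])

lemma card_option_type: "CARD('N::finite option) = CARD('N) + 1"
  by (simp add: UNIV_option_conv card_image)

text \<open>The product measure is Lebesgue measure on pairs, and |(a, w)|^2 = |a|^2 + |w|^2 there,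
  so the map is a linear isometry between spaces of real dimension 2 + 2N.\<close>

lemma distr_lborel_join_coords:
  "distr (lborel \<Otimes>\<^sub>M lborel) borel (\<lambda>p. join_coords (k :: 'N::finite option) (fst p) (snd p)) = lborel"
proof -
  have "norm (join_coords k (fst p) (snd p)) = norm p" for p :: "complex \<times> (complex^'N)"
    using norm_join_coords[of k "fst p" "snd p"]
    by (metis (no_types) norm_Pair norm_ge_zero prod.collapse real_sqrt_unique)
  thus ?thesis
    unfolding lborel_prod by (intro distr_lborel_isometry linear_join_coords) (auto simp:
      card_option_type)
qed

text \<open>Multiplication by \<open>a\<close> is a similarity of ratio |a| on a space of real
  dimension 2n, which yields the factor without a determinant.\<close>

lemma nn_integral_scale:
  fixes f :: "complex^'n \<Rightarrow> ennreal"
  assumes [measurable]: "f \<in> borel_measurable borel" and a: "a \<noteq> 0"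
  shows "(\<integral>\<^sup>+w. f w \<partial>lborel) = ennreal (norm a ^ (2 * CARD('n))) * (\<integral>\<^sup>+w. f (a *s w) \<partial>lborel)"
proof -
  have lin: "linear ((*s) a)"
    by (rule linearI) (auto simp: vec_eq_iff algebra_simps)
  have [measurable]: "(*s) a \<in> borel_measurable borel"
    using lin by (intro borel_measurable_continuous_onI linear_continuous_on) (simp add:
      linear_conv_bounded_linear)
  define r where "r = norm a ^ (2 * CARD('n))"
  have r: "r > 0" using a by (simp add: r_def)
  have distr: "distr lborel borel ((*s) a) = density lborel (\<lambda>_::complex^'n. ennreal (1 / r))"
    using distr_lborel_similarity[of "(*s) a" "norm a", OF lin norm_scale_vec] a
      by (simp add: r_def mult.commute)
  have "(\<integral>\<^sup>+w. f (a *s w) \<partial>lborel) = (\<integral>\<^sup>+w. f w \<partial>distr lborel borel ((*s) a))"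
    by (subst nn_integral_distr) simp_all
  also have "\<dots> = ennreal (1 / r) * (\<integral>\<^sup>+w. f w \<partial>lborel)"
    unfolding distr by (simp add: nn_integral_density nn_integral_cmult)
  finally have "ennreal r * (\<integral>\<^sup>+w. f (a *s w) \<partial>lborel) =
    (ennreal r * ennreal (1 / r)) * (\<integral>\<^sup>+w. f w \<partial>lborel)"
    by (simp add: mult.assoc)
  thus ?thesis using r by (simp add: r_def[symmetric] ennreal_mult'[symmetric])
qed

lemma nn_integral_scale_complex:
  fixes f :: "complex \<Rightarrow> ennreal"
  assumes [measurable]: "f \<in> borel_measurable borel" and r: "r > 0"
  shows "(\<integral>\<^sup>+w. f w \<partial>lborel) = ennreal (r\<^sup>2) * (\<integral>\<^sup>+w. f (of_real r * w) \<partial>lborel)"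
proof -
  have "(\<integral>\<^sup>+w. f w \<partial>lborel) = (\<integral>\<^sup>+w. f w \<partial>density (distr lborel borel (\<lambda>x. 0 + r *\<^sub>R x)) (\<lambda>_.
    ennreal (\<bar>r\<bar> ^ DIM(complex))))"
    using r by (subst lborel_affine[of r 0]) auto
  also have "\<dots> = ennreal (r\<^sup>2) * (\<integral>\<^sup>+w. f (of_real r * w) \<partial>lborel)"
    using r by (simp add: nn_integral_density nn_integral_cmult nn_integral_distr
      scaleR_conv_of_real power2_abs del: power_abs)
  finally show ?thesis .
qed

section \<open>The image of Lebesgue measure on the unit ball in an affine chart\<close>

definition quotient_coords :: "'N::finite option \<Rightarrow> complex^'N option \<Rightarrow> complex^'N" where
  "quotient_coords k v = (\<chi> j. v $ affine_index k j / v $ k)"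

lemma measurable_vec_nth [measurable]: "(\<lambda>v. v $ i) \<in> borel_measurable (borel :: (complex^'m) measure)"
  by (intro borel_measurable_continuous_onI continuous_intros)

lemma measurable_quotient_coords [measurable]: "quotient_coords k \<in> borel_measurable borel"
  unfolding quotient_coords_def[abs_def] by (intro borel_measurable_vec_lambda) measurable

text \<open>What remains of the integral over the split-off coordinate after rescaling. Its value is
  pi/(n+1); it enters the proof through its being finite and positive.\<close>

definition disc_moment :: "nat \<Rightarrow> ennreal" where
  "disc_moment n = (\<integral>\<^sup>+b. ennreal (norm (b :: complex) ^ (2 * n)) * indicator (ball 0 1) b \<partial>lborel)"

lemma disc_moment_finite: "disc_moment n < \<infinity>"
proof -
  have "disc_moment n \<le> (\<integral>\<^sup>+b. indicator (ball (0::complex) 1) b \<partial>lborel)"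
    unfolding disc_moment_def
    by (intro nn_integral_mono) (auto simp: indicator_def intro!: power_le_one)
  also have "\<dots> < \<infinity>" using emeasure_lborel_ball_finite by simp
  finally show ?thesis .
qed

text \<open>Split the ball as \<open>(a, u)\<close> with \<open>a = z\<^sub>k\<close>, substitute \<open>u = a w\<close>
  for fixed \<open>a\<close>, exchange the integrals,
  and rescale \<open>a\<close> by \<open>sqrt (1 + \<bar>w\<bar>\<^sup>2)\<close>; what remains of the \<open>a\<close>-integral is a constant.\<close>

lemma distr_ball_quotient_coords:
  "distr (density lborel (indicator (ball 0 1))) borel (quotient_coords (k :: 'N::finite option)) =
   density lborel (\<lambda>w. ennreal (enn2real (disc_moment CARD('N)) / (1 + (norm w)\<^sup>2) ^ (CARD('N) + 1)))"
  (is "?L = ?R")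
proof (rule measure_eqI)
  fix A assume "A \<in> sets ?L"
  hence [measurable]: "A \<in> sets borel" by simp
  let ?n = "CARD('N)"
  have [measurable]: "(indicator (ball 0 1) :: complex \<Rightarrow> ennreal) \<in> borel_measurable borel"
    by (simp add: borel_measurable_indicator)
  have [measurable]: "(indicator (ball 0 1) :: complex^'N option \<Rightarrow> ennreal) \<in> borel_measurable borel"
    by (simp add: borel_measurable_indicator)
  have [measurable]: "(\<lambda>p::complex \<times> (complex^'N). join_coords k (fst p) (snd p)) \<in> borel_measurable
    borel"
    using linear_join_coords[of k]
      by (intro borel_measurable_continuous_onI linear_continuous_on) (simp add:
        linear_conv_bounded_linear)
  \<comment> \<open>Membership in the ball is expressed by squared norms, so that after the
    substitution it reads |a|^2 (1 + |w|^2) < 1.\<close>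
  have ball: "indicator (ball 0 1) (join_coords k a w) =
    (indicator {..<1} ((norm a)\<^sup>2 + (norm w)\<^sup>2) :: ennreal)" for a w
    using norm_join_coords[of k a w]
      by (simp add: indicator_def power_less_one_iff) (metis norm_ge_zero one_power2
        power2_less_imp_less power_strict_mono zero_less_one_class.zero_le_one zero_less_numeral)
  have quot: "quotient_coords k (join_coords k a (a *s w)) = w" if "a \<noteq> 0" for a w
    using that by (simp add: quotient_coords_def vec_eq_iff)
  have "emeasure ?L A = (\<integral>\<^sup>+z. indicator (ball 0 1) z * indicator A (quotient_coords k z) \<partial>lborel)"
    by (subst nn_integral_indicator[symmetric], simp, subst nn_integral_distr, simp, simp, subst
      nn_integral_density) (simp_all add: borel_measurable_indicator)
  also have "\<dots> = (\<integral>\<^sup>+p. indicator (ball 0 1) (join_coords k (fst p) (snd p)) * indicator A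
    (quotient_coords k (join_coords k (fst p) (snd p))) \<partial>(lborel \<Otimes>\<^sub>M lborel))"
    by (subst distr_lborel_join_coords[of k, symmetric], subst nn_integral_distr) (auto simp:
      lborel_prod)
  also have "\<dots> = (\<integral>\<^sup>+a. (\<integral>\<^sup>+w. indicator (ball 0 1) (join_coords k a w) * indicator A
    (quotient_coords k (join_coords k a w)) \<partial>lborel) \<partial>lborel)"
    by (subst lborel.nn_integral_fst[symmetric]) (auto simp: lborel_prod)
  also have "\<dots> = (\<integral>\<^sup>+a. (\<integral>\<^sup>+w. ennreal (norm a ^ (2 * ?n)) * (indicator {..<1} ((norm a)\<^sup>2 * (1 +
    (norm w)\<^sup>2)) * indicator A w) \<partial>lborel) \<partial>(lborel :: complex measure))"
  proof (rule nn_integral_cong_AE)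
    \<comment> \<open>The substitution divides by \<open>a\<close>, so the null set
      \<open>a = 0\<close> is discarded first.\<close>
    have "AE a in (lborel :: complex measure). a \<noteq> 0" by (rule AE_lborel_singleton)
    thus "AE a in lborel. (\<integral>\<^sup>+w. indicator (ball 0 1) (join_coords k a w) * indicator A
      (quotient_coords k (join_coords k a w)) \<partial>lborel) =
       (\<integral>\<^sup>+w. ennreal (norm a ^ (2 * ?n)) * (indicator {..<1} ((norm a)\<^sup>2 * (1 + (norm w)\<^sup>2)) *
         indicator A w) \<partial>lborel)"
    proof eventually_elim
      case (elim a)
      have [measurable]: "join_coords k a \<in> borel_measurable borel"
        unfolding join_coords_def[abs_def] by (intro borel_measurable_vec_lambda) measurable
      show ?case using elim
        by (subst nn_integral_scale[of _ a])
          (simp_all add: ball quot norm_scale_vec power_mult_distrib distrib_left nn_integral_cmult)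
    qed
  qed
  also have "\<dots> = (\<integral>\<^sup>+w. (\<integral>\<^sup>+a. ennreal (norm a ^ (2 * ?n)) * (indicator {..<1} ((norm a)\<^sup>2 * (1 +
    (norm w)\<^sup>2)) * indicator A w) \<partial>(lborel::complex measure)) \<partial>lborel)"
    by (rule lborel_pair.Fubini') measurable
  also have "\<dots> = (\<integral>\<^sup>+w. ennreal (enn2real (disc_moment ?n) / (1 + (norm w)\<^sup>2) ^ (?n + 1)) *
    indicator A w \<partial>lborel)"
  proof (rule nn_integral_cong)
    fix w :: "complex^'N"
    define S where "S = 1 + (norm w)\<^sup>2"
    have S: "S > 0" by (simp add: S_def add_pos_nonneg)
    \<comment> \<open>Chosen with \<open>r\<^sup>2 * S = 1\<close>: the condition on
      \<open>of_real r * b\<close> then says that \<open>b\<close> lies in the unit disc.\<close>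
    define r where "r = 1 / sqrt S"
    have r: "r > 0" "r\<^sup>2 = 1 / S" using S by (auto simp: r_def power_divide)
    have "(\<integral>\<^sup>+a. ennreal (norm a ^ (2 * ?n)) * indicator {..<1} ((norm a)\<^sup>2 * S) \<partial>(lborel::complex
      measure))
      = ennreal (r\<^sup>2) * (\<integral>\<^sup>+b. ennreal (norm (of_real r * b) ^ (2 * ?n)) * indicator {..<1} ((norm
        (of_real r * b))\<^sup>2 * S) \<partial>(lborel::complex measure))"
      by (subst nn_integral_scale_complex[OF _ r(1)]) auto
    also have "(\<integral>\<^sup>+b. ennreal (norm (of_real r * b) ^ (2 * ?n)) * indicator {..<1} ((norm (of_real r
      * b))\<^sup>2 * S) \<partial>(lborel::complex measure))
      = (\<integral>\<^sup>+b. ennreal (r ^ (2 * ?n)) * (ennreal (norm b ^ (2 * ?n)) * indicator (ball 0 1) b)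
        \<partial>(lborel::complex measure))"
    proof (rule nn_integral_cong)
      fix b :: complex
      have "(norm (of_real r * b))\<^sup>2 * S = (norm b)\<^sup>2" using S r
        by (simp add: norm_mult power_mult_distrib)
      thus "ennreal (norm (of_real r * b) ^ (2 * ?n)) * indicator {..<1} ((norm (of_real r * b))\<^sup>2 *
        S) = 
        ennreal (r ^ (2 * ?n)) * (ennreal (norm b ^ (2 * ?n)) * indicator (ball 0 1) b)"
        using r by (simp add: norm_mult power_mult_distrib ennreal_mult' indicator_def
          power_less_one_iff abs_square_less_1)
    qed
    also have "\<dots> = ennreal (r ^ (2 * ?n)) * disc_moment ?n"
      unfolding disc_moment_def by (rule nn_integral_cmult) measurable
    also have "disc_moment ?n = ennreal (enn2real (disc_moment ?n))"
      using disc_moment_finite[of ?n] by simp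
    \<comment> \<open>Origin of the exponent N + 1: rescaling the area gives 1/S, and the factor
      |a|^(2N) gives 1/S^N.\<close>
    also have "ennreal (r\<^sup>2) * (ennreal (r ^ (2 * ?n)) * \<dots>) =
      ennreal (enn2real (disc_moment ?n) / S ^ (?n + 1))"
      using S r(1) unfolding power_mult r(2)
        by (simp add: ennreal_mult'[symmetric] power_one_over mult.commute)
    finally show "(\<integral>\<^sup>+a. ennreal (norm a ^ (2 * ?n)) * (indicator {..<1} ((norm a)\<^sup>2 * (1 + (norm
      w)\<^sup>2)) * indicator A w) \<partial>(lborel::complex measure)) = 
      ennreal (enn2real (disc_moment ?n) / (1 + (norm w)\<^sup>2) ^ (?n + 1)) * indicator A w"
      by (simp add: S_def[symmetric] mult.assoc[symmetric] nn_integral_multc)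
  qed
  also have "\<dots> = emeasure ?R A"
    by (simp add: emeasure_density)
  finally show "emeasure ?L A = emeasure ?R A" .
qed simp

text \<open>A vanishing moment would make the image measure of the ball zero, hence the ball itself
  a null set.\<close>

lemma disc_moment_pos: "enn2real (disc_moment CARD('N::finite)) > 0"
proof (rule ccontr)
  assume "\<not> ?thesis"
  hence "enn2real (disc_moment CARD('N)) = 0"
    using enn2real_nonneg[of "disc_moment CARD('N)"] by linarith
  hence "emeasure (distr (density lborel (indicator (ball 0 1))) borel (quotient_coords (None :: 'N
    option))) UNIV = 0"
    unfolding distr_ball_quotient_coords by (simp add: emeasure_density)
  hence "emeasure lborel (ball (0 :: complex^'N option) 1) = 0"
    by (simp add: emeasure_distr emeasure_density borel_measurable_indicator)
  thus False
    using unit_ball_vol_pos[of "2 + real CARD('N) * 2"] by (simp add: emeasure_ball)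
qed

text \<open>The left side is the shape of a chart integral, while the right side lives on the ball
  for every \<open>k\<close>. This brings the integrals over different patches to a common
  domain.\<close>

lemma integral_quotient_coords:
  fixes g :: "complex^'N::finite \<Rightarrow> 'b::{banach, second_countable_topology}"
  assumes [measurable]: "g \<in> borel_measurable borel"
  shows "(LINT w|lborel. (1 / (1 + (norm w)\<^sup>2) ^ (CARD('N) + 1)) *\<^sub>R g w) =
    (1 / enn2real (disc_moment CARD('N))) *\<^sub>R (LINT z:ball 0 1|lborel. g (quotient_coords k z))"
proof -
  let ?C = "enn2real (disc_moment CARD('N))"
  have "(LINT z:ball 0 1|lborel. g (quotient_coords k z)) =
    (LINT w|(distr (density lborel (\<lambda>z. ennreal (indicator (ball 0 1) z))) borel (quotient_coords
      k)). g w)"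
    by (subst integral_distr, simp, simp, subst integral_density) (simp_all add:
      set_lebesgue_integral_def borel_measurable_indicator)
  also have "\<dots> = (LINT w|density lborel (\<lambda>w. ennreal (?C / (1 + (norm w)\<^sup>2) ^ (CARD('N) + 1))). g w)"
    by (subst distr_ball_quotient_coords[symmetric]) (simp add: ennreal_indicator)
  also have "\<dots> = (LINT w|lborel. (?C / (1 + (norm w)\<^sup>2) ^ (CARD('N) + 1)) *\<^sub>R g w)"
    by (subst integral_density) auto
  also have "\<dots> = ?C *\<^sub>R (LINT w|lborel. (1 / (1 + (norm w)\<^sup>2) ^ (CARD('N) + 1)) *\<^sub>R g w)"
    by (subst integral_scaleR_right[symmetric]) simp
  finally show ?thesis using disc_moment_pos[where 'N='N] by simp
qed

section \<open>The Fubini-Study density\<close>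

text \<open>Row \<open>k\<close> is \<open>v\<close> itself, so multiples of \<open>v\<close> in
  other rows do not affect the determinant: splitting row \<open>m\<close> by additivity leaves a
  summand with two equal rows.\<close>

lemma det_unit_rows_replace_row:
  fixes u v :: "'a::field^'n"
  assumes "finite S" "k \<notin> S"
  shows "det (\<chi> i. if i = k then v else if i \<in> S then axis i 1 + u $ i *s v else axis i 1) = v $ k"
  using assms
proof (induction S)
  case empty
  \<comment> \<open>Cramer's rule for the identity matrix: replacing its row \<open>k\<close> by
    \<open>v\<close> gives determinant \<open>v $ k\<close>.\<close>
  have *: "(\<chi> i. if i = k then (\<Sum>i\<in>UNIV. v$i *s row i (mat 1 :: 'a^'n^'n)) else row i (mat 1)) =
    (\<chi> i. if i = k then v else axis i 1)"
    by (auto simp: vec_eq_iff row_def mat_def axis_def sum.delta if_distrib cong: if_cong)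
  show ?case using cramer_lemma_transpose[of k v "mat 1"] unfolding * by (simp cong: if_cong)
next
  case (insert m S)
  let ?R = "\<lambda>i. if i = k then v else if i \<in> S then axis i 1 + u $ i *s v else axis i 1"
  have "det (\<chi> i. if i = k then v else if i \<in> insert m S then axis i 1 + u $ i *s v else axis i 1)
      = det (\<chi> i. if i = m then axis i 1 + u $ i *s v else ?R i)"
    using insert by (intro arg_cong[where f = det]) (auto simp: vec_eq_iff)
  also have "\<dots> = det (\<chi> i. if i = m then axis i 1 else ?R i) + det (\<chi> i. if i =
    m then u $ m *s v else ?R i)"
    using det_row_add[of m "\<lambda>i. axis i 1" "\<lambda>i. u $ i *s v" ?R] 
    by (simp cong: if_cong)
  also have "det (\<chi> i. if i = m then u $ m *s v else ?R i) = u $ m * det (\<chi> i. if i =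
    m then v else ?R i)"
    by (rule det_row_mul)
  also have "det (\<chi> i. if i = m then v else ?R i) = 0"
    by (rule det_identical_rows[of k m]) (use insert in \<open>auto simp: row_def vec_eq_iff\<close>)
  also have "det (\<chi> i. if i = m then axis i 1 else ?R i) = det (\<chi> i. ?R i)"
    using insert.hyps insert.prems by (intro arg_cong[where f = det]) (auto simp: vec_eq_iff)
  also have "\<dots> = v $ k" using insert by simp
  finally show ?case by simp
qed

text \<open>The matrix determinant lemma. The induction is over the set of rows already perturbed;
  perturbing row \<open>m\<close> adds \<open>u $ m\<close> times a determinant in which row
  \<open>m\<close> is \<open>v\<close>, evaluated by the previous lemma.\<close>

lemma det_rank_one_update:
  fixes u v :: "'a::field^'n"
  shows "det (\<chi> i j. (if i = j then 1 else 0) + u $ i * v $ j) = 1 + (\<Sum>i\<in>UNIV. u $ i * v $ i)"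
proof -
  have "det (\<chi> i. if i \<in> S then axis i 1 + u $ i *s v else axis i 1) = 1 + (\<Sum>i\<in>S. u $ i * v $ i)"
    for S :: "'n set"
    using finite[of S]
  proof (induction S)
    case empty
    have "(\<chi> i. axis i 1) = (mat 1 :: 'a^'n^'n)" by (auto simp: vec_eq_iff axis_def mat_def)
    thus ?case by simp
  next
    case (insert m S)
    let ?R = "\<lambda>i. if i \<in> S then axis i 1 + u $ i *s v else axis i 1"
    have "det (\<chi> i. if i \<in> insert m S then axis i 1 + u $ i *s v else axis i 1)
        = det (\<chi> i. if i = m then axis i 1 + u $ i *s v else ?R i)"
      by (intro arg_cong[where f = det]) (auto simp: vec_eq_iff)
    also have "\<dots> = det (\<chi> i. if i = m then axis i 1 else ?R i) + det (\<chi> i. if i =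
      m then u $ m *s v else ?R i)"
      using det_row_add[of m "\<lambda>i. axis i 1" "\<lambda>i. u $ i *s v" ?R] 
      by (simp cong: if_cong)
    also have "det (\<chi> i. if i = m then u $ m *s v else ?R i) = u $ m * det (\<chi> i. if i =
      m then v else ?R i)"
      by (rule det_row_mul)
    also have "det (\<chi> i. if i = m then v else ?R i) = v $ m"
      using insert by (subst det_unit_rows_replace_row[where S = S and k = m and u = u, symmetric])
        (auto intro!: arg_cong[where f = det] simp: vec_eq_iff)
    also have "det (\<chi> i. if i = m then axis i 1 else ?R i) = det (\<chi> i. ?R i)"
      using insert.hyps by (intro arg_cong[where f = det]) (auto simp: vec_eq_iff)
    finally show ?case using insert by simp
  qed
  from this[of UNIV] show ?thesis
    by (simp add: axis_def plus_vec_def vector_scalar_mult_def eq_commute cong: if_cong)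
qed

text \<open>Permuting the rows by \<sigma> multiplies the determinant by its sign, which cancels the
  prefactor, so each inner sum is \<open>det g\<close>. The resulting factorial cancels the one in
  \<open>liouville_density\<close>.\<close>

lemma sum_permutations_det:
  fixes g :: "complex^'n^'n"
  shows "(\<Sum>\<sigma> | \<sigma> permutes (UNIV :: 'n set). \<Sum>\<tau> | \<tau> permutes (UNIV :: 'n set).
           of_int (sign \<sigma> * sign \<tau>) * (\<Prod>l\<in>UNIV. g $ \<sigma> l $ \<tau> l)) = fact CARD('n) * det g"
proof -
  have "(\<Sum>\<tau> | \<tau> permutes (UNIV :: 'n set).
           of_int (sign \<sigma> * sign \<tau>) * (\<Prod>l\<in>UNIV. g $ \<sigma> l $ \<tau> l)) = det g"
             if "\<sigma> permutes (UNIV :: 'n set)" for \<sigma>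
  proof -
    have "(\<Sum>\<tau> | \<tau> permutes (UNIV :: 'n set).
           of_int (sign \<sigma> * sign \<tau>) * (\<Prod>l\<in>UNIV. g $ \<sigma> l $ \<tau> l)) = of_int (sign \<sigma>) * det (\<chi> i. g $ \<sigma> i)"
      by (simp add: det_def sum_distrib_left mult_ac)
    also have "\<dots> = of_int (sign \<sigma> * sign \<sigma>) * det g"
      using det_permute_rows[of \<sigma> g] that by (simp only: of_int_mult mult.assoc)
    finally show ?thesis by (simp only: sign_idempotent) simp
  qed
  thus ?thesis by (simp add: card_permutations)
qed

text \<open>The coefficients of \<open>fubini_study\<close> as a function of the affine coordinates,
  through which alone the chart enters.\<close>

definition fs_matrix :: "complex^'n \<Rightarrow> complex^'n^'n" where
  "fs_matrix w = (\<chi> j k. wirtinger j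
     (wirtinger_bar k (\<lambda>w. complex_of_real (ln (1 + (norm w)\<^sup>2)))) w)"

section \<open>Second derivatives of the potential log(1 + |w|^2)\<close>

lemma inner_axis_complex:
  fixes w :: "complex^'n"
  shows "w \<bullet> axis k c = Re (w $ k) * Re c + Im (w $ k) * Im c"
  by (simp add: inner_axis inner_complex_def)

lemma wirtinger_bar_log:
  fixes w :: "complex^'n"
  shows "wirtinger_bar k (\<lambda>w. complex_of_real (ln (1 + (norm w)\<^sup>2))) w =
    w $ k / of_real (1 + (norm w)\<^sup>2)"
proof -
  define S where "S = 1 + (norm w)\<^sup>2"
  have S: "S = 1 + w \<bullet> w" by (simp add: S_def power2_norm_eq_inner)
  have pos: "S > 0" by (simp add: S add_pos_nonneg)
  have "((\<lambda>w. complex_of_real (ln (1 + w \<bullet> w))) has_derivative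
     (\<lambda>h. complex_of_real (2 * (w \<bullet> h) / S))) (at w)"
    using pos unfolding S by (auto intro!: derivative_eq_intros simp: inner_commute field_simps)
  hence fd: "frechet_derivative (\<lambda>w. complex_of_real (ln (1 + (norm w)\<^sup>2))) (at w) =
     (\<lambda>h. complex_of_real (2 * (w \<bullet> h) / S))"
    by (intro frechet_derivative_at[symmetric]) (simp add: power2_norm_eq_inner)
  have "w $ k / of_real S = (complex_of_real (2 * Re (w $ k) / S) + \<i> * complex_of_real (2 * Im (w $
    k) / S)) / 2"
    by (simp add: complex_eq_iff)
  thus ?thesis
    by (simp only: wirtinger_bar_def fd inner_axis_complex S_def[symmetric]) simp
qed

lemma fs_matrix_eq:
  fixes w :: "complex^'n"
  shows "fs_matrix w $ j $ k = ((if j =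
    k then 1 else 0) - cnj (w $ j) * w $ k / of_real (1 + (norm w)\<^sup>2)) / of_real (1 + (norm w)\<^sup>2)"
proof -
  define S where "S = 1 + (norm w)\<^sup>2"
  have S: "S = 1 + w \<bullet> w" by (simp add: S_def power2_norm_eq_inner)
  have pos: "S > 0" by (simp add: S add_pos_nonneg)
  have 1: "((\<lambda>w. w $ k) has_derivative (\<lambda>h. h $ k)) (at w)"
    by (simp add: bounded_linear_imp_has_derivative bounded_linear_vec_nth)
  have 2: "((\<lambda>w. complex_of_real (1 + (norm w)\<^sup>2)) has_derivative (\<lambda>h. of_real (2 * (w \<bullet> h)))) (at w)"
    unfolding power2_norm_eq_inner by (auto intro!: derivative_eq_intros simp: inner_commute)
  have "((\<lambda>w. w $ k / complex_of_real (1 + (norm w)\<^sup>2)) has_derivative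
     (\<lambda>h. (h $ k * of_real S - w $ k * of_real (2 * (w \<bullet> h))) / (of_real S * of_real S))) (at w)"
    using has_derivative_divide'[OF 1 2] pos unfolding S_def[symmetric] by simp
  hence fd: "frechet_derivative (\<lambda>w. w $ k / complex_of_real (1 + (norm w)\<^sup>2)) (at w) =
     (\<lambda>h. (h $ k * of_real S - w $ k * of_real (2 * (w \<bullet> h))) / (of_real S * of_real S))"
    by (rule frechet_derivative_at[symmetric])
  have cj: "cnj (w $ j) = of_real (Re (w $ j)) - \<i> * of_real (Im (w $ j))"
    by (simp add: complex_eq_iff)
  have wbar: "wirtinger_bar k (\<lambda>w. complex_of_real (ln (1 + (norm w)\<^sup>2))) =
    (\<lambda>w::complex^'n. w $ k / of_real (1 + (norm w)\<^sup>2))"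
    by (rule ext) (rule wirtinger_bar_log)
  have "fs_matrix w $ j $ k = ((axis j 1 $ k * of_real S - w $ k * of_real (2 * Re (w $ j))) /
    (of_real S * of_real S)
     - \<i> * ((axis j \<i> $ k * of_real S - w $ k * of_real (2 * Im (w $ j))) / (of_real S * of_real
       S))) / 2"
    by (simp only: fs_matrix_def wbar wirtinger_def fd inner_axis_complex vec_lambda_beta) simp
  also have "\<dots> = ((if j = k then 1 else 0) - cnj (w $ j) * w $ k / of_real S) / of_real S"
  proof -
    \<comment> \<open>\<open>R\<close> and \<open>I\<close> stand for the real and imaginary part of
      \<open>w $ j\<close>; the derivatives in the directions 1 and \<open>\<i>\<close> recombine to
      its conjugate \<open>R - \<i> * I\<close>.\<close>
    have alg: "((d * s - W * (2 * R)) / (s * s) - \<i> * ((d * \<i> * s - W * (2 * I)) / (s * s))) / 2 =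
      (d - (R - \<i> * I) * W / s) / s"
      if "s \<noteq> 0" for d s W R I :: complex
    proof -
      have "(d * s - W * (2 * R)) - \<i> * (d * \<i> * s - W * (2 * I)) = 2 * (d * s - (R - \<i> * I) * W)"
        by (simp add: algebra_simps)
      hence "((d * s - W * (2 * R)) / (s * s) - \<i> * ((d * \<i> * s - W * (2 * I)) / (s * s))) / 2 =
        (2 * (d * s - (R - \<i> * I) * W)) / (s * s) / 2"
        by (metis diff_divide_distrib times_divide_eq_right)
      also have "\<dots> = (d - (R - \<i> * I) * W / s) / s"
        using that by (simp add: diff_divide_distrib)
      finally show ?thesis .
    qed
    have ax: "axis j \<i> $ k = (if j = k then 1 else 0) * \<i>" "axis j 1 $ k = (if j =
      k then 1 else (0::complex))"
      by (auto simp: axis_def)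
    show ?thesis unfolding cj ax of_real_mult of_real_numeral
      by (rule alg) (use pos in simp)
  qed
  finally show ?thesis by (simp only: S_def)
qed

text \<open>With S = 1 + |w|^2 the matrix is 1/S times a rank one perturbation of the identity,
  whose determinant is 1 - |w|^2/S = 1/S. This is one factor 1/S on top of the N from the scaling of
  the rows, N being the size of the matrix.\<close>

lemma det_fs_matrix:
  fixes w :: "complex^'n"
  shows "det (fs_matrix w) = of_real (1 / (1 + (norm w)\<^sup>2) ^ (CARD('n) + 1))"
proof -
  define S where "S = 1 + (norm w)\<^sup>2"
  have pos: "S > 0" by (simp add: S_def add_pos_nonneg)
  have nw: "(\<Sum>i\<in>UNIV. cnj (w $ i) * w $ i) = of_real (S - 1)"
  proof -
    have "complex_of_real ((norm w)\<^sup>2) = (\<Sum>i\<in>UNIV. cnj (w $ i) * w $ i)"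
      by (simp only: norm_vec_square of_real_sum complex_norm_square mult.commute)
    thus ?thesis by (simp add: S_def)
  qed
  have "fs_matrix w = (\<chi> i. (1 / of_real S) *s (\<chi> j. (if i =
    j then 1 else 0) + (- cnj (w $ i) / of_real S) * w $ j))"
  proof -
    have "(d - c * x / s) / s = 1 / s * (d + - c / s * x)" for d c x s :: complex by simp
    thus ?thesis by (simp add: vec_eq_iff fs_matrix_eq[of w, folded S_def] del: of_real_add)
  qed
  hence "det (fs_matrix w) = (1 / of_real S) ^ CARD('n) *
     det (\<chi> i j. (if i = j then 1 else 0) + (\<chi> i. - cnj (w $ i) / of_real S) $ i * w $ j)"
    by (simp add: det_rows_mul)
  also have "\<dots> = (1 / of_real S) ^ CARD('n) * (1 - (\<Sum>i\<in>UNIV. cnj (w $ i) * w $ i) / of_real S)"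
    unfolding det_rank_one_update by (simp add: sum_negf sum_divide_distrib)
  also have "\<dots> = of_real (1 / S ^ (CARD('n) + 1))"
  proof -
    have "1 - complex_of_real (S - 1) / of_real S = 1 / of_real S" using pos
      by (simp add: diff_divide_distrib)
    thus ?thesis unfolding nw by (simp add: power_one_over)
  qed
  finally show ?thesis by (simp add: S_def)
qed

lemma liouville_density_fubini_study:
  fixes c :: "((complex^'N::finite option) set, 'N) chart"
  shows "liouville_density fubini_study c p = 2 ^ CARD('N) / (1 + (norm (snd c p))\<^sup>2) ^ (CARD('N) + 1)"
proof -
  have fs: "fubini_study c p = fs_matrix (snd c p)"
    by (simp add: fubini_study_def fs_matrix_def)
  have re: "Re (fact n * of_real r) = fact n * r" for n and r :: real
    by (metis Re_complex_of_real of_real_fact of_real_mult)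
  show ?thesis
    unfolding liouville_density_def fs sum_permutations_det det_fs_matrix re by simp
qed

section \<open>Projective space and integration over it\<close>

lemma smult_vec_eq_0_iff: "c *s (v::complex^'m) = 0 \<longleftrightarrow> c = 0 \<or> v = 0"
  by (metis norm_eq_zero norm_scale_vec mult_eq_0_iff)

lemma mem_line: "u \<in> line v \<longleftrightarrow> (\<exists>c. u = c *s v)"
  by (auto simp: line_def)

lemma self_mem_line [simp]: "v \<in> line v"
  unfolding mem_line by (rule exI[of _ 1]) simp

lemma line_scale: "c \<noteq> 0 \<Longrightarrow> line (c *s v) = line v"
  unfolding line_def
proof (intro equalityI subsetI)
  fix u assume "c \<noteq> 0" "u \<in> range (\<lambda>d. d *s v)"
  then obtain d where "u = (d / c) *s (c *s v)" by auto
  thus "u \<in> range (\<lambda>d. d *s (c *s v))" by blast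
qed auto

lemma line_in_proj_points [simp]: "v \<noteq> 0 \<Longrightarrow> line v \<in> proj_points"
  by (auto simp: proj_points_def)

lemma line_0: "line 0 = {0}"
  by (auto simp: line_def)

lemma line_in_proj_points_iff: "line v \<in> proj_points \<longleftrightarrow> v \<noteq> 0"
proof
  assume "line v \<in> proj_points"
  then obtain w where "w \<noteq> 0" "line v = line w" by (auto simp: proj_points_def)
  thus "v \<noteq> 0" using self_mem_line[of w] by (auto simp: line_0)
qed simp

lemma proj_points_cases:
  assumes "l \<in> proj_points" obtains v where "v \<noteq> 0" "l = line v"
  using assms by (auto simp: proj_points_def)

lemma line_in_affine_patch: "v \<noteq> 0 \<Longrightarrow> line v \<in> affine_patch k \<longleftrightarrow> v $ k \<noteq> 0"
  using self_mem_line[of v] by (auto simp: affine_patch_def mem_line)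

lemma homog_rep_line:
  assumes "v $ k \<noteq> 0" shows "homog_rep k (line v) = (1 / v $ k) *s v"
  unfolding homog_rep_def
proof (rule the_equality)
  show "(1 / v $ k) *s v \<in> line v \<and> ((1 / v $ k) *s v) $ k = 1" using assms by (auto simp: mem_line)
next
  fix u assume "u \<in> line v \<and> u $ k = 1"
  then obtain c where c: "u = c *s v" and "u $ k = 1" unfolding mem_line by blast
  hence "c = 1 / v $ k" using assms by (simp add: field_simps)
  thus "u = (1 / v $ k) *s v" using c by simp
qed

lemma affine_coords_line: "v $ k \<noteq> 0 \<Longrightarrow> affine_coords k (line v) = quotient_coords k v"
  by (simp add: affine_coords_def homog_rep_line quotient_coords_def vec_eq_iff)

abbreviation patch_chart :: "'N::finite option \<Rightarrow> ((complex^'N option) set, 'N) chart" where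
  "patch_chart k \<equiv> (affine_patch k, affine_coords k)"

lemma join_coords_1_neq_0 [simp]: "join_coords k 1 w \<noteq> 0"
  by (metis join_coords_nth(1) zero_index zero_neq_one)

lemma quotient_coords_join [simp]: "quotient_coords k (join_coords k 1 w) = w"
  by (simp add: quotient_coords_def vec_eq_iff)

lemma join_quotient_coords: "v $ k \<noteq> 0 \<Longrightarrow> join_coords k 1 (quotient_coords k v) = (1 / v $ k) *s v"
  by (simp add: vec_eq_affine[of _ _ k] quotient_coords_def)

lemma affine_patch_cases:
  assumes "l \<in> affine_patch k" obtains w where "l = line (join_coords k 1 w)"
proof -
  from assms obtain v where v: "v \<noteq> 0" "l = line v"
    by (auto simp: affine_patch_def elim: proj_points_cases)
  hence "v $ k \<noteq> 0" using assms by (simp add: line_in_affine_patch)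
  hence "l = line (join_coords k 1 (quotient_coords k v))"
    by (simp add: join_quotient_coords line_scale v)
  thus ?thesis using that by blast
qed

lemma line_join_in_patch: "line (join_coords k 1 w) \<in> affine_patch k"
  by (simp add: line_in_affine_patch)

lemma affine_coords_line_join [simp]: "affine_coords k (line (join_coords k 1 w)) = w"
  by (simp add: affine_coords_line)

lemma inj_on_affine_coords: "inj_on (affine_coords k) (affine_patch k)"
  by (rule inj_onI) (auto elim!: affine_patch_cases)

lemma affine_coords_image: "affine_coords k ` affine_patch k = UNIV"
  using line_join_in_patch affine_coords_line_join by (metis image_eqI UNIV_eq_I)

lemma inv_affine_coords: "inv_into (affine_patch k) (affine_coords k) w = line (join_coords k 1 w)"
  using inv_into_f_f[OF inj_on_affine_coords line_join_in_patch, of k w] by simp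

lemma linear_join_coords_0: "linear (join_coords k 0)"
  by (rule linearI) (auto simp: vec_eq_affine[of _ _ k])

lemma continuous_join_coords: "continuous_on A (join_coords k a)"
proof -
  have eq: "join_coords k a = (\<lambda>w. join_coords k a 0 + join_coords k 0 w)"
    by (auto simp: vec_eq_affine[of _ _ k])
  have "continuous_on A (join_coords k 0)"
    using linear_join_coords_0[of k] by (simp add: linear_continuous_on linear_conv_bounded_linear)
  thus ?thesis by (subst eq) (intro continuous_on_add continuous_on_const)
qed

section \<open>The topology of projective space\<close>

lemma istopology_projective:
  "istopology (\<lambda>U. U \<subseteq> (proj_points :: (complex^'N::finite option) set set) \<and> open {v. v \<noteq> 0 \<and>
    line v \<in> U})"
  unfolding istopology_def
proof (intro conjI allI impI)
  fix S T :: "(complex^'N option) set set"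
  assume "S \<subseteq> proj_points \<and> open {v. v \<noteq> 0 \<and> line v \<in> S}" "T \<subseteq> proj_points \<and> open {v. v \<noteq> 0 \<and>
    line v \<in> T}"
  moreover have "{v. v \<noteq> 0 \<and> line v \<in> S \<inter> T} = {v. v \<noteq> 0 \<and> line v \<in> S} \<inter> {v. v \<noteq> 0 \<and> line v \<in> T}"
    by auto
  ultimately show "S \<inter> T \<subseteq> proj_points" "open {v. v \<noteq> 0 \<and> line v \<in> S \<inter> T}" by auto
next
  fix \<K> :: "(complex^'N option) set set set"
  assume *: "\<forall>K\<in>\<K>. K \<subseteq> proj_points \<and> open {v. v \<noteq> 0 \<and> line v \<in> K}"
  thus "\<Union> \<K> \<subseteq> proj_points" by auto
  have "{v. v \<noteq> 0 \<and> line v \<in> \<Union> \<K>} = (\<Union>K\<in>\<K>. {v. v \<noteq> 0 \<and> line v \<in> K})" by auto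
  thus "open {v. v \<noteq> 0 \<and> line v \<in> \<Union> \<K>}" using * by auto
qed

lemma openin_projective:
  "openin (mtop projective_space) U \<longleftrightarrow> U \<subseteq> proj_points \<and> open {v. v \<noteq> 0 \<and> line v \<in> U}"
  unfolding projective_space_def by (simp add: topology_inverse'[OF istopology_projective])

lemma points_projective [simp]: "points projective_space = proj_points"
proof -
  have "{v. v \<noteq> 0 \<and> line v \<in> proj_points} = (-{0} :: (complex^'a option) set)" by auto
  hence "openin (mtop projective_space) (proj_points :: (complex^'a option) set set)"
    unfolding openin_projective by (metis closed_singleton open_Compl order_refl)
  thus ?thesis by (metis openin_projective openin_topspace openin_subset subset_antisym)
qed

lemma atlas_projective: "atlas projective_space = range patch_chart"
  by (simp add: projective_space_def)

text \<open>The topology is the quotient topology of the punctured coordinate space, so continuity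
  can be tested upstairs, after composition with \<open>line\<close>.\<close>

lemma continuous_map_projective:
  fixes f :: "(complex^'N::finite option) set \<Rightarrow> 'b::topological_space"
  shows "continuous_map (mtop projective_space) euclidean f \<longleftrightarrow> continuous_on (-{0}) (\<lambda>v. f (line v))"
proof -
  have "{v. v \<noteq> 0 \<and> line v \<in> {l \<in> proj_points. f l \<in> U}} = (\<lambda>v. f (line v)) -` U \<inter> -{0}" for U by auto
  thus ?thesis
    using continuous_on_open_vimage[of "-{0}" "\<lambda>v. f (line v)"]
    by (auto simp: continuous_map openin_projective open_Compl)
qed

section \<open>Partitions of unity\<close>

lemma partition_of_unity_normalise:
  assumes "finite G"
    and G: "\<And>c g. (c, g) \<in> G \<Longrightarrow> c \<in> atlas M \<and> continuous_map (mtop M) euclideanreal g \<and>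
        (\<forall>x\<in>points M. 0 \<le> g x) \<and> mtop M closure_of {x \<in> points M. g x \<noteq> 0} \<subseteq> fst c"
    and pos: "\<And>x. x \<in> points M \<Longrightarrow> (\<Sum>(c, g)\<in>G. g x) > 0"
  shows "\<exists>P. partition_of_unity M P"
proof -
  \<comment> \<open>Off the space the sum has no known sign; the value 1 keeps \<open>S\<close>
    positive on the whole type, as the injectivity of \<open>N\<close> below requires.\<close>
  define S where "S x = (if x \<in> points M then \<Sum>(c, g)\<in>G. g x else 1)" for x
  have S: "S x > 0" for x using pos by (simp add: S_def)
  define N where "N = (\<lambda>(c :: ('a, 'b) chart, g). (c, \<lambda>x. g x / S x :: real))"
  \<comment> \<open>A partition is a set of pairs, so the sum over it would change if normalization
    identified two of them.\<close>
  have inj: "inj_on N G"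
  proof (rule inj_onI, clarsimp simp: N_def)
    fix g g' :: "'a \<Rightarrow> real" assume "(\<lambda>x. g x / S x) = (\<lambda>x. g' x / S x)"
    hence "g x / S x = g' x / S x" for x by metis
    thus "g = g'" using S by (intro ext) (metis less_irrefl divide_cancel_right)
  qed
  have contS: "continuous_map (mtop M) euclideanreal (\<lambda>x. \<Sum>(c, g)\<in>G. g x)"
    using G by (auto intro!: continuous_map_sum[OF \<open>finite G\<close>] simp: case_prod_unfold)
  have "partition_of_unity M (N ` G)"
    unfolding partition_of_unity_def
  proof (intro conjI ballI)
    fix p assume "p \<in> N ` G"
    then obtain c g where p: "(c, g) \<in> G" "p = (c, \<lambda>x. g x / S x)" by (auto simp: N_def)
    have "continuous_map (mtop M) euclideanreal (\<lambda>x. g x / (\<Sum>(c, g)\<in>G. g x))"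
      using G[OF p(1)] contS pos
        by (intro continuous_map_real_divide) (auto dest: less_imp_neq[THEN not_sym])
    hence "continuous_map (mtop M) euclideanreal (\<lambda>x. g x / S x)"
      by (rule continuous_map_eq) (simp add: S_def)
    moreover have "{x \<in> points M. g x / S x \<noteq> 0} = {x \<in> points M. g x \<noteq> 0}" using S less_imp_neq
      by fastforce
    ultimately show "case p of (c, \<rho>) \<Rightarrow> c \<in> atlas M \<and> continuous_map (mtop M) euclideanreal \<rho> \<and>
        (\<forall>x\<in>points M. 0 \<le> \<rho> x) \<and> mtop M closure_of {x \<in> points M. \<rho> x \<noteq> 0} \<subseteq> fst c"
      using G[OF p(1)] S by (auto simp: p(2) less_imp_le)
  next
    fix x assume x: "x \<in> points M"
    have "(\<Sum>(c, \<rho>)\<in>N ` G. \<rho> x) = (\<Sum>(c, g)\<in>G. g x / S x)"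
      by (subst sum.reindex[OF inj]) (simp add: N_def case_prod_unfold)
    also have "\<dots> = (\<Sum>(c, g)\<in>G. g x) / S x"
      by (simp add: sum_divide_distrib case_prod_unfold)
    finally show "(\<Sum>(c, \<rho>)\<in>N ` G. \<rho> x) = 1" using pos[OF x] x by (simp add: S_def)
  qed (use assms in simp)
  thus ?thesis by blast
qed

text \<open>The weights |v_k|^2/|v|^2 already sum to 1, but each is nonzero on its whole patch,
  whose closure leaves the patch. Truncating them at a positive level pulls the supports
  inside.\<close>

lemma partition_of_unity_projective:
  "\<exists>P. partition_of_unity (projective_space :: ((complex^'N::finite option) set, 'N) complex_mfd) P"
proof -
  \<comment> \<open>Half the average of the N + 1 weights; since they sum to 1, some weight exceeds
    this level at every point.\<close>
  define \<epsilon> where "\<epsilon> = 1 / (2 * real (CARD('N) + 1))"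
  have eps: "\<epsilon> > 0" by (simp add: \<epsilon>_def)
  \<comment> \<open>The quotient is homogeneous of degree 0, so any nonzero vector of the line may
    be chosen.\<close>
  define wt where "wt k l = (let v = (SOME v. v \<in> l \<and> v \<noteq> 0) in (norm (v $ k))\<^sup>2 / (norm v)\<^sup>2)"
    for k and l :: "(complex^'N option) set"
  have wt: "wt k (line v) = (norm (v $ k))\<^sup>2 / (norm v)\<^sup>2" if "v \<noteq> 0" for k v
  proof -
    define u where "u = (SOME u. u \<in> line v \<and> u \<noteq> 0)"
    have "u \<in> line v \<and> u \<noteq> 0"
      unfolding u_def by (rule someI[of _ v]) (use that in simp)
    then obtain c where "u = c *s v" "c \<noteq> 0" by (auto simp: mem_line)
    thus ?thesis by (simp add: wt_def Let_def u_def[symmetric] norm_scale_vec norm_mult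
      power_mult_distrib)
  qed
  have wt_cont: "continuous_map (mtop projective_space) euclideanreal (wt k)" for k
    unfolding continuous_map_projective
    by (rule continuous_on_cong[THEN iffD2, OF refl wt]) (auto intro!: continuous_intros)
  define G where "G = (\<lambda>k. (patch_chart k, \<lambda>l. max 0 (wt k l - \<epsilon>))) ` UNIV"
  show ?thesis
  proof (rule partition_of_unity_normalise[of G])
    fix c g assume "(c, g) \<in> G"
    then obtain k where k: "c = patch_chart k" "g = (\<lambda>l. max 0 (wt k l - \<epsilon>))" by (auto simp: G_def)
    have "closedin (mtop projective_space) {l \<in> points projective_space. wt k l \<in> {\<epsilon>..}}"
      by (rule closedin_continuous_map_preimage[OF wt_cont]) simp
    moreover have "{l \<in> points projective_space. g l \<noteq> 0} \<subseteq> {l \<in> points projective_space. wt k l \<in>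
      {\<epsilon>..}}"
      by (auto simp: k)
    ultimately have "mtop projective_space closure_of {l \<in> points projective_space. g l \<noteq> 0} \<subseteq> {l \<in>
      points projective_space. wt k l \<in> {\<epsilon>..}}"
      by (simp add: closure_of_minimal)
    also have "\<dots> \<subseteq> affine_patch k"
      using eps by (auto elim!: proj_points_cases simp: wt line_in_affine_patch)
    finally show "c \<in> atlas projective_space \<and> continuous_map (mtop projective_space) euclideanreal g \<and>
        (\<forall>x\<in>points projective_space. 0 \<le> g x) \<and>
          mtop projective_space closure_of {x \<in> points projective_space. g x \<noteq> 0} \<subseteq> fst c"
      using wt_cont by (auto simp: k atlas_projective intro!: continuous_map_real_max
        continuous_map_diff)
  next
    fix l :: "(complex^'N option) set" assume "l \<in> points projective_space"
    then obtain v where v: "v \<noteq> 0" "l = line v" by (auto elim: proj_points_cases)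
    have "(\<Sum>k\<in>UNIV. wt k l) = 1"
      using v by (simp add: wt sum_divide_distrib[symmetric] norm_vec_square[symmetric])
    moreover have "(\<Sum>k\<in>(UNIV::'N option set). wt k l) \<le> (\<Sum>k\<in>(UNIV::'N option set). \<epsilon>)"
      if "\<And>k. wt k l \<le> \<epsilon>"
      using that by (intro sum_mono) auto
    moreover have "(\<Sum>k\<in>(UNIV::'N option set). \<epsilon>) = 1/2"
      by (simp add: \<epsilon>_def card_option_type)
    ultimately have "\<not> (\<forall>k. wt k l \<le> \<epsilon>)" by force
    then obtain k where "wt k l > \<epsilon>" by (auto simp: not_le)
    moreover have "0 < (\<Sum>p\<in>G. snd p l)" if "wt k l > \<epsilon>" for k
      by (rule sum_pos2[of _ "(patch_chart k, \<lambda>l. max 0 (wt k l - \<epsilon>))"]) (use that in \<open>auto simp: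
        G_def\<close>)
    ultimately show "0 < (\<Sum>(c, g)\<in>G. g l)" by (auto simp: case_prod_unfold)
  qed (simp add: G_def)
qed

section \<open>Reduction of integrals over projective space to the unit ball\<close>

lemma borel_measurable_continuous_off_0:
  fixes f :: "'a::euclidean_space \<Rightarrow> 'b::{banach, second_countable_topology}"
  assumes "continuous_on (-{0}) f" shows "f \<in> borel_measurable borel"
proof -
  have [measurable]: "(\<lambda>x. indicator (-{0}) x *\<^sub>R f x) \<in> borel_measurable borel"
    using assms by (intro borel_measurable_continuous_on_indicator) auto
  have "f = (\<lambda>x. if x = 0 then f 0 else indicator (-{0}) x *\<^sub>R f x)" by auto
  also have "\<dots> \<in> borel_measurable borel" by measurable
  finally show ?thesis .
qed

lemma integrable_ball_bounded:
  fixes f :: "'a::euclidean_space \<Rightarrow> 'b::{banach, second_countable_topology}"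
  assumes "continuous_on (-{0}) f" "\<And>x. x \<noteq> 0 \<Longrightarrow> norm (f x) \<le> K"
  shows "set_integrable lborel (ball 0 1) f"
proof -
  have [measurable]: "f \<in> borel_measurable borel" by (rule borel_measurable_continuous_off_0) fact
  have "set_integrable lborel (ball (0::'a) 1) (\<lambda>_. max K (norm (f 0)))"
    using emeasure_lborel_ball_finite[of "0::'a" 1] by (simp add: set_integrable_def)
  thus ?thesis
  proof (rule set_integrable_bound)
    show "set_borel_measurable lborel (ball 0 1) f"
      unfolding set_borel_measurable_def
      by (intro borel_measurable_scaleR borel_measurable_indicator) auto
    have "norm (f x) \<le> norm (max K (norm (f 0)))" for x
      using assms(2)[of x] by (cases "x = 0") auto
    thus "AE x in lborel. x \<in> ball 0 1 \<longrightarrow> norm (f x) \<le> norm (max K (norm (f 0)))" by simp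
  qed
qed

text \<open>The complex hyperplane lies in the real hyperplane where the real part of the
  \<open>k\<close>-th coordinate vanishes, which is negligible.\<close>

lemma AE_nth_neq_0: "AE z in lborel. (z::complex^'m) $ k \<noteq> 0"
proof -
  have "{z::complex^'m. z $ k = 0} \<subseteq> {z. axis k 1 \<bullet> z = 0}"
    by (auto simp: inner_axis' inner_complex_def)
  moreover have "negligible {z::complex^'m. axis k 1 \<bullet> z = 0}"
    by (rule negligible_hyperplane) (simp add: axis_eq_0_iff)
  ultimately have "negligible {z::complex^'m. z $ k = 0}" by (rule negligible_subset[rotated])
  moreover have "{z::complex^'m. z $ k = 0} \<in> sets borel" by measurable
  ultimately have "{z::complex^'m. z $ k = 0} \<in> null_sets lborel"
    by (simp add: negligible_iff_null_sets null_sets_completion_iff)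
  thus ?thesis by (rule AE_I'[of _ lborel]) auto
qed

text \<open>The chart integral belonging to (c, \<rho>) becomes the integral of \<rho> f over the
  ball, up to the null set where the homogeneous coordinate of the chart vanishes. Summation removes
  the weights, so the result does not depend on the chosen partition. The power of 2 comes from the
  Liouville density.\<close>

lemma liouville_integral_projective:
  fixes f :: "(complex^'N::finite option) set \<Rightarrow> 'b::{banach, second_countable_topology}"
  assumes cont: "continuous_on (-{0}) (\<lambda>v. f (line v))"
    and bound: "\<And>v. v \<noteq> 0 \<Longrightarrow> norm (f (line v)) \<le> K"
  shows "liouville_integral projective_space fubini_study f =
    (2 ^ CARD('N) / enn2real (disc_moment CARD('N))) *\<^sub>R (LINT z:ball 0 1|lborel. f (line z))"
proof -
  let ?C = "enn2real (disc_moment CARD('N))"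
  let ?PS = "projective_space :: ((complex^'N::finite option) set, 'N) complex_mfd"
  define P where "P = (SOME P. partition_of_unity ?PS P)"
  have P: "partition_of_unity ?PS P"
    unfolding P_def using partition_of_unity_projective by (rule someI_ex)
  have fin: "finite P" using P by (simp add: partition_of_unity_def)
  have chart: "c \<in> range patch_chart" and rho_cont: "continuous_on (-{0}) (\<lambda>v. \<rho> (line v))"
    and rho_nonneg: "v \<noteq> 0 \<Longrightarrow> 0 \<le> \<rho> (line v)" if "(c, \<rho>) \<in> P" for c \<rho> v
    using P that by (auto simp: partition_of_unity_def continuous_map_projective atlas_projective)
  have one: "(\<Sum>(c, \<rho>)\<in>P. \<rho> (line v)) = 1" if "v \<noteq> 0" for v
    using P that by (auto simp: partition_of_unity_def)
  have rho_le: "\<rho> (line v) \<le> 1" if "(c, \<rho>) \<in> P" "v \<noteq> 0" for c \<rho> v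
    unfolding one[OF that(2), symmetric]
    by (rule order_trans[OF _ member_le_sum[OF that(1)]]) (use that fin rho_nonneg in auto)
  have cont': "continuous_on (-{0}) (\<lambda>v. \<rho> (line v) *\<^sub>R f (line v))" if "(c, \<rho>) \<in> P" for c \<rho>
    by (intro continuous_intros rho_cont[OF that] cont)
  have chart_int: "(LINT z : snd c ` fst c | lborel.
          (\<rho> (chart_inv c z) * liouville_density fubini_study c (chart_inv c z)) *\<^sub>R f (chart_inv c
            z)) =
       (2 ^ CARD('N) / ?C) *\<^sub>R (LINT z:ball 0 1|lborel. \<rho> (line z) *\<^sub>R f (line z))"
         if mem: "(c, \<rho>) \<in> P" for c \<rho>
  proof -
    obtain k where k: "c = patch_chart k" using chart[OF mem] by auto
    define g where "g w = \<rho> (line (join_coords k 1 w)) *\<^sub>R f (line (join_coords k 1 w))" for w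
    have "continuous_on UNIV g"
      unfolding g_def by (rule continuous_on_compose2[OF cont'[OF mem] continuous_join_coords]) auto
    hence g: "g \<in> borel_measurable borel" by (rule borel_measurable_continuous_onI)
    have "(LINT z : snd c ` fst c | lborel.
          (\<rho> (chart_inv c z) * liouville_density fubini_study c (chart_inv c z)) *\<^sub>R f (chart_inv c
            z)) =
       (LINT w|lborel. 2 ^ CARD('N) *\<^sub>R ((1 / (1 + (norm w)\<^sup>2) ^ (CARD('N) + 1)) *\<^sub>R g w))"
      unfolding set_lebesgue_integral_def k fst_conv snd_conv affine_coords_image inv_affine_coords
        liouville_density_fubini_study
      by (simp add: g_def mult_ac)
    also have "\<dots> = (2 ^ CARD('N) / ?C) *\<^sub>R (LINT z:ball 0 1|lborel. g (quotient_coords k z))"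
      by (simp only: integral_scaleR_right integral_quotient_coords[OF g, of k]) simp
    also have "(LINT z:ball 0 1|lborel. g (quotient_coords k z)) =
      (LINT z:ball 0 1|lborel. \<rho> (line z) *\<^sub>R f (line z))"
      unfolding set_lebesgue_integral_def
    proof (rule integral_cong_AE)
      show "AE z in lborel. indicator (ball 0 1) z *\<^sub>R g (quotient_coords k z) =
        indicator (ball 0 1) z *\<^sub>R \<rho> (line z) *\<^sub>R f (line z)"
        using AE_nth_neq_0[of k] by eventually_elim (simp add: g_def join_quotient_coords line_scale)
      have [measurable]: "(\<lambda>v. \<rho> (line v) *\<^sub>R f (line v)) \<in> borel_measurable borel" "g \<in>
        borel_measurable borel"
        "(indicator (ball 0 1) :: complex^'N option \<Rightarrow> real) \<in> borel_measurable borel"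
        using borel_measurable_continuous_off_0[OF cont'[OF mem]] g
          by (auto simp: borel_measurable_indicator)
      show "(\<lambda>z. indicator (ball 0 1) z *\<^sub>R g (quotient_coords k z)) \<in> borel_measurable lborel"
        "(\<lambda>z. indicator (ball 0 1) z *\<^sub>R \<rho> (line z) *\<^sub>R f (line z)) \<in> borel_measurable lborel"
          by measurable
    qed
    finally show ?thesis .
  qed
  have "liouville_integral ?PS fubini_study f =
    (\<Sum>(c, \<rho>)\<in>P. (2 ^ CARD('N) / ?C) *\<^sub>R (LINT z:ball 0 1|lborel. \<rho> (line z) *\<^sub>R f (line z)))"
    unfolding liouville_integral_def P_def[symmetric] using chart_int by (intro sum.cong) auto
  also have "\<dots> = (2 ^ CARD('N) / ?C) *\<^sub>R (\<Sum>p\<in>P. (LINT z:ball 0 1|lborel. snd p (line z) *\<^sub>R f (line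
    z)))"
    by (simp add: scaleR_sum_right case_prod_unfold)
  also have "(\<Sum>p\<in>P. (LINT z:ball 0 1|lborel. snd p (line z) *\<^sub>R f (line z))) =
    (LINT z:ball 0 1|lborel. (\<Sum>p\<in>P. snd p (line z) *\<^sub>R f (line z)))"
    unfolding set_lebesgue_integral_def scaleR_sum_right
  proof (rule Bochner_Integration.integral_sum[symmetric])
    fix p assume "p \<in> P"
    then obtain c \<rho> where p: "p = (c, \<rho>)" "(c, \<rho>) \<in> P" by (cases p) auto
    have "norm (\<rho> (line v) *\<^sub>R f (line v)) \<le> 1 * K" if "v \<noteq> 0" for v
      unfolding norm_scaleR using rho_nonneg[OF p(2) that] rho_le[OF p(2) that] bound[OF that]
        by (intro mult_mono) auto
    from integrable_ball_bounded[OF cont'[OF p(2)] this]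
    show "integrable lborel (\<lambda>z. indicator (ball 0 1) z *\<^sub>R snd p (line z) *\<^sub>R f (line z))"
      by (simp add: p set_integrable_def)
  qed
  also have "\<dots> = (LINT z:ball 0 1|lborel. f (line z))"
    unfolding set_lebesgue_integral_def
  proof (rule integral_cong_AE)
    have "AE z in lborel. (z :: complex^'N option) \<noteq> 0" by (rule AE_lborel_singleton)
    thus "AE z in lborel. indicator (ball 0 1) z *\<^sub>R (\<Sum>p\<in>P. snd p (line z) *\<^sub>R f (line z)) =
      indicator (ball 0 1) z *\<^sub>R f (line z)"
      by eventually_elim (use one in \<open>simp add: scaleR_sum_left[symmetric] case_prod_unfold\<close>)
    have [measurable]: "(\<lambda>v. f (line v)) \<in> borel_measurable borel" 
      "(indicator (ball 0 1) :: complex^'N option \<Rightarrow> real) \<in> borel_measurable borel"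
      using borel_measurable_continuous_off_0[OF cont] by (auto simp: borel_measurable_indicator)
    have [measurable]: "(\<lambda>z. \<Sum>p\<in>P. snd p (line z) *\<^sub>R f (line z)) \<in> borel_measurable borel"
      using borel_measurable_continuous_off_0[OF cont'] by (intro borel_measurable_sum) auto
    show "(\<lambda>z. indicator (ball 0 1) z *\<^sub>R (\<Sum>p\<in>P. snd p (line z) *\<^sub>R f (line z))) \<in> borel_measurable
      lborel"
      "(\<lambda>z. indicator (ball 0 1) z *\<^sub>R f (line z)) \<in> borel_measurable lborel" by measurable
  qed
  finally show ?thesis .
qed

section \<open>Orthogonality of the homogeneous coordinates\<close>

lemma borel_measurable_ball_continuous_off_0:
  fixes f :: "'a::euclidean_space \<Rightarrow> 'b::{banach, second_countable_topology}"
  assumes "continuous_on (-{0}) f"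
  shows "(\<lambda>z. indicator (ball 0 1) z *\<^sub>R f z) \<in> borel_measurable lborel"
  using borel_measurable_continuous_off_0[OF assms]
  by (intro borel_measurable_scaleR borel_measurable_indicator) auto

lemma integral_ball_isometry:
  fixes T :: "'a::euclidean_space \<Rightarrow> 'a" and g :: "'a \<Rightarrow> 'b::{banach, second_countable_topology}"
  assumes "linear T" "\<And>x. norm (T x) = norm x" "continuous_on (-{0}) g"
  shows "(LINT z:ball 0 1|lborel. g z) = (LINT z:ball 0 1|lborel. g (T z))"
proof -
  have [measurable]: "T \<in> borel_measurable borel"
    using assms(1) by (intro borel_measurable_continuous_onI linear_continuous_on) (simp add:
      linear_conv_bounded_linear)
  have [measurable]: "(\<lambda>z. indicator (ball 0 1) z *\<^sub>R g z) \<in> borel_measurable borel"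
    using borel_measurable_ball_continuous_off_0[OF assms(3)] by simp
  have "(LINT z:ball 0 1|lborel. g z) = (LINT z|distr lborel borel T. indicator (ball 0 1) z *\<^sub>R g z)"
    unfolding distr_lborel_isometry[OF assms(1,2) refl] set_lebesgue_integral_def ..
  also have "\<dots> = (LINT z|lborel. indicator (ball 0 1) (T z) *\<^sub>R g (T z))"
    by (rule integral_distr) auto
  also have "\<dots> = (LINT z:ball 0 1|lborel. g (T z))"
    by (simp add: set_lebesgue_integral_def indicator_def assms(2))
  finally show ?thesis .
qed

text \<open>Up to the constant of \<open>liouville_integral_projective\<close>, the scalar product
  of the linear forms Z_j and Z_k.\<close>

definition coord_integral :: "'m::finite \<Rightarrow> 'm \<Rightarrow> complex" where
  "coord_integral j k = (LINT z:ball 0 1|lborel. cnj (z $ j) * z $ k / of_real ((norm (z ::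
    complex^'m))\<^sup>2))"

lemma continuous_coord_product:
  "continuous_on (-{0}) (\<lambda>z::complex^'m. cnj (z $ j) * z $ k / of_real ((norm z)\<^sup>2))"
  by (intro continuous_intros) auto

lemma norm_coord_product_le:
  "norm (cnj (z $ j) * z $ k / complex_of_real ((norm (z :: complex^'m))\<^sup>2)) \<le> 1"
proof -
  have "cmod (z $ j) * cmod (z $ k) \<le> norm z * norm z"
    by (intro mult_mono Finite_Cartesian_Product.norm_nth_le) auto
  thus ?thesis
    by (auto simp: norm_divide norm_mult norm_power power2_eq_square divide_simps)
qed

lemma set_integrable_coord_product:
  "set_integrable lborel (ball 0 1) (\<lambda>z::complex^'m. cnj (z $ j) * z $ k / of_real ((norm z)\<^sup>2))"
  by (rule integrable_ball_bounded[OF continuous_coord_product norm_coord_product_le])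

text \<open>Reflecting the \<open>j\<close>-th coordinate changes the sign of the integrand.\<close>

lemma coord_integral_off_diagonal:
  assumes "j \<noteq> k" shows "coord_integral j k = 0"
proof -
  define T where "T z = (\<chi> i. if i = j then - (z $ i) else z $ i)" for z :: "complex^'a"
  have "linear T" by (rule linearI) (auto simp: T_def vec_eq_iff)
  moreover have norm: "norm (T z) = norm z" for z
  proof -
    have "(norm (T z))\<^sup>2 = (norm z)\<^sup>2" unfolding norm_vec_square
      by (intro sum.cong) (auto simp: T_def)
    thus ?thesis by (simp add: power2_eq_iff_nonneg)
  qed
  ultimately have "coord_integral j k =
    (LINT z:ball 0 1|lborel. cnj (T z $ j) * T z $ k / of_real ((norm (T z))\<^sup>2))"
    unfolding coord_integral_def by (rule integral_ball_isometry) (rule continuous_coord_product)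
  also have "\<dots> = (LINT z:ball 0 1|lborel. - (cnj (z $ j) * z $ k / of_real ((norm z)\<^sup>2)))"
    unfolding norm using assms by (simp add: T_def)
  also have "\<dots> = - coord_integral j k"
    by (simp add: coord_integral_def set_lebesgue_integral_def)
  finally show ?thesis by simp
qed

lemma coord_integral_diagonal_eq:
  fixes j k :: "'m::finite"
  shows "coord_integral j j = coord_integral k k"
proof -
  define T where "T z = (\<chi> i. z $ (Transposition.transpose j k i))" for z :: "complex^'m"
  have "linear T" by (rule linearI) (auto simp: T_def vec_eq_iff)
  moreover have norm: "norm (T z) = norm z" for z
  proof -
    have "(norm (T z))\<^sup>2 = (norm z)\<^sup>2" unfolding norm_vec_square
      using sum.reindex_bij_betw[OF bij_transpose[of j k], of "\<lambda>i. (cmod (z $ i))\<^sup>2"]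
        by (simp add: T_def)
    thus ?thesis by (simp add: power2_eq_iff_nonneg)
  qed
  ultimately have "coord_integral j j =
    (LINT z:ball 0 1|lborel. cnj (T z $ j) * T z $ j / of_real ((norm (T z))\<^sup>2))"
    unfolding coord_integral_def by (rule integral_ball_isometry) (rule continuous_coord_product)
  also have "\<dots> = coord_integral k k"
    unfolding norm by (simp add: T_def coord_integral_def)
  finally show ?thesis .
qed

text \<open>Away from the origin the diagonal integrands add up to 1, so the equal diagonal entries
  share the volume of the ball.\<close>

lemma coord_integral_diagonal:
  "coord_integral k (k :: 'm::finite) = of_real (measure lborel (ball (0 :: complex^'m) 1) / CARD('m))"
proof -
  have "(\<Sum>j\<in>UNIV. coord_integral j (j :: 'm)) =
    (LINT z:ball 0 1|lborel. (\<Sum>j\<in>UNIV. cnj (z $ j) * z $ j / of_real ((norm (z :: complex^'m))\<^sup>2)))"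
    unfolding coord_integral_def set_lebesgue_integral_def scaleR_sum_right
    by (rule Bochner_Integration.integral_sum[symmetric])
      (use set_integrable_coord_product in \<open>simp add: set_integrable_def\<close>)
  also have "\<dots> = (LINT z|lborel. of_real (indicator (ball (0 :: complex^'m) 1) z))"
    unfolding set_lebesgue_integral_def
  proof (rule integral_cong_AE)
    have "AE z in lborel. (z :: complex^'m) \<noteq> 0" by (rule AE_lborel_singleton)
    thus "AE z in lborel. indicator (ball 0 1) z *\<^sub>R (\<Sum>j\<in>UNIV. cnj (z $ j) * z $ j / of_real ((norm
      (z :: complex^'m))\<^sup>2)) = of_real (indicator (ball 0 1) z)"
    proof eventually_elim
      case (elim z)
      have "(\<Sum>j\<in>UNIV. cnj (z $ j) * z $ j) = of_real ((norm z)\<^sup>2)"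
        unfolding norm_vec_square of_real_sum complex_norm_square by (simp add: mult.commute)
      thus ?case using elim by (simp add: sum_divide_distrib[symmetric] scaleR_conv_of_real)
    qed
    show "(\<lambda>z. indicator (ball 0 1) z *\<^sub>R (\<Sum>j\<in>UNIV. cnj (z $ j) * z $ j / of_real ((norm (z ::
      complex^'m))\<^sup>2))) \<in> borel_measurable lborel"
      by (intro borel_measurable_ball_continuous_off_0 continuous_on_sum continuous_coord_product)
    have [measurable]: "(indicator (ball (0 :: complex^'m) 1) :: _ \<Rightarrow> real) \<in> borel_measurable borel"
      by (simp add: borel_measurable_indicator)
    show "(\<lambda>z. complex_of_real (indicator (ball (0 :: complex^'m) 1) z)) \<in> borel_measurable lborel"
      by measurable
  qed
  also have "\<dots> = of_real (measure lborel (ball (0 :: complex^'m) 1))" by simp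
  finally have *: "(\<Sum>j\<in>UNIV. coord_integral j (j :: 'm)) =
    of_real (measure lborel (ball (0 :: complex^'m) 1))" .
  have "of_nat CARD('m) * coord_integral k k = of_real (measure lborel (ball (0 :: complex^'m) 1))"
  proof -
    have "(\<Sum>j\<in>UNIV. coord_integral j (j :: 'm)) = (\<Sum>j\<in>(UNIV :: 'm set). coord_integral k k)"
      by (intro sum.cong refl coord_integral_diagonal_eq)
    thus ?thesis using * by simp
  qed
  thus ?thesis by (simp add: field_simps)
qed

section \<open>Scalar products of linear forms\<close>

definition coord_form :: "('m::finite \<Rightarrow> complex) \<Rightarrow> complex^'m \<Rightarrow> complex" where
  "coord_form a v = (\<Sum>j\<in>UNIV. a j * v $ j)"

lemma coord_form_add: "coord_form a (u + v) = coord_form a u + coord_form a v"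
  by (simp add: coord_form_def distrib_left sum.distrib)

lemma coord_form_scale: "coord_form a (c *s v) = c * coord_form a v"
  by (simp add: coord_form_def sum_distrib_left mult_ac)

text \<open>The vector chosen by the metric is some \<open>c *s v\<close> with
  \<open>c \<noteq> 0\<close>; numerator and denominator both pick up |c|^2.\<close>

lemma hyperplane_metric_form_section:
  assumes "v \<noteq> 0"
  shows "hyperplane_metric (form_section (coord_form a) (line v)) (form_section (coord_form b) (line
    v)) =
    cnj (coord_form a v) * coord_form b v / of_real ((norm v)\<^sup>2)"
proof -
  define u where "u = (SOME u. u \<in> line v \<and> u \<noteq> 0)"
  have u: "u \<in> line v \<and> u \<noteq> 0"
    unfolding u_def by (rule someI[of _ v]) (use assms in simp)
  then obtain c where c: "u = c *s v" "c \<noteq> 0" by (auto simp: mem_line)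
  have "cnj c * c / of_real ((cmod c)\<^sup>2) = 1"
    using c(2) by (simp add: complex_norm_square mult.commute del: of_real_power)
  moreover have "cnj (coord_form a u) * coord_form b u / of_real ((norm u)\<^sup>2) =
      (cnj c * c / of_real ((cmod c)\<^sup>2)) * (cnj (coord_form a v) * coord_form b v / of_real ((norm
        v)\<^sup>2))"
    by (simp add: c(1) coord_form_scale norm_scale_vec power_mult_distrib)
  ultimately have "cnj (coord_form a u) * coord_form b u / of_real ((norm u)\<^sup>2) =
    cnj (coord_form a v) * coord_form b v / of_real ((norm v)\<^sup>2)"
    by simp
  thus ?thesis using u assms
    by (simp add: hyperplane_metric_def form_section_def Let_def u_def[symmetric])
qed

definition fs_volume :: "'N::finite itself \<Rightarrow> real" where
  "fs_volume T = liouville_volume (projective_space :: ((complex^'N option) set, 'N) complex_mfd)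
    fubini_study"

lemma fs_volume_eq:
  "fs_volume TYPE('N::finite) =
    2 ^ CARD('N) / enn2real (disc_moment CARD('N)) * measure lborel (ball (0 :: complex^'N option) 1)"
  unfolding fs_volume_def liouville_volume_def
  by (subst liouville_integral_projective[of _ 1]) (auto simp: set_lebesgue_integral_def)

lemma fs_volume_pos: "fs_volume TYPE('N::finite) > 0"
  unfolding fs_volume_eq using disc_moment_pos[where 'N = 'N] by (simp add: content_ball)

text \<open>Sesquilinear expansion reduces the scalar product to \<open>coord_integral\<close>, of
  which only the diagonal survives. The disc moment is absorbed into the volume, leaving the factor
  vol/(N+1).\<close>

lemma section_inner_coord_forms:
  fixes a b :: "'N::finite option \<Rightarrow> complex"
  shows "section_inner projective_space fubini_study hyperplane_metric
    (form_section (coord_form a)) (form_section (coord_form b)) =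
    of_real (fs_volume TYPE('N) / (CARD('N) + 1)) * (\<Sum>j\<in>UNIV. cnj (a j) * b j)"
proof -
  let ?K = "2 ^ CARD('N) / enn2real (disc_moment CARD('N))"
  define f where "f l = hyperplane_metric (form_section (coord_form a) l) (form_section (coord_form
    b) l)" for l
  define g where "g z = (\<Sum>j\<in>UNIV. \<Sum>k\<in>UNIV. cnj (a j) * b k * (cnj (z $ j) * z $ k / of_real ((norm
    z)\<^sup>2)))" for z :: "complex^'N option"
  have fg: "f (line z) = g z" if "z \<noteq> 0" for z
    unfolding f_def hyperplane_metric_form_section[OF that] g_def coord_form_def cnj_sum sum_product
      sum_divide_distrib
    by (intro sum.cong refl) simp
  have cont: "continuous_on (-{0}) g"
    unfolding g_def by (intro continuous_on_sum continuous_on_mult continuous_on_const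
      continuous_coord_product)
  have le: "cmod (cnj (a j) * b k * e) \<le> cmod (a j) * cmod (b k)" if "cmod e \<le> 1" for e j k
    using mult_left_le[OF that, of "cmod (a j) * cmod (b k)"] by (simp add: norm_mult)
  have bound: "norm (g z) \<le> (\<Sum>j\<in>UNIV. \<Sum>k\<in>UNIV. cmod (a j) * cmod (b k))" for z
    unfolding g_def
    by (intro order_trans[OF norm_sum] sum_mono le norm_coord_product_le)
  have "section_inner projective_space fubini_study hyperplane_metric
    (form_section (coord_form a)) (form_section (coord_form b)) =
      ?K *\<^sub>R (LINT z:ball 0 1|lborel. f (line z))"
    unfolding section_inner_def f_def[symmetric]
  proof (rule liouville_integral_projective)
    show "continuous_on (-{0}) (\<lambda>v. f (line v))"
      using cont by (rule continuous_on_cong[THEN iffD1, rotated 2]) (auto simp: fg)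
  qed (use fg bound in auto)
  also have "(LINT z:ball 0 1|lborel. f (line z)) = (LINT z:ball 0 1|lborel. g z)"
    unfolding set_lebesgue_integral_def
  proof (rule integral_cong_AE)
    have "AE z in lborel. (z :: complex^'N option) \<noteq> 0" by (rule AE_lborel_singleton)
    thus "AE z in lborel. indicator (ball 0 1) z *\<^sub>R f (line z) = indicator (ball 0 1) z *\<^sub>R g z"
      by eventually_elim (simp add: fg)
    have "continuous_on (-{0}) (\<lambda>v. f (line v))"
      using cont by (rule continuous_on_cong[THEN iffD1, rotated 2]) (auto simp: fg)
    thus "(\<lambda>z. indicator (ball 0 1) z *\<^sub>R f (line z)) \<in> borel_measurable lborel"
      by (rule borel_measurable_ball_continuous_off_0)
    show "(\<lambda>z. indicator (ball 0 1) z *\<^sub>R g z) \<in> borel_measurable lborel"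
      by (rule borel_measurable_ball_continuous_off_0) fact
  qed
  also have "\<dots> = (\<Sum>j\<in>UNIV. \<Sum>k\<in>UNIV. cnj (a j) * b k * coord_integral j k)"
  proof -
    define e where "e j k z = cnj (z $ j) * z $ k / of_real ((norm z)\<^sup>2)"
      for j k and z :: "complex^'N option"
    have int: "integrable lborel (\<lambda>z. indicator (ball 0 1) z *\<^sub>R e j k z)" for j k
      using set_integrable_coord_product by (simp add: set_integrable_def e_def)
    have "(LINT z:ball 0 1|lborel. g z) =
        (LINT z|lborel. (\<Sum>j\<in>UNIV. \<Sum>k\<in>UNIV. cnj (a j) * b k * (indicator (ball 0 1) z *\<^sub>R e j k z)))"
      unfolding set_lebesgue_integral_def g_def e_def[symmetric] scaleR_sum_right mult_scaleR_right ..
    also have "\<dots> = (\<Sum>j\<in>UNIV. LINT z|lborel. (\<Sum>k\<in>UNIV. cnj (a j) * b k * (indicator (ball 0 1) z *\<^sub>R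
      e j k z)))"
      by (rule Bochner_Integration.integral_sum) (intro Bochner_Integration.integrable_sum
        integrable_mult_right int)
    also have "\<dots> = (\<Sum>j\<in>UNIV. \<Sum>k\<in>UNIV. LINT z|lborel. cnj (a j) * b k * (indicator (ball 0 1) z *\<^sub>R e
      j k z))"
      by (rule sum.cong[OF refl]) (rule Bochner_Integration.integral_sum, rule
        integrable_mult_right, rule int)
    also have "\<dots> = (\<Sum>j\<in>UNIV. \<Sum>k\<in>UNIV. cnj (a j) * b k * coord_integral j k)"
      by (simp only: integral_mult_right_zero coord_integral_def set_lebesgue_integral_def e_def)
    finally show ?thesis .
  qed
  also have "\<dots> = (\<Sum>j\<in>UNIV. cnj (a j) * b j * coord_integral j j)"
  proof (rule sum.cong)
    fix j :: "'N option"
    have "(\<Sum>k\<in>UNIV. cnj (a j) * b k * coord_integral j k) = (\<Sum>k\<in>UNIV. if k =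
      j then cnj (a j) * b j * coord_integral j j else 0)"
      by (intro sum.cong) (auto simp: coord_integral_off_diagonal)
    thus "(\<Sum>k\<in>UNIV. cnj (a j) * b k * coord_integral j k) = cnj (a j) * b j * coord_integral j j"
      by simp
  qed simp
  also have "?K *\<^sub>R \<dots> = of_real (fs_volume TYPE('N) / (CARD('N) + 1)) * (\<Sum>j\<in>UNIV. cnj (a j) * b j)"
    by (simp add: coord_integral_diagonal fs_volume_eq card_option_type scaleR_conv_of_real
      sum_distrib_left sum_distrib_right sum_divide_distrib mult_ac)
  finally show ?thesis .
qed

section \<open>Sections of the hyperplane bundle\<close>

lemma holomorphic_fun_on_imp_continuous_on: "holomorphic_fun_on f S \<Longrightarrow> continuous_on S f"
  unfolding holomorphic_fun_on_def
  by (metis continuous_at_imp_continuous_on has_derivative_continuous)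

lemma holomorphic_fun_on_cong_open:
  assumes "open S" "holomorphic_fun_on f S" "\<And>z. z \<in> S \<Longrightarrow> f z = g z"
  shows "holomorphic_fun_on g S"
  using assms unfolding holomorphic_fun_on_def by (metis has_derivative_transform_within_open)

lemma holomorphic_fun_on_const: "holomorphic_fun_on (\<lambda>z. c) S"
  unfolding holomorphic_fun_on_def by (intro ballI exI[of _ "\<lambda>_. 0"]) simp

lemma holomorphic_fun_on_add:
  assumes "holomorphic_fun_on f S" "holomorphic_fun_on g S"
  shows "holomorphic_fun_on (\<lambda>z. f z + g z) S"
  unfolding holomorphic_fun_on_def
proof
  fix z assume "z \<in> S"
  with assms obtain D E where
    D: "(f has_derivative D) (at z)" "\<And>c v. D (c *s v) = c * D v" and
    E: "(g has_derivative E) (at z)" "\<And>c v. E (c *s v) = c * E v"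
    unfolding holomorphic_fun_on_def by metis
  show "\<exists>D. ((\<lambda>z. f z + g z) has_derivative D) (at z) \<and> (\<forall>c v. D (c *s v) = c * D v)"
    by (rule exI, rule conjI, rule has_derivative_add[OF D(1) E(1)]) (simp add: D E distrib_left)
qed

lemma holomorphic_fun_on_mult:
  assumes "holomorphic_fun_on f S" "holomorphic_fun_on g S"
  shows "holomorphic_fun_on (\<lambda>z. f z * g z) S"
  unfolding holomorphic_fun_on_def
proof
  fix z assume "z \<in> S"
  with assms obtain D E where
    D: "(f has_derivative D) (at z)" "\<And>c v. D (c *s v) = c * D v" and
    E: "(g has_derivative E) (at z)" "\<And>c v. E (c *s v) = c * E v"
    unfolding holomorphic_fun_on_def by metis
  show "\<exists>D. ((\<lambda>z. f z * g z) has_derivative D) (at z) \<and> (\<forall>c v. D (c *s v) = c * D v)"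
    by (rule exI, rule conjI, rule has_derivative_mult[OF D(1) E(1)]) (simp add: D E algebra_simps)
qed

lemma holomorphic_fun_on_divide:
  assumes "holomorphic_fun_on f S" "holomorphic_fun_on g S" "\<And>z. z \<in> S \<Longrightarrow> g z \<noteq> 0"
  shows "holomorphic_fun_on (\<lambda>z. f z / g z) S"
  unfolding holomorphic_fun_on_def
proof
  fix z assume z: "z \<in> S"
  with assms obtain D E where
    D: "(f has_derivative D) (at z)" "\<And>c v. D (c *s v) = c * D v" and
    E: "(g has_derivative E) (at z)" "\<And>c v. E (c *s v) = c * E v"
    unfolding holomorphic_fun_on_def by metis
  show "\<exists>D. ((\<lambda>z. f z / g z) has_derivative D) (at z) \<and> (\<forall>c v. D (c *s v) = c * D v)"
    by (rule exI, rule conjI, rule has_derivative_divide'[OF D(1) E(1)])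
      (use assms(3)[OF z] in \<open>simp_all add: D E algebra_simps\<close>)
qed

lemma coord_form_scaleR: "coord_form a (r *\<^sub>R v) = r *\<^sub>R coord_form a v"
  by (simp add: coord_form_def scaleR_sum_right)

text \<open>In an affine chart a linear form is a constant plus the complex linear map with the
  \<open>k\<close>-th coordinate set to 0, which is its derivative everywhere.\<close>

lemma holomorphic_fun_on_coord_form: "holomorphic_fun_on (\<lambda>w. coord_form a (join_coords k 1 w)) S"
proof -
  have lin: "linear (\<lambda>w. coord_form a (join_coords k 0 w))"
    by (rule linearI) (simp_all add: linear_add[OF linear_join_coords_0] coord_form_add
        coord_form_scaleR linear_cmul[OF linear_join_coords_0])
  have eq: "coord_form a (join_coords k 1 w) =
    coord_form a (join_coords k 1 0) + coord_form a (join_coords k 0 w)" for w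
    by (subst coord_form_add[symmetric]) (rule arg_cong[where f =
      "coord_form a"], simp add: vec_eq_affine[of _ _ k])
  have "((\<lambda>w. coord_form a (join_coords k 1 w)) has_derivative (\<lambda>w. 0 + coord_form a (join_coords k
    0 w))) (at z)" for z
  proof -
    have "((\<lambda>w. coord_form a (join_coords k 1 0) + coord_form a (join_coords k 0 w)) has_derivative
      (\<lambda>w. 0 + coord_form a (join_coords k 0 w))) (at z)"
      by (intro has_derivative_add has_derivative_const linear_imp_has_derivative lin)
    thus ?thesis by (simp only: eq[symmetric])
  qed
  moreover have "0 + coord_form a (join_coords k 0 (c *s v)) =
    c * (0 + coord_form a (join_coords k 0 v))" for c v
    using join_coords_scale[of c k 0 v] by (simp flip: coord_form_scale)
  ultimately show ?thesis unfolding holomorphic_fun_on_def by blast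
qed

section \<open>Linear forms as holomorphic sections\<close>

lemma nth_eq_coord_form: "v $ k = coord_form (\<lambda>j. if j = k then 1 else 0) v"
proof -
  have "coord_form (\<lambda>j. if j = k then 1 else 0) v = (\<Sum>j\<in>UNIV. if j = k then v $ j else 0)"
    unfolding coord_form_def by (intro sum.cong) auto
  thus ?thesis by simp
qed

lemma form_section_line: "v \<noteq> 0 \<Longrightarrow> form_section f (line v) = (line v, restrict f (line v))"
  by (simp add: form_section_def)

text \<open>A linear form on a line is fixed by its value at a spanning vector, so the ratio of two
  of them is the quotient of their values at \<open>v\<close>.\<close>

lemma ratio_hyperplane_bundle:
  assumes v: "v \<noteq> 0" and \<phi>: "\<phi> \<in> linear_forms (line v)" and f: "f v \<noteq> 0" "\<And>c. f (c *s v) = c * f v"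
  shows "ratio (fibre hyperplane_bundle (line v)) (form_section f (line v)) (line v, \<phi>) = \<phi> v / f v"
  unfolding ratio_def
proof (rule the_equality)
  have scale: "\<phi> (c *s v) = c * \<phi> v" for c
    using \<phi> by (auto simp: linear_forms_def)
  have "\<phi> = (\<lambda>u\<in>line v. \<phi> v / f v * restrict f (line v) u)"
  proof
    fix u
    show "\<phi> u = (\<lambda>u\<in>line v. \<phi> v / f v * restrict f (line v) u) u"
    proof (cases "u \<in> line v")
      case True
      then obtain c where "u = c *s v" by (auto simp: mem_line)
      thus ?thesis using True f scale by simp
    next
      case False
      thus ?thesis using \<phi> by (auto simp: linear_forms_def extensional_def)
    qed
  qed
  thus "(line v, \<phi>) = (\<phi> v / f v) \<odot>\<^bsub>fibre hyperplane_bundle (line v)\<^esub> form_section f (line v)"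
    by (simp add: hyperplane_bundle_def form_section_line[OF v])
next
  fix c assume "(line v, \<phi>) = c \<odot>\<^bsub>fibre hyperplane_bundle (line v)\<^esub> form_section f (line v)"
  hence "\<phi> = (\<lambda>u\<in>line v. c * restrict f (line v) u)"
    by (simp add: hyperplane_bundle_def form_section_line[OF v])
  hence "\<phi> v = c * f v" by simp
  thus "c = \<phi> v / f v" using f by simp
qed

lemma coord_form_in_linear_forms: "restrict (coord_form a) (line v) \<in> linear_forms (line v)"
proof -
  have "u + w \<in> line v" if "u \<in> line v" "w \<in> line v" for u w
    using that unfolding mem_line by (metis vector_sadd_rdistrib)
  moreover have "c *s u \<in> line v" if "u \<in> line v" for u c
    using that unfolding mem_line by (metis vector_smult_assoc)
  ultimately show ?thesis
    by (auto simp: linear_forms_def coord_form_add coord_form_scale)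
qed

lemma frames_hyperplane_bundle:
  "frames hyperplane_bundle = range (\<lambda>k. (affine_patch k, form_section (\<lambda>v. v $ k)))"
  by (simp add: hyperplane_bundle_def)

lemma carrier_hyperplane_fibre: "carrier (fibre hyperplane_bundle l) = {l} \<times> linear_forms l"
  by (simp add: hyperplane_bundle_def)

text \<open>In chart \<open>m\<close> and against the frame Z_k the section is a quotient of two
  affine functions, the denominator being nonzero exactly on the image of the overlap of the
  patches.\<close>

lemma hol_section_coord_form:
  "hol_section projective_space hyperplane_bundle (form_section (coord_form (a :: 'N::finite option
    \<Rightarrow> complex)))"
  unfolding hol_section_def
proof (intro conjI ballI)
  show "form_section (coord_form a) \<in> (\<Pi>\<^sub>E x\<in>points projective_space. carrier (fibre
    hyperplane_bundle x))"
    by (auto simp: form_section_def carrier_hyperplane_fibre coord_form_in_linear_forms elim!: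
      proj_points_cases)
next
  fix p :: "(complex^'N option) set set \<times> ((complex^'N option) set \<Rightarrow> 'N hyperplane_vector)"
  assume "p \<in> frames hyperplane_bundle"
  then obtain k where p: "p = (affine_patch k, form_section (\<lambda>v. v $ k))"
    by (auto simp: frames_hyperplane_bundle)
  have "holomorphic_on_mfd projective_space
      (\<lambda>x. ratio (fibre hyperplane_bundle x) (form_section (\<lambda>v. v $ k) x) (form_section (coord_form
        a) x)) (affine_patch k)"
    unfolding holomorphic_on_mfd_def
  proof
    fix c :: "((complex^'N option) set, 'N) chart" assume "c \<in> atlas projective_space"
    then obtain m where c: "c = patch_chart m" by (auto simp: atlas_projective)
    define S where "S = {w. join_coords m 1 w $ k \<noteq> 0}"
    have "open S"
      unfolding S_def by (intro open_Collect_neq continuous_intros continuous_join_coords)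
    have S: "chart_image c (affine_patch k) = S"
    proof (intro equalityI subsetI)
      fix w assume "w \<in> S"
      hence "line (join_coords m 1 w) \<in> affine_patch m \<inter> affine_patch k"
        by (simp add: S_def line_in_affine_patch)
      thus "w \<in> chart_image c (affine_patch k)"
        by (metis affine_coords_line_join c fst_conv image_eqI snd_conv)
    next
      fix w assume "w \<in> chart_image c (affine_patch k)"
      then obtain l where l: "l \<in> affine_patch m" "l \<in> affine_patch k" "w = affine_coords m l"
        by (auto simp: c)
      then obtain u where "l = line (join_coords m 1 u)" by (auto elim: affine_patch_cases)
      thus "w \<in> S" using l by (simp add: S_def line_in_affine_patch)
    qed
    have "holomorphic_fun_on (\<lambda>w. coord_form a (join_coords m 1 w) / coord_form (\<lambda>j. if j =
      k then 1 else 0) (join_coords m 1 w)) S"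
      by (intro holomorphic_fun_on_divide holomorphic_fun_on_coord_form) (simp add: S_def flip:
        nth_eq_coord_form)
    hence "holomorphic_fun_on (\<lambda>w. coord_form a (join_coords m 1 w) / join_coords m 1 w $ k) S"
      by (simp flip: nth_eq_coord_form)
    hence "holomorphic_fun_on ((\<lambda>x. ratio (fibre hyperplane_bundle x) (form_section (\<lambda>v. v $ k) x)
      (form_section (coord_form a) x)) \<circ> chart_inv c) S"
    proof (rule holomorphic_fun_on_cong_open[OF \<open>open S\<close>])
      fix w assume w: "w \<in> S"
      let ?v = "join_coords m 1 w"
      have "ratio (fibre hyperplane_bundle (line ?v)) (form_section (\<lambda>v. v $ k) (line ?v)) (line ?v,
        restrict (coord_form a) (line ?v)) = coord_form a ?v / ?v $ k"
        using w by (subst ratio_hyperplane_bundle) (auto simp: S_def coord_form_in_linear_forms)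
      thus "coord_form a ?v / ?v $ k =
        ((\<lambda>x. ratio (fibre hyperplane_bundle x) (form_section (\<lambda>v. v $ k) x) (form_section
          (coord_form a) x)) \<circ> chart_inv c) w"
        by (simp add: c inv_affine_coords form_section_line)
    qed
    thus "holomorphic_fun_on ((\<lambda>x. ratio (fibre hyperplane_bundle x) (form_section (\<lambda>v. v $ k) x)
      (form_section (coord_form a) x)) \<circ> chart_inv c)
        (chart_image c (affine_patch k))"
      unfolding S .
  qed
  thus "case p of (U, t) \<Rightarrow> holomorphic_on_mfd projective_space
      (\<lambda>x. ratio (fibre hyperplane_bundle x) (t x) (form_section (coord_form a) x)) U"
    by (simp add: p)
qed

text \<open>Restriction to the complex line through 0 and \<open>w\<close> gives an entire function
  of one variable, a polynomial of degree at most 1, whose value at 1 is \<open>f w\<close>. Its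
  slope is the derivative of \<open>f\<close> at 0 applied to \<open>w\<close>, so one complex
  linear map serves all lines.\<close>

lemma affine_of_linear_growth:
  fixes f :: "complex^'n \<Rightarrow> complex"
  assumes hol: "holomorphic_fun_on f UNIV" and growth: "\<And>w. norm (f w) \<le> B * (1 + norm w)"
  shows "\<exists>b. \<forall>w. f w = f 0 + coord_form b w"
proof -
  obtain D where D: "(f has_derivative D) (at 0)" "\<And>c v. D (c *s v) = c * D v"
    using hol unfolding holomorphic_fun_on_def by blast
  have lin: "linear D" using D(1) by (rule has_derivative_linear)
  have B: "B \<ge> 0" using order_trans[OF norm_ge_zero growth[of 0]] by simp
  have "f w = f 0 + D w" for w
  proof -
    define \<phi> where "\<phi> \<zeta> = f (\<zeta> *s w)" for \<zeta>
    have blin: "((\<lambda>\<zeta>. \<zeta> *s w) has_derivative (\<lambda>\<zeta>. \<zeta> *s w)) (at z)" for z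
      by (rule linear_imp_has_derivative, rule linearI) (auto simp: vec_eq_iff algebra_simps)
    have deriv: "(\<phi> has_field_derivative E w) (at z)"
      if E: "(f has_derivative E) (at (z *s w))" "\<And>c v. E (c *s v) = c * E v" for z E
    proof -
      have "(\<phi> has_derivative (\<lambda>\<zeta>. E (\<zeta> *s w))) (at z)"
        unfolding \<phi>_def using has_derivative_compose[OF blin E(1)] by simp
      moreover have "(\<lambda>\<zeta>. E (\<zeta> *s w)) = (*) (E w)" by (auto simp: E(2))
      ultimately show ?thesis by (simp add: has_field_derivative_def)
    qed
    have "\<phi> holomorphic_on UNIV"
      unfolding holomorphic_on_def
    proof
      fix z
      obtain E where E: "(f has_derivative E) (at (z *s w))" "\<And>c v. E (c *s v) = c * E v"
        using hol unfolding holomorphic_fun_on_def by blast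
      show "\<phi> field_differentiable at z within UNIV"
        using deriv[OF E] by (auto simp: field_differentiable_def)
    qed
    \<comment> \<open>The condition \<open>1 \<le> norm z\<close> absorbs the additive constant,
      leaving the pure power required by the polynomial form of Liouville's theorem.\<close>
    moreover have "norm (\<phi> z) \<le> (B * (1 + norm w)) * norm z ^ 1" if "1 \<le> norm z" for z
    proof -
      have "norm (\<phi> z) \<le> B * (1 + norm z * norm w)"
        using growth[of "z *s w"] by (simp add: \<phi>_def norm_scale_vec)
      also have "\<dots> \<le> B * (norm z + norm z * norm w)"
        using B that by (intro mult_left_mono add_mono) auto
      finally show ?thesis by (simp add: algebra_simps)
    qed
    ultimately have "\<phi> 1 = (\<Sum>k\<le>1. (deriv ^^ k) \<phi> 0 / fact k * 1 ^ k)"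
      by (rule Liouville_polynomial)
    hence "\<phi> 1 = \<phi> 0 + deriv \<phi> 0" by (simp add: lessThan_Suc atMost_Suc)
    moreover have "deriv \<phi> 0 = D w"
      by (rule DERIV_imp_deriv, rule deriv) (use D in simp_all)
    ultimately show ?thesis by (simp add: \<phi>_def)
  qed
  moreover have "D w = coord_form (\<lambda>j. D (axis j 1)) w" for w
  proof -
    have "D w = D (\<Sum>j\<in>UNIV. w $ j *s axis j 1)" by (simp add: basis_expansion)
    also have "\<dots> = (\<Sum>j\<in>UNIV. w $ j * D (axis j 1))"
      by (simp add: linear_sum[OF lin] D(2))
    finally show ?thesis by (simp add: coord_form_def mult.commute)
  qed
  ultimately show ?thesis by metis
qed

text \<open>A section is a function \<open>G\<close> on nonzero vectors, homogeneous of degree 1.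
  Its bound by a multiple of |v| comes from finitely many compact sets, one per patch; evaluated at
  (1, w) it is the linear growth that makes each local function affine. The forms found in the
  patches are then glued.\<close>

lemma hol_section_hyperplane_bundle:
  fixes s :: "(complex^'N::finite option) set \<Rightarrow> 'N hyperplane_vector"
  assumes "hol_section projective_space hyperplane_bundle s"
  obtains b where "s = form_section (coord_form b)"
proof -
  define G where "G v = snd (s (line v)) v" for v
  have s_line: "s (line v) = (line v, snd (s (line v)))" "snd (s (line v)) \<in> linear_forms (line v)"
    if "v \<noteq> 0" for v
  proof -
    have "s (line v) \<in> {line v} \<times> linear_forms (line v)"
      using assms that by (auto simp: hol_section_def carrier_hyperplane_fibre PiE_iff)
    thus "s (line v) = (line v, snd (s (line v)))" "snd (s (line v)) \<in> linear_forms (line v)"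
      by (auto simp: prod_eq_iff)
  qed
  have G_scale: "G (c *s v) = c * G v" if "v \<noteq> 0" "c \<noteq> 0" for c v
    using s_line(2)[OF that(1)] by (simp add: G_def line_scale that linear_forms_def)
  define f where "f k w = G (join_coords k 1 w)" for k w
  have hol: "holomorphic_fun_on (f k) UNIV" for k
  proof -
    have "holomorphic_on_mfd projective_space
      (\<lambda>x. ratio (fibre hyperplane_bundle x) (form_section (\<lambda>v. v $ k) x) (s x)) (affine_patch k)"
      using assms by (auto simp: hol_section_def frames_hyperplane_bundle)
    hence "holomorphic_fun_on ((\<lambda>x. ratio (fibre hyperplane_bundle x) (form_section (\<lambda>v. v $ k) x)
      (s x)) \<circ> chart_inv (patch_chart k))
       (chart_image (patch_chart k) (affine_patch k))"
      unfolding holomorphic_on_mfd_def atlas_projective by blast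
    moreover have "(\<lambda>x. ratio (fibre hyperplane_bundle x) (form_section (\<lambda>v. v $ k) x) (s x)) \<circ>
      chart_inv (patch_chart k) = f k"
    proof
      fix w
      have "ratio (fibre hyperplane_bundle (line (join_coords k 1 w))) (form_section (\<lambda>v. v $ k)
        (line (join_coords k 1 w))) (s (line (join_coords k 1 w))) = f k w"
        by (subst s_line(1), simp, subst ratio_hyperplane_bundle) (simp_all add: s_line(2) f_def G_def)
      thus "((\<lambda>x. ratio (fibre hyperplane_bundle x) (form_section (\<lambda>v. v $ k) x) (s x)) \<circ> chart_inv
        (patch_chart k)) w = f k w"
        by (simp add: inv_affine_coords)
    qed
    ultimately show ?thesis by (simp add: affine_coords_image)
  qed
  \<comment> \<open>Bounds the norm of a vector of N entries of modulus at most 1.\<close>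
  define R where "R = real CARD('N)"
  have "\<exists>B. \<forall>w\<in>cball 0 R. norm (f k w) \<le> B" for k
  proof -
    have "continuous_on (cball 0 R) (f k)"
      using holomorphic_fun_on_imp_continuous_on[OF hol] by (rule continuous_on_subset) simp
    hence "bounded (f k ` cball 0 R)" by (intro compact_imp_bounded compact_continuous_image) auto
    thus ?thesis by (auto simp: bounded_iff)
  qed
  then obtain B' where B': "\<And>k w. w \<in> cball 0 R \<Longrightarrow> norm (f k w) \<le> B' k" by metis
  define B where "B = (\<Sum>k\<in>UNIV. \<bar>B' k\<bar>)"
  have B: "norm (f k w) \<le> B" if "w \<in> cball 0 R" for k w
  proof -
    have "\<bar>B' k\<bar> \<le> B" unfolding B_def by (rule member_le_sum) auto
    thus ?thesis using B'[OF that, of k] by linarith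
  qed
  have G_split: "G v = v $ k * f k (quotient_coords k v)" if "v $ k \<noteq> 0" for k v
  proof -
    have "v \<noteq> 0" using that by auto
    have "v = v $ k *s join_coords k 1 (quotient_coords k v)"
      using that by (simp add: join_quotient_coords)
    thus ?thesis using G_scale[OF join_coords_1_neq_0 that] unfolding f_def by metis
  qed
  have G_bound: "norm (G v) \<le> B * norm v" if "v \<noteq> 0" for v
  proof -
    \<comment> \<open>In the patch of a coordinate of largest modulus all affine coordinates have
      modulus at most 1, so the point lies in the compact ball of radius \<open>R\<close>.\<close>
    have "Max (range (\<lambda>i. norm (v $ i))) \<in> range (\<lambda>i. norm (v $ i))" by (rule Max_in) auto
    then obtain k where k: "Max (range (\<lambda>i. norm (v $ i))) = norm (v $ k)" by blast
    have max: "norm (v $ i) \<le> norm (v $ k)" for i unfolding k[symmetric] by (rule Max_ge) auto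
    have vk: "v $ k \<noteq> 0" using max that by (metis norm_le_zero_iff norm_zero vec_eq_iff zero_index)
    have "norm (quotient_coords k v) \<le> (\<Sum>j\<in>UNIV. norm (quotient_coords k v $ j))"
      unfolding norm_vec_def by (rule L2_set_le_sum) simp
    also have "\<dots> \<le> (\<Sum>j\<in>(UNIV :: 'N set). 1)"
      using max vk by (intro sum_mono) (simp add: quotient_coords_def norm_divide divide_le_eq_1)
    finally have "norm (f k (quotient_coords k v)) \<le> B" by (intro B) (simp add: R_def)
    hence "norm (G v) \<le> norm (v $ k) * B"
      unfolding G_split[OF vk] norm_mult by (rule mult_left_mono) simp
    also have "\<dots> \<le> norm v * B"
      using B[of 0 k] by (intro mult_right_mono Finite_Cartesian_Product.norm_nth_le) (auto simp:
        R_def intro: order_trans[OF norm_ge_zero])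
    finally show ?thesis by (simp add: mult.commute)
  qed
  have "\<exists>b. \<forall>v. v $ k \<noteq> 0 \<longrightarrow> G v = coord_form b v" for k
  proof -
    have "norm (f k w) \<le> B * (1 + norm w)" for w
    proof -
      have "norm (join_coords k 1 w) \<le> 1 + norm w"
        by (rule power2_le_imp_le) (auto simp: norm_join_coords power2_sum)
      moreover have "B \<ge> 0" by (simp add: B_def sum_nonneg)
      ultimately show ?thesis
        using G_bound[OF join_coords_1_neq_0] unfolding f_def by (meson mult_left_mono order_trans)
    qed
    from affine_of_linear_growth[OF hol this] obtain c where c: "\<And>w. f k w = f k 0 + coord_form c w"
      by blast
    define b where "b i = (if i = k then f k 0 else c (inv_into UNIV (affine_index k) i))" for i
    have b: "b k = f k 0" "b (affine_index k j) = c j" for j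
      using bij_affine_index[of k] by (auto simp: b_def bij_betw_def inv_into_f_f)
    have "G v = coord_form b v" if "v $ k \<noteq> 0" for v
      unfolding G_split[OF that] c[of "quotient_coords k v"] coord_form_def sum_option_split[of _ k]
      using that by (simp add: b quotient_coords_def distrib_left sum_distrib_left mult.commute)
    thus ?thesis by blast
  qed
  then obtain b where b: "\<And>k v. v $ k \<noteq> 0 \<Longrightarrow> G v = coord_form (b k) v" by metis
  \<comment> \<open>Each \<open>b k\<close> is known to represent \<open>G\<close> only where
    \<open>v $ k \<noteq> 0\<close>; the form for the index \<open>None\<close> has to be carried
    over to the hyperplane \<open>v $ None = 0\<close>.\<close>
  have G: "G v = coord_form (b None) v" if v: "v \<noteq> 0" for v
  proof (cases "v $ None = 0")
    case True
    from v obtain k where k: "v $ k \<noteq> 0" by (auto simp: vec_eq_iff)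
    hence "k \<noteq> None" using True by metis
    let ?e = "axis None 1 :: complex^'N option"
    \<comment> \<open>\<open>v\<close> is the mean of two vectors at which both linear forms are known to give \<open>G\<close>.\<close>
    have double: "(v + ?e) + (v - ?e) = 2 *s v" by (simp add: vec_eq_iff)
    have eq: "coord_form (b k) u = coord_form (b None) u" if "u $ k \<noteq> 0" "u $ None \<noteq> 0" for u
      using b[OF that(1)] b[OF that(2)] by simp
    have "coord_form (b k) (v + ?e) + coord_form (b k) (v - ?e) =
      coord_form (b None) (v + ?e) + coord_form (b None) (v - ?e)"
      using True k \<open>k \<noteq> None\<close> by (intro arg_cong2[where f = "(+)"] eq) (auto simp: axis_def)
    hence "coord_form (b k) (2 *s v) = coord_form (b None) (2 *s v)"
      unfolding coord_form_add[symmetric] double .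
    thus ?thesis using b[OF k] by (simp add: coord_form_scale)
  qed (use b in blast)
  have "s = form_section (coord_form (b None))"
  proof
    fix l
    show "s l = form_section (coord_form (b None)) l"
    proof (cases "l \<in> proj_points")
      case True
      then obtain v where v: "v \<noteq> 0" "l = line v" by (rule proj_points_cases)
      have "snd (s (line v)) = restrict (coord_form (b None)) (line v)"
      proof
        fix u
        show "snd (s (line v)) u = restrict (coord_form (b None)) (line v) u"
        proof (cases "u \<in> line v")
          case True
          then obtain c where u: "u = c *s v" by (auto simp: mem_line)
          have "snd (s (line v)) u = c * G v"
            using s_line(2)[OF v(1)] by (simp add: u G_def linear_forms_def)
          thus ?thesis using True by (simp add: u coord_form_scale G[OF v(1)])
        next
          case False
          thus ?thesis using s_line(2)[OF v(1)] by (auto simp: linear_forms_def extensional_def)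
        qed
      qed
      thus ?thesis using s_line(1)[OF v(1)] v by (simp add: form_section_line)
    next
      case False
      thus ?thesis using assms by (auto simp: hol_section_def form_section_def PiE_iff extensional_def)
    qed
  qed
  thus ?thesis by (rule that)
qed

section \<open>Coherent vectors\<close>

text \<open>The common situation of both scalar products: \<kappa> = 1 for an orthonormal basis on
  M, \<kappa> = vol/(N+1) for linear forms on projective space. That \<open>comb\<close> reaches
  every section is what makes the coherent vector unique.\<close>

locale coherent_frame =
  fixes M :: "('a, 'n::finite) complex_mfd" and \<omega> :: "('a, 'n) form11"
    and L :: "('a, 'e) line_bundle" and h :: "'e \<Rightarrow> 'e \<Rightarrow> complex"
    and comb :: "('i::finite \<Rightarrow> complex) \<Rightarrow> 'a \<Rightarrow> 'e" and \<kappa> :: real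
  assumes carrier_comb: "carrier (hol_sections M L) = range comb"
    and inner_comb: "section_inner M \<omega> h (comb a) (comb b) = of_real \<kappa> * (\<Sum>j\<in>UNIV. cnj (a j) * b j)"
    and scale_nonzero: "\<kappa> \<noteq> 0"
begin

text \<open>Conjugate linearity in the first argument turns the coefficients \<open>p\<close> of the
  form into \<open>cnj p / \<kappa>\<close>; for uniqueness, pairing with the unit coefficient
  vectors reads off each \<open>a k\<close>.\<close>

lemma coherent_vector_comb:
  assumes "\<And>b. point_form L q (comb b) = (\<Sum>j\<in>UNIV. b j * p j)"
  shows "coherent_vector M \<omega> L h q = comb (\<lambda>j. cnj (p j) / of_real \<kappa>)"
  unfolding coherent_vector_def carrier_comb
proof (rule the_equality)
  have "section_inner M \<omega> h (comb (\<lambda>j. cnj (p j) / of_real \<kappa>)) (comb b) = point_form L q (comb b)" for b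
    unfolding inner_comb assms using scale_nonzero by (simp add: sum_distrib_left mult.commute)
  thus "comb (\<lambda>j. cnj (p j) / of_real \<kappa>) \<in> range comb \<and>
    (\<forall>s\<in>range comb. section_inner M \<omega> h (comb (\<lambda>j. cnj (p j) / of_real \<kappa>)) s = point_form L q s)"
    by blast
next
  fix e assume e: "e \<in> range comb \<and> (\<forall>s\<in>range comb. section_inner M \<omega> h e s = point_form L q s)"
  then obtain a where a: "e = comb a" by auto
  have "a k = cnj (p k) / of_real \<kappa>" for k
  proof -
    define b where "b j = (if j = k then 1 else 0 :: complex)" for j
    have sum_b: "(\<Sum>j\<in>UNIV. b j * f j) = f k" "(\<Sum>j\<in>UNIV. f j * b j) = f k" for f
      by (simp_all add: b_def if_distrib if_distribR cong: if_cong)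
    have "section_inner M \<omega> h (comb a) (comb b) = point_form L q (comb b)" using e a by auto
    hence "of_real \<kappa> * cnj (a k) = p k" unfolding inner_comb assms sum_b .
    hence "cnj (of_real \<kappa> * cnj (a k)) = cnj (p k)" by simp
    thus ?thesis using scale_nonzero by (simp add: field_simps)
  qed
  thus "e = comb (\<lambda>j. cnj (p j) / of_real \<kappa>)" using a by presburger
qed

text \<open>Each coherent vector carries 1/\<kappa> and the scalar product \<kappa>, which leaves
  1/\<kappa>.\<close>

lemma inner_coherent_vectors:
  assumes "\<And>b. point_form L q (comb b) = (\<Sum>j\<in>UNIV. b j * p j)"
    and "\<And>b. point_form L q' (comb b) = (\<Sum>j\<in>UNIV. b j * p' j)"
  shows "section_inner M \<omega> h (coherent_vector M \<omega> L h q) (coherent_vector M \<omega> L h q') =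
    (\<Sum>j\<in>UNIV. p j * cnj (p' j)) / of_real \<kappa>"
  unfolding coherent_vector_comb[OF assms(1)] coherent_vector_comb[OF assms(2)] inner_comb
  using scale_nonzero by (simp add: sum_distrib_left sum_divide_distrib)

end

section \<open>Coherent vectors of projective space\<close>

lemma carrier_hol_sections_hyperplane:
  "carrier (hol_sections projective_space (hyperplane_bundle :: (_, 'N::finite hyperplane_vector)
    line_bundle)) =
    range (\<lambda>b. form_section (coord_form b))"
  using hol_section_coord_form hol_section_hyperplane_bundle by (fastforce simp: hol_sections_def)

lemma coherent_frame_projective:
  "coherent_frame (projective_space :: ((complex^'N option) set, 'N) complex_mfd) fubini_study
    hyperplane_bundle hyperplane_metric
    (\<lambda>b. form_section (coord_form b)) (fs_volume TYPE('N::finite) / (CARD('N) + 1))"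
proof
  show "fs_volume TYPE('N) / (CARD('N) + 1) \<noteq> 0"
    using fs_volume_pos[where 'N = 'N] by simp
qed (rule carrier_hol_sections_hyperplane section_inner_coord_forms)+

text \<open>Evaluation relative to the frame Z_0 at \<open>line u\<close> sends Z_j to u_j/u_0, the
  \<open>j\<close>-th entry of the normalized representative. The prefactor is 1/\<kappa>, that is,
  F.\<close>

lemma coherent_inner_along_projective:
  fixes v w :: "complex^'N::finite option"
  assumes "v $ None \<noteq> 0" "w $ None \<noteq> 0"
  shows "coherent_inner_along projective_space fubini_study hyperplane_bundle hyperplane_metric
      (form_section (\<lambda>v. v $ None)) (line v) (line w) =
    of_real (real (CARD('N) + 1) / fs_volume TYPE('N)) *
    (\<Sum>j\<in>UNIV. (v $ j / v $ None) * cnj (w $ j / w $ None))"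
proof -
  interpret coherent_frame "projective_space :: ((complex^'N option) set, 'N) complex_mfd"
    fubini_study hyperplane_bundle hyperplane_metric
    "\<lambda>b. form_section (coord_form b)" "fs_volume TYPE('N) / (CARD('N) + 1)"
    by (rule coherent_frame_projective)
  have pf: "point_form hyperplane_bundle (form_section (\<lambda>v. v $ None) (line u)) (form_section
    (coord_form b)) =
      (\<Sum>j\<in>UNIV. b j * (u $ j / u $ None))" if "u $ None \<noteq> 0" for u :: "complex^'N option" and b
  proof -
    have "u \<noteq> 0" using that by auto
    hence "point_form hyperplane_bundle (form_section (\<lambda>v. v $ None) (line u)) (form_section
      (coord_form b)) =
      ratio (fibre hyperplane_bundle (line u)) (form_section (\<lambda>v. v $ None) (line u)) (line u,
        restrict (coord_form b) (line u))"
      by (simp add: point_form_def form_section_line) (simp add: hyperplane_bundle_def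
        form_section_line)
    also have "\<dots> = coord_form b u / u $ None"
      using \<open>u \<noteq> 0\<close> that by (subst ratio_hyperplane_bundle) (auto simp: coord_form_in_linear_forms)
    finally show ?thesis by (simp add: coord_form_def sum_divide_distrib)
  qed
  show ?thesis
    unfolding coherent_inner_along_def inner_coherent_vectors[OF pf[OF assms(1)] pf[OF assms(2)]]
    by simp
qed

section \<open>Integration over compact Kaehler manifolds\<close>

context complex_manifold
begin

lemma chart_domain_subset: "c \<in> atlas M \<Longrightarrow> fst c \<subseteq> points M"
  using chart_domain openin_subset by blast

lemma inj_on_chart: "c \<in> atlas M \<Longrightarrow> inj_on (snd c) (fst c)"
  using homeomorphic_imp_injective_map[OF chart_homeomorphic, of c] chart_domain_subset[of c]
  by (simp add: Int_absorb1)

lemma chart_inv_in: "z \<in> snd c ` fst c \<Longrightarrow> chart_inv c z \<in> fst c"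
  by (rule inv_into_into)

lemma chart_chart_inv: "z \<in> snd c ` fst c \<Longrightarrow> snd c (chart_inv c z) = z"
  by (rule f_inv_into_f)

lemma chart_inv_chart: "c \<in> atlas M \<Longrightarrow> p \<in> fst c \<Longrightarrow> chart_inv c (snd c p) = p"
  by (rule inv_into_f_f[OF inj_on_chart])

lemma chart_image_eq: "c \<in> atlas M \<Longrightarrow> chart_image c U = {z \<in> snd c ` fst c. chart_inv c z \<in> U}"
  using chart_inv_chart chart_inv_in chart_chart_inv by (auto simp: image_iff)

lemma open_chart_image:
  assumes "c \<in> atlas M" "openin (mtop M) U" shows "open (chart_image c U)"
proof -
  have "openin (subtopology (mtop M) (fst c)) (fst c \<inter> U)"
    using assms(2) by (metis inf_commute openin_subtopology)
  hence "openin (top_of_set (snd c ` fst c)) (snd c ` (fst c \<inter> U))"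
    using homeomorphic_imp_open_map[OF chart_homeomorphic[OF assms(1)]] by (simp add: open_map_def)
  thus ?thesis using chart_range[OF assms(1)] by (simp add: openin_open_eq)
qed

lemma continuous_map_chart_inv:
  "c \<in> atlas M \<Longrightarrow> continuous_map (top_of_set (snd c ` fst c)) (mtop M) (chart_inv c)"
  unfolding continuous_map
proof (intro conjI allI impI)
  assume c: "c \<in> atlas M"
  show "chart_inv c ` topspace (top_of_set (snd c ` fst c)) \<subseteq> points M"
    using chart_inv_chart[OF c] chart_domain_subset[OF c] by auto
  fix U assume U: "openin (mtop M) U"
  have "{z \<in> topspace (top_of_set (snd c ` fst c)). chart_inv c z \<in> U} = chart_image c U"
    by (simp add: chart_image_eq[OF c])
  thus "openin (top_of_set (snd c ` fst c)) {z \<in> topspace (top_of_set (snd c ` fst c)). chart_inv c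
    z \<in> U}"
    using open_chart_image[OF c U] chart_range[OF c] by (auto simp: openin_open_eq)
qed

text \<open>Existence is what gives the chosen partition in \<open>liouville_integral\<close> its
  properties. Compact Hausdorff spaces are normal, so Urysohn functions subordinate to charts are
  available, and finitely many of them suffice by compactness.\<close>

lemma partition_of_unity_exists:
  assumes "compact_space (mtop M)"
  shows "\<exists>P. partition_of_unity M P"
proof -
  have normal: "normal_space (mtop M)"
    using assms Hausdorff compact_Hausdorff_or_regular_imp_normal_space by blast
  define good where "good c g \<longleftrightarrow> c \<in> atlas M \<and> continuous_map (mtop M) euclideanreal g \<and>
        (\<forall>x\<in>points M. 0 \<le> g x) \<and> mtop M closure_of {x \<in> points M. g x \<noteq> 0} \<subseteq> fst c"
          for c and g :: "'a \<Rightarrow> real"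
  have ex: "\<exists>c g. good c g \<and> g x > 0" if x: "x \<in> points M" for x
  proof -
    obtain c where c: "c \<in> atlas M" "x \<in> fst c" using x atlas_cover by auto
    have "closedin (mtop M) {x}"
      using Hausdorff x by (simp add: closedin_Hausdorff_singleton)
    moreover have "closedin (mtop M) (points M - fst c)" using chart_domain[OF c(1)] by blast
    ultimately obtain f where f: "continuous_map (mtop M) euclideanreal f" "f ` {x} \<subseteq> {1}" "f `
      (points M - fst c) \<subseteq> {0}"
      using Urysohn_lemma_alt[OF normal, of "{x}" "points M - fst c" 1 0] c(2)
        by (auto simp: disjnt_def)
    \<comment> \<open>Subtracting 1/2 confines the support to the closed set where \<open>f\<close>
      is at least 1/2, which lies in the chart domain because \<open>f\<close> vanishes outside
      it.\<close>
    let ?g = "\<lambda>y. max 0 (f y - 1/2)"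
    have "closedin (mtop M) {y \<in> points M. f y \<in> {1/2..}}"
      by (rule closedin_continuous_map_preimage[OF f(1)]) simp
    hence "mtop M closure_of {y \<in> points M. ?g y \<noteq> 0} \<subseteq> {y \<in> points M. f y \<in> {1/2..}}"
      by (intro closure_of_minimal) auto
    also have "\<dots> \<subseteq> fst c" using f(3) by force
    finally have "good c ?g"
      using f(1) c(1) by (auto simp: good_def intro!: continuous_map_real_max continuous_map_diff)
    moreover have "?g x > 0" using f(2) by simp
    ultimately show ?thesis by blast
  qed
  define \<U> where "\<U> = (\<lambda>p. {x \<in> points M. snd p x > 0}) ` {p. good (fst p) (snd p)}"
  have "openin (mtop M) {x \<in> points M. g x \<in> {0<..}}" if "good c g" for c g
    using that by (intro openin_continuous_map_preimage[of _ euclideanreal]) (auto simp: good_def)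
  hence "openin (mtop M) U" if "U \<in> \<U>" for U using that by (auto simp: \<U>_def)
  moreover have "points M \<subseteq> \<Union> \<U>" using ex by (fastforce simp: \<U>_def)
  ultimately obtain \<F> where \<F>: "finite \<F>" "\<F> \<subseteq> \<U>" "points M \<subseteq> \<Union> \<F>"
    using assms unfolding compact_space_alt by metis
  obtain G where G: "finite G" "G \<subseteq> {p. good (fst p) (snd p)}" "\<F> =
    (\<lambda>p. {x \<in> points M. snd p x > 0}) ` G"
    using finite_subset_image[OF \<F>(1) \<F>(2)[unfolded \<U>_def]] by blast
  show ?thesis
  proof (rule partition_of_unity_normalise[OF G(1)])
    fix c g assume "(c, g) \<in> G"
    hence "good c g" using G(2) by auto
    thus "c \<in> atlas M \<and> continuous_map (mtop M) euclideanreal g \<and>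
        (\<forall>x\<in>points M. 0 \<le> g x) \<and> mtop M closure_of {x \<in> points M. g x \<noteq> 0} \<subseteq> fst c"
      by (simp add: good_def)
  next
    fix x assume x: "x \<in> points M"
    with \<F>(3) obtain p where p: "p \<in> G" "snd p x > 0" by (auto simp: G(3))
    have "0 < (\<Sum>p\<in>G. snd p x)"
    proof (rule sum_pos2[of G p "\<lambda>r. snd r x", OF G(1) p])
      fix r assume "r \<in> G"
      hence "good (fst r) (snd r)" using G(2) by auto
      thus "0 \<le> snd r x" using x by (simp add: good_def)
    qed
    thus "0 < (\<Sum>(c, g)\<in>G. g x)" by (simp add: case_prod_unfold)
  qed
qed

text \<open>Read in charts because the chart integrals are taken there and because holomorphy of
  sections is given by local ratios; the total space of the bundle carries no topology.\<close>

definition continuous_in_charts :: "('a \<Rightarrow> 'b::topological_space) \<Rightarrow> bool" where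
  "continuous_in_charts f \<longleftrightarrow> (\<forall>c\<in>atlas M. continuous_on (snd c ` fst c) (\<lambda>z. f (chart_inv c z)))"

end

section \<open>Linearity and symmetry of the Liouville integral\<close>

context kaehler_manifold
begin

lemma continuous_liouville_density:
  assumes "c \<in> atlas M"
  shows "continuous_on (snd c ` fst c) (\<lambda>z. liouville_density \<omega> c (chart_inv c z))"
proof -
  have "continuous_on (snd c ` fst c) (\<lambda>z. \<omega> c (chart_inv c z) $ j $ k)" for j k
    using form_smooth[OF assms, of j k] unfolding smooth_fun_on_def by (metis Ck_on.simps(1))
  thus ?thesis
    unfolding liouville_density_def
    by (intro continuous_on_mult continuous_on_const continuous_on_Re continuous_on_sum
      continuous_on_prod)
qed

text \<open>The support of \<rho> is closed in a compact space and contained in the chart, so its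
  image is compact; the integrand is continuous and vanishes off this image.\<close>

lemma set_integrable_liouville:
  fixes f :: "'a \<Rightarrow> 'b::{banach, second_countable_topology}"
  assumes compact: "compact_space (mtop M)" and P: "partition_of_unity M P" "(c, \<rho>) \<in> P" and f:
    "continuous_in_charts f"
  shows "set_integrable lborel (snd c ` fst c)
    (\<lambda>z. (\<rho> (chart_inv c z) * liouville_density \<omega> c (chart_inv c z)) *\<^sub>R f (chart_inv c z))"
proof -
  have c: "c \<in> atlas M" and \<rho>: "continuous_map (mtop M) euclideanreal \<rho>"
    and supp: "mtop M closure_of {x \<in> points M. \<rho> x \<noteq> 0} \<subseteq> fst c"
    using P by (auto simp: partition_of_unity_def)
  let ?S = "snd c ` fst c"
  define K where "K = snd c ` (mtop M closure_of {x \<in> points M. \<rho> x \<noteq> 0})"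
  define g where "g z = (\<rho> (chart_inv c z) * liouville_density \<omega> c (chart_inv c z)) *\<^sub>R f (chart_inv
    c z)" for z
  have "compactin (mtop M) (mtop M closure_of {x \<in> points M. \<rho> x \<noteq> 0})"
    using compact by (simp add: closedin_compact_space)
  hence "compactin (subtopology (mtop M) (fst c)) (mtop M closure_of {x \<in> points M. \<rho> x \<noteq> 0})"
    using supp by (simp add: compactin_subtopology)
  hence "compactin (top_of_set ?S) K"
    unfolding K_def using homeomorphic_imp_continuous_map[OF chart_homeomorphic[OF c]]
      by (rule image_compactin)
  hence K: "compact K" by (simp add: compactin_subtopology)
  have KS: "K \<subseteq> ?S" using supp by (auto simp: K_def)
  have "continuous_map (top_of_set ?S) euclideanreal (\<rho> \<circ> chart_inv c)"
    using continuous_map_chart_inv[OF c] \<rho> by (rule continuous_map_compose)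
  hence "continuous_on ?S (\<lambda>z. \<rho> (chart_inv c z))" by (simp add: comp_def)
  hence g: "continuous_on ?S g"
    unfolding g_def using f c
    by (intro continuous_intros continuous_liouville_density[OF c]) (auto simp:
      continuous_in_charts_def)
  have zero: "g z = 0" if "z \<in> ?S" "z \<notin> K" for z
  proof (rule ccontr)
    assume "g z \<noteq> 0"
    hence "\<rho> (chart_inv c z) \<noteq> 0" by (auto simp: g_def)
    moreover have "chart_inv c z \<in> points M"
      using chart_inv_in[OF that(1)] chart_domain_subset[OF c] by auto
    moreover have "{x \<in> points M. \<rho> x \<noteq> 0} \<subseteq> mtop M closure_of {x \<in> points M. \<rho> x \<noteq> 0}"
      by (rule closure_of_subset) auto
    ultimately have "chart_inv c z \<in> mtop M closure_of {x \<in> points M. \<rho> x \<noteq> 0}" by blast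
    hence "snd c (chart_inv c z) \<in> K" unfolding K_def by (rule imageI)
    thus False using chart_chart_inv[OF that(1)] that(2) by simp
  qed
  have "integrable lborel (\<lambda>z. indicator K z *\<^sub>R g z)"
    using K continuous_on_subset[OF g KS] by (rule borel_integrable_compact)
  also have "(\<lambda>z. indicator K z *\<^sub>R g z) = (\<lambda>z. indicator ?S z *\<^sub>R g z)"
    using zero KS by (auto simp: indicator_def fun_eq_iff)
  finally show ?thesis by (simp add: set_integrable_def g_def)
qed

text \<open>The choice of the partition does not involve the integrand, so the three integrals have
  the same charts and weights and additivity holds termwise.\<close>

lemma liouville_integral_add:
  fixes f g :: "'a \<Rightarrow> 'b::{banach, second_countable_topology}"
  assumes "compact_space (mtop M)" "continuous_in_charts f" "continuous_in_charts g"
  shows "liouville_integral M \<omega> (\<lambda>x. f x + g x) = liouville_integral M \<omega> f + liouville_integral M \<omega> g"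
proof -
  have P: "partition_of_unity M (SOME P. partition_of_unity M P)"
    using partition_of_unity_exists[OF assms(1)] by (rule someI_ex)
  show ?thesis
    unfolding liouville_integral_def sum.distrib[symmetric]
  proof (rule sum.cong[OF refl])
    fix p assume "p \<in> (SOME P. partition_of_unity M P)"
    moreover obtain c \<rho> where "p = (c, \<rho>)" by (cases p)
    ultimately have p: "p = (c, \<rho>)" "(c, \<rho>) \<in> (SOME P. partition_of_unity M P)" by simp_all
    note int = set_integrable_liouville[OF assms(1) P p(2)]
    show "(case p of (c, \<rho>) \<Rightarrow> LINT z : snd c ` fst c | lborel.
          (\<rho> (chart_inv c z) * liouville_density \<omega> c (chart_inv c z)) *\<^sub>R (f (chart_inv c z) + g
            (chart_inv c z))) =
      (case p of (c, \<rho>) \<Rightarrow> LINT z : snd c ` fst c | lborel.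
          (\<rho> (chart_inv c z) * liouville_density \<omega> c (chart_inv c z)) *\<^sub>R f (chart_inv c z)) +
      (case p of (c, \<rho>) \<Rightarrow> LINT z : snd c ` fst c | lborel.
          (\<rho> (chart_inv c z) * liouville_density \<omega> c (chart_inv c z)) *\<^sub>R g (chart_inv c z))"
      unfolding p(1) prod.case scaleR_add_right
      by (rule set_integral_add[OF int[OF assms(2)] int[OF assms(3)]])
  qed
qed

lemma liouville_integral_mult:
  fixes f :: "'a \<Rightarrow> complex"
  shows "liouville_integral M \<omega> (\<lambda>x. a * f x) = a * liouville_integral M \<omega> f"
  unfolding liouville_integral_def sum_distrib_left case_prod_unfold set_lebesgue_integral_def
    mult_scaleR_right[symmetric]
  by (rule sum.cong[OF refl]) (rule integral_mult_right_zero)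

lemma liouville_integral_cnj:
  fixes f :: "'a \<Rightarrow> complex"
  shows "liouville_integral M \<omega> (\<lambda>x. cnj (f x)) = cnj (liouville_integral M \<omega> f)"
  unfolding liouville_integral_def cnj_sum
proof (rule sum.cong[OF refl])
  fix p :: "('a, 'n) chart \<times> ('a \<Rightarrow> real)"
  obtain c \<rho> where p: "p = (c, \<rho>)" by (cases p)
  show "(case p of (c, \<rho>) \<Rightarrow> LINT z : snd c ` fst c | lborel.
          (\<rho> (chart_inv c z) * liouville_density \<omega> c (chart_inv c z)) *\<^sub>R cnj (f (chart_inv c z))) =
      cnj (case p of (c, \<rho>) \<Rightarrow> LINT z : snd c ` fst c | lborel.
          (\<rho> (chart_inv c z) * liouville_density \<omega> c (chart_inv c z)) *\<^sub>R f (chart_inv c z))"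
    unfolding p prod.case set_lebesgue_integral_def Bochner_Integration.integral_cnj[symmetric]
      complex_cnj_scaleR ..
qed

text \<open>The charts of the chosen partition belong to the atlas, so the chart integrals evaluate
  the functions at points of M only. Compactness guarantees the partition.\<close>

lemma liouville_integral_cong:
  assumes "compact_space (mtop M)" "\<And>x. x \<in> points M \<Longrightarrow> f x = g x"
  shows "liouville_integral M \<omega> f = liouville_integral M \<omega> g"
  unfolding liouville_integral_def case_prod_unfold
proof (rule sum.cong[OF refl])
  fix p assume "p \<in> (SOME P. partition_of_unity M P)"
  moreover have "partition_of_unity M (SOME P. partition_of_unity M P)"
    using partition_of_unity_exists[OF assms(1)] by (rule someI_ex)
  ultimately have c: "fst p \<in> atlas M" by (auto simp: partition_of_unity_def)
  have "f (chart_inv (fst p) z) = g (chart_inv (fst p) z)" if "z \<in> snd (fst p) ` fst (fst p)" for z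
    using assms(2) chart_inv_in[OF that] chart_domain_subset[OF c] by blast
  thus "(LINT z : snd (fst p) ` fst (fst p) | lborel.
        (snd p (chart_inv (fst p) z) * liouville_density \<omega> (fst p) (chart_inv (fst p) z)) *\<^sub>R f
          (chart_inv (fst p) z)) =
      (LINT z : snd (fst p) ` fst (fst p) | lborel.
        (snd p (chart_inv (fst p) z) * liouville_density \<omega> (fst p) (chart_inv (fst p) z)) *\<^sub>R g
          (chart_inv (fst p) z))"
    unfolding set_lebesgue_integral_def
      by (intro Bochner_Integration.integral_cong refl) (auto simp: indicator_def)
qed

end

section \<open>Holomorphic sections of a quantum line bundle\<close>

context holomorphic_line_bundle
begin

lemma fibre_smult_closed:
  "x \<in> points M \<Longrightarrow> u \<in> carrier (fibre L x) \<Longrightarrow> a \<odot>\<^bsub>fibre L x\<^esub> u \<in> carrier (fibre L x)"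
  using module.smult_closed[OF fibre_vector_space] by (simp add: complex_ring_def)

lemma fibre_smult_assoc:
  "x \<in> points M \<Longrightarrow> u \<in> carrier (fibre L x) \<Longrightarrow> (a * b) \<odot>\<^bsub>fibre L x\<^esub> u = a \<odot>\<^bsub>fibre L x\<^esub> (b \<odot>\<^bsub>fibre L x\<^esub> u)"
  using module.smult_assoc1[OF fibre_vector_space] by (simp add: complex_ring_def)

lemma fibre_smult_add_left:
  "x \<in> points M \<Longrightarrow> u \<in> carrier (fibre L x) \<Longrightarrow> (a + b) \<odot>\<^bsub>fibre L x\<^esub> u =
    a \<odot>\<^bsub>fibre L x\<^esub> u \<oplus>\<^bsub>fibre L x\<^esub> b \<odot>\<^bsub>fibre L x\<^esub> u"
  using module.smult_l_distr[OF fibre_vector_space] by (simp add: complex_ring_def)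

lemma fibre_smult_zero_left:
  "x \<in> points M \<Longrightarrow> u \<in> carrier (fibre L x) \<Longrightarrow> 0 \<odot>\<^bsub>fibre L x\<^esub> u = \<zero>\<^bsub>fibre L x\<^esub>"
  using module.smult_l_null[OF fibre_vector_space] by (simp add: complex_ring_def)

lemma fibre_abelian_group: "x \<in> points M \<Longrightarrow> abelian_group (fibre L x)"
  using fibre_vector_space by (simp add: Module.module_def)

lemma frame_domain_subset: "(U, t) \<in> frames L \<Longrightarrow> U \<subseteq> points M"
  using frame_domain openin_subset by blast

text \<open>The vector \<open>u\<close> is a basis of the fibre, which is when the description in
  \<open>ratio\<close> singles out a unique number. It covers values of frames and arbitrary nonzero
  vectors.\<close>

definition spans_fibre :: "'a \<Rightarrow> 'e \<Rightarrow> bool" where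
  "spans_fibre x u \<longleftrightarrow> u \<in> carrier (fibre L x) \<and>
    bij_betw (\<lambda>c. c \<odot>\<^bsub>fibre L x\<^esub> u) UNIV (carrier (fibre L x))"

lemma frame_spans_fibre: "(U, t) \<in> frames L \<Longrightarrow> x \<in> U \<Longrightarrow> spans_fibre x (t x)"
  by (simp add: spans_fibre_def frame_in_fibre frame_basis)

lemma ratio_smult_self: "spans_fibre x u \<Longrightarrow> ratio (fibre L x) u (c \<odot>\<^bsub>fibre L x\<^esub> u) = c"
  unfolding ratio_def spans_fibre_def bij_betw_def inj_on_def by (intro the_equality) auto

lemma ratio_smult:
  assumes "spans_fibre x u" "v \<in> carrier (fibre L x)"
  shows "ratio (fibre L x) u v \<odot>\<^bsub>fibre L x\<^esub> u = v"
proof -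
  have "v \<in> range (\<lambda>c. c \<odot>\<^bsub>fibre L x\<^esub> u)"
    using assms by (simp add: spans_fibre_def bij_betw_def)
  then obtain c where "v = c \<odot>\<^bsub>fibre L x\<^esub> u" by blast
  thus ?thesis using ratio_smult_self[OF assms(1)] by simp
qed

lemma ratio_eqI: "spans_fibre x u \<Longrightarrow> v = c \<odot>\<^bsub>fibre L x\<^esub> u \<Longrightarrow> ratio (fibre L x) u v = c"
  using ratio_smult_self by simp

lemma ratio_add:
  assumes "x \<in> points M" "spans_fibre x u" "v \<in> carrier (fibre L x)" "w \<in> carrier (fibre L x)"
  shows "ratio (fibre L x) u (v \<oplus>\<^bsub>fibre L x\<^esub> w) = ratio (fibre L x) u v + ratio (fibre L x) u w"
proof (rule ratio_eqI[OF assms(2)])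
  have "u \<in> carrier (fibre L x)" using assms(2) by (simp add: spans_fibre_def)
  thus "v \<oplus>\<^bsub>fibre L x\<^esub> w = (ratio (fibre L x) u v + ratio (fibre L x) u w) \<odot>\<^bsub>fibre L x\<^esub> u"
    using assms by (simp add: fibre_smult_add_left ratio_smult)
qed

lemma ratio_scale:
  assumes "x \<in> points M" "spans_fibre x u" "v \<in> carrier (fibre L x)"
  shows "ratio (fibre L x) u (a \<odot>\<^bsub>fibre L x\<^esub> v) = a * ratio (fibre L x) u v"
proof (rule ratio_eqI[OF assms(2)])
  have "u \<in> carrier (fibre L x)" using assms(2) by (simp add: spans_fibre_def)
  thus "a \<odot>\<^bsub>fibre L x\<^esub> v = (a * ratio (fibre L x) u v) \<odot>\<^bsub>fibre L x\<^esub> u"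
    using assms by (simp add: fibre_smult_assoc ratio_smult)
qed

lemma ratio_zero:
  assumes "x \<in> points M" "spans_fibre x u"
  shows "ratio (fibre L x) u \<zero>\<^bsub>fibre L x\<^esub> = 0"
  using assms by (intro ratio_eqI) (auto simp: spans_fibre_def fibre_smult_zero_left)

text \<open>One-dimensionality is given through frames: \<open>q\<close> is a nonzero multiple of a
  frame value, and multiplication by that factor permutes the complex numbers.\<close>

lemma nonzero_spans_fibre:
  assumes x: "x \<in> points M" and q: "q \<in> carrier (fibre L x)" "q \<noteq> \<zero>\<^bsub>fibre L x\<^esub>"
  shows "spans_fibre x q"
proof -
  obtain U t where t: "(U, t) \<in> frames L" "x \<in> U" using x frames_cover by auto
  note span = frame_spans_fibre[OF t]
  have tc: "t x \<in> carrier (fibre L x)" and bij: "bij_betw (\<lambda>c. c \<odot>\<^bsub>fibre L x\<^esub> t x) UNIV (carrier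
    (fibre L x))"
    using span by (auto simp: spans_fibre_def)
  define a where "a = ratio (fibre L x) (t x) q"
  have qa: "q = a \<odot>\<^bsub>fibre L x\<^esub> t x" using ratio_smult[OF span q(1)] by (simp add: a_def)
  have a: "a \<noteq> 0" using q(2) fibre_smult_zero_left[OF x tc] by (auto simp: qa)
  have "bij_betw (\<lambda>c. c * a) UNIV (UNIV :: complex set)"
    by (rule bij_betw_byWitness[of _ "\<lambda>c. c / a"]) (use a in auto)
  from bij_betw_trans[OF this bij] show ?thesis
    using q(1) by (simp add: spans_fibre_def comp_def qa fibre_smult_assoc[OF x tc])
qed

lemma nonzero_vectors_over:
  assumes "q \<in> nonzero_vectors M L" "bproj L q = x"
  shows "x \<in> points M" "q \<in> carrier (fibre L x)" "q \<noteq> \<zero>\<^bsub>fibre L x\<^esub>" "spans_fibre x q"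
proof -
  obtain x' where x': "x' \<in> points M" "q \<in> carrier (fibre L x')" "q \<noteq> \<zero>\<^bsub>fibre L x'\<^esub>"
    using assms(1) by (auto simp: nonzero_vectors_def)
  hence "x' = x" using fibre_bproj assms(2) by blast
  thus *: "x \<in> points M" "q \<in> carrier (fibre L x)" "q \<noteq> \<zero>\<^bsub>fibre L x\<^esub>" using x' by auto
  show "spans_fibre x q" by (rule nonzero_spans_fibre) fact+
qed

lemma holomorphic_on_mfd_cong:
  assumes "openin (mtop M) U" "holomorphic_on_mfd M f U" "\<And>x. x \<in> U \<Longrightarrow> f x = g x"
  shows "holomorphic_on_mfd M g U"
  unfolding holomorphic_on_mfd_def
proof
  fix c assume c: "c \<in> atlas M"
  show "holomorphic_fun_on (g \<circ> chart_inv c) (chart_image c U)"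
  proof (rule holomorphic_fun_on_cong_open)
    show "open (chart_image c U)" by (rule open_chart_image[OF c assms(1)])
    show "holomorphic_fun_on (f \<circ> chart_inv c) (chart_image c U)"
      using assms(2) c by (simp add: holomorphic_on_mfd_def)
    show "(f \<circ> chart_inv c) z = (g \<circ> chart_inv c) z" if "z \<in> chart_image c U" for z
      using that assms(3) by (simp add: chart_image_eq[OF c])
  qed
qed

section \<open>The space of holomorphic sections\<close>

abbreviation \<Gamma> :: "(complex, 'a \<Rightarrow> 'e) module" where
  "\<Gamma> \<equiv> hol_sections M L"

lemma section_in_fibre: "\<phi> \<in> carrier \<Gamma> \<Longrightarrow> x \<in> points M \<Longrightarrow> \<phi> x \<in> carrier (fibre L x)"
  by (auto simp: hol_sections_def hol_section_def)

lemma section_holomorphic: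
  "\<phi> \<in> carrier \<Gamma> \<Longrightarrow> (U, t) \<in> frames L \<Longrightarrow> holomorphic_on_mfd M (\<lambda>x. ratio (fibre L x) (t x) (\<phi> x)) U"
  by (auto simp: hol_sections_def hol_section_def)

lemma section_extensional: "\<phi> \<in> carrier \<Gamma> \<Longrightarrow> \<phi> \<in> extensional (points M)"
  by (auto simp: hol_sections_def hol_section_def PiE_def)

lemma sectionI:
  assumes "\<And>x. x \<in> points M \<Longrightarrow> \<phi> x \<in> carrier (fibre L x)" "\<phi> \<in> extensional (points M)"
    "\<And>U t. (U, t) \<in> frames L \<Longrightarrow> holomorphic_on_mfd M (\<lambda>x. ratio (fibre L x) (t x) (\<phi> x)) U"
  shows "\<phi> \<in> carrier \<Gamma>"
  using assms by (auto simp: hol_sections_def hol_section_def PiE_def)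

lemma section_eqI:
  assumes "\<phi> \<in> carrier \<Gamma>" "\<psi> \<in> carrier \<Gamma>" "\<And>x. x \<in> points M \<Longrightarrow> \<phi> x = \<psi> x" shows "\<phi> = \<psi>"
  using section_extensional[OF assms(1)] section_extensional[OF assms(2)] assms(3)
    by (rule extensionalityI)

lemma section_add_apply: "x \<in> points M \<Longrightarrow> (\<phi> \<oplus>\<^bsub>\<Gamma>\<^esub> \<psi>) x = \<phi> x \<oplus>\<^bsub>fibre L x\<^esub> \<psi> x"
  by (simp add: hol_sections_def)

lemma section_smult_apply: "x \<in> points M \<Longrightarrow> (a \<odot>\<^bsub>\<Gamma>\<^esub> \<phi>) x = a \<odot>\<^bsub>fibre L x\<^esub> \<phi> x"
  by (simp add: hol_sections_def)

lemma section_zero_apply: "x \<in> points M \<Longrightarrow> \<zero>\<^bsub>\<Gamma>\<^esub> x = \<zero>\<^bsub>fibre L x\<^esub>"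
  by (simp add: hol_sections_def)

lemma section_add_closed:
  assumes "\<phi> \<in> carrier \<Gamma>" "\<psi> \<in> carrier \<Gamma>" shows "\<phi> \<oplus>\<^bsub>\<Gamma>\<^esub> \<psi> \<in> carrier \<Gamma>"
proof (rule sectionI)
  fix x assume x: "x \<in> points M"
  interpret abelian_group "fibre L x" by (rule fibre_abelian_group[OF x])
  show "(\<phi> \<oplus>\<^bsub>\<Gamma>\<^esub> \<psi>) x \<in> carrier (fibre L x)"
    by (simp add: section_add_apply[OF x] section_in_fibre[OF _ x] assms)
next
  fix U t assume t: "(U, t) \<in> frames L"
  show "holomorphic_on_mfd M (\<lambda>x. ratio (fibre L x) (t x) ((\<phi> \<oplus>\<^bsub>\<Gamma>\<^esub> \<psi>) x)) U"
  proof (rule holomorphic_on_mfd_cong[OF frame_domain[OF t]])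
    show "holomorphic_on_mfd M (\<lambda>x. ratio (fibre L x) (t x) (\<phi> x) + ratio (fibre L x) (t x) (\<psi> x)) U"
      using section_holomorphic[OF assms(1) t] section_holomorphic[OF assms(2) t]
      by (auto simp: holomorphic_on_mfd_def comp_def intro!: holomorphic_fun_on_add)
    fix x assume "x \<in> U"
    moreover from this have "x \<in> points M" using frame_domain_subset[OF t] by auto
    ultimately show "ratio (fibre L x) (t x) (\<phi> x) + ratio (fibre L x) (t x) (\<psi> x) =
      ratio (fibre L x) (t x) ((\<phi> \<oplus>\<^bsub>\<Gamma>\<^esub> \<psi>) x)"
      by (simp add: section_add_apply ratio_add frame_spans_fibre[OF t] section_in_fibre assms)
  qed
qed (simp add: hol_sections_def)

lemma section_smult_closed:
  assumes "\<phi> \<in> carrier \<Gamma>" shows "a \<odot>\<^bsub>\<Gamma>\<^esub> \<phi> \<in> carrier \<Gamma>"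
proof (rule sectionI)
  fix x assume x: "x \<in> points M"
  show "(a \<odot>\<^bsub>\<Gamma>\<^esub> \<phi>) x \<in> carrier (fibre L x)"
    by (simp add: section_smult_apply[OF x] section_in_fibre[OF _ x] assms fibre_smult_closed[OF x])
next
  fix U t assume t: "(U, t) \<in> frames L"
  show "holomorphic_on_mfd M (\<lambda>x. ratio (fibre L x) (t x) ((a \<odot>\<^bsub>\<Gamma>\<^esub> \<phi>) x)) U"
  proof (rule holomorphic_on_mfd_cong[OF frame_domain[OF t]])
    show "holomorphic_on_mfd M (\<lambda>x. a * ratio (fibre L x) (t x) (\<phi> x)) U"
      using section_holomorphic[OF assms(1) t]
      by (auto simp: holomorphic_on_mfd_def comp_def intro!: holomorphic_fun_on_mult
        holomorphic_fun_on_const)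
    fix x assume "x \<in> U"
    moreover from this have "x \<in> points M" using frame_domain_subset[OF t] by auto
    ultimately show "a * ratio (fibre L x) (t x) (\<phi> x) = ratio (fibre L x) (t x) ((a \<odot>\<^bsub>\<Gamma>\<^esub> \<phi>) x)"
      by (simp add: section_smult_apply ratio_scale frame_spans_fibre[OF t] section_in_fibre assms)
  qed
qed (simp add: hol_sections_def)

lemma section_zero_closed: "\<zero>\<^bsub>\<Gamma>\<^esub> \<in> carrier \<Gamma>"
proof (rule sectionI)
  fix x assume x: "x \<in> points M"
  interpret abelian_group "fibre L x" by (rule fibre_abelian_group[OF x])
  show "\<zero>\<^bsub>\<Gamma>\<^esub> x \<in> carrier (fibre L x)" by (simp add: section_zero_apply[OF x])
next
  fix U t assume t: "(U, t) \<in> frames L"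
  show "holomorphic_on_mfd M (\<lambda>x. ratio (fibre L x) (t x) (\<zero>\<^bsub>\<Gamma>\<^esub> x)) U"
  proof (rule holomorphic_on_mfd_cong[OF frame_domain[OF t]])
    show "holomorphic_on_mfd M (\<lambda>x. 0) U"
      by (auto simp: holomorphic_on_mfd_def comp_def intro!: holomorphic_fun_on_const)
    fix x assume "x \<in> U"
    moreover from this have "x \<in> points M" using frame_domain_subset[OF t] by auto
    ultimately show "0 = ratio (fibre L x) (t x) (\<zero>\<^bsub>\<Gamma>\<^esub> x)"
      by (simp add: section_zero_apply ratio_zero frame_spans_fibre[OF t])
  qed
qed (simp add: hol_sections_def)

text \<open>The additive structure is what \<open>finsum\<close> works with; the multiplicative part
  of the module record is unspecified.\<close>

lemma sections_abelian_monoid: "abelian_monoid \<Gamma>"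
proof (rule abelian_monoidI)
  fix \<phi> \<psi> \<eta> assume carr: "\<phi> \<in> carrier \<Gamma>" "\<psi> \<in> carrier \<Gamma>" "\<eta> \<in> carrier \<Gamma>"
  show "\<phi> \<oplus>\<^bsub>\<Gamma>\<^esub> \<psi> \<oplus>\<^bsub>\<Gamma>\<^esub> \<eta> = \<phi> \<oplus>\<^bsub>\<Gamma>\<^esub> (\<psi> \<oplus>\<^bsub>\<Gamma>\<^esub> \<eta>)"
  proof (rule section_eqI)
    fix x assume x: "x \<in> points M"
    interpret abelian_group "fibre L x" by (rule fibre_abelian_group[OF x])
    show "(\<phi> \<oplus>\<^bsub>\<Gamma>\<^esub> \<psi> \<oplus>\<^bsub>\<Gamma>\<^esub> \<eta>) x = (\<phi> \<oplus>\<^bsub>\<Gamma>\<^esub> (\<psi> \<oplus>\<^bsub>\<Gamma>\<^esub> \<eta>)) x"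
      using carr x by (simp add: section_add_apply section_in_fibre a_assoc)
  qed (simp_all add: section_add_closed carr)
next
  fix \<phi> \<psi> assume carr: "\<phi> \<in> carrier \<Gamma>" "\<psi> \<in> carrier \<Gamma>"
  show "\<phi> \<oplus>\<^bsub>\<Gamma>\<^esub> \<psi> = \<psi> \<oplus>\<^bsub>\<Gamma>\<^esub> \<phi>"
  proof (rule section_eqI)
    fix x assume x: "x \<in> points M"
    interpret abelian_group "fibre L x" by (rule fibre_abelian_group[OF x])
    show "(\<phi> \<oplus>\<^bsub>\<Gamma>\<^esub> \<psi>) x = (\<psi> \<oplus>\<^bsub>\<Gamma>\<^esub> \<phi>) x"
      using carr x by (simp add: section_add_apply section_in_fibre a_comm)
  qed (simp_all add: section_add_closed carr)
next
  fix \<phi> assume carr: "\<phi> \<in> carrier \<Gamma>"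
  show "\<zero>\<^bsub>\<Gamma>\<^esub> \<oplus>\<^bsub>\<Gamma>\<^esub> \<phi> = \<phi>"
  proof (rule section_eqI)
    fix x assume x: "x \<in> points M"
    interpret abelian_group "fibre L x" by (rule fibre_abelian_group[OF x])
    show "(\<zero>\<^bsub>\<Gamma>\<^esub> \<oplus>\<^bsub>\<Gamma>\<^esub> \<phi>) x = \<phi> x"
      using carr x by (simp add: section_add_apply section_zero_apply section_in_fibre)
  qed (simp_all add: section_add_closed section_zero_closed carr)
qed (auto simp: section_add_closed section_zero_closed)

text \<open>Serves the scalar product in its second argument and the evaluation
  \<open>point_form L q\<close>, the two functionals to be computed on expansions in the
  basis.\<close>

lemma linear_functional_finsum:
  fixes \<Phi> :: "('a \<Rightarrow> 'e) \<Rightarrow> complex"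
  assumes add: "\<And>\<phi> \<psi>. \<phi> \<in> carrier \<Gamma> \<Longrightarrow> \<psi> \<in> carrier \<Gamma> \<Longrightarrow> \<Phi> (\<phi> \<oplus>\<^bsub>\<Gamma>\<^esub> \<psi>) = \<Phi> \<phi> + \<Phi> \<psi>"
    and scale: "\<And>a \<phi>. \<phi> \<in> carrier \<Gamma> \<Longrightarrow> \<Phi> (a \<odot>\<^bsub>\<Gamma>\<^esub> \<phi>) = a * \<Phi> \<phi>"
    and "finite A" and s: "\<And>j. s j \<in> carrier \<Gamma>"
  shows "\<Phi> (finsum \<Gamma> (\<lambda>j. a j \<odot>\<^bsub>\<Gamma>\<^esub> s j) A) = (\<Sum>j\<in>A. a j * \<Phi> (s j))"
  using \<open>finite A\<close>
proof induction
  case empty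
  interpret abelian_monoid \<Gamma> by (rule sections_abelian_monoid)
  have "\<Phi> \<zero>\<^bsub>\<Gamma>\<^esub> + \<Phi> \<zero>\<^bsub>\<Gamma>\<^esub> = \<Phi> \<zero>\<^bsub>\<Gamma>\<^esub>"
    using add[OF section_zero_closed section_zero_closed] l_zero[OF section_zero_closed] by simp
  thus ?case by simp
next
  case (insert k A)
  interpret abelian_monoid \<Gamma> by (rule sections_abelian_monoid)
  have "finsum \<Gamma> (\<lambda>j. a j \<odot>\<^bsub>\<Gamma>\<^esub> s j) (insert k A) = a k \<odot>\<^bsub>\<Gamma>\<^esub> s k \<oplus>\<^bsub>\<Gamma>\<^esub> finsum \<Gamma> (\<lambda>j. a j \<odot>\<^bsub>\<Gamma>\<^esub> s j) A"
    using insert.hyps s by (intro finsum_insert) (auto simp: section_smult_closed)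
  moreover have "finsum \<Gamma> (\<lambda>j. a j \<odot>\<^bsub>\<Gamma>\<^esub> s j) A \<in> carrier \<Gamma>"
    using s by (intro finsum_closed) (auto simp: section_smult_closed)
  ultimately show ?case
    using insert s by (simp add: add scale section_smult_closed)
qed

lemma point_form_add:
  assumes "q \<in> nonzero_vectors M L" "\<phi> \<in> carrier \<Gamma>" "\<psi> \<in> carrier \<Gamma>"
  shows "point_form L q (\<phi> \<oplus>\<^bsub>\<Gamma>\<^esub> \<psi>) = point_form L q \<phi> + point_form L q \<psi>"
  using nonzero_vectors_over[OF assms(1) refl] assms(2,3)
  by (simp add: point_form_def section_add_apply ratio_add section_in_fibre)

lemma point_form_smult:
  assumes "q \<in> nonzero_vectors M L" "\<phi> \<in> carrier \<Gamma>"
  shows "point_form L q (a \<odot>\<^bsub>\<Gamma>\<^esub> \<phi>) = a * point_form L q \<phi>"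
  using nonzero_vectors_over[OF assms(1) refl] assms(2)
  by (simp add: point_form_def section_smult_apply ratio_scale section_in_fibre)

text \<open>Another nonzero vector over \<open>x\<close> multiplies all coordinates by the same
  nonzero factor, so the vector picked in \<open>map_to_proj\<close> may be replaced by
  \<open>q\<close>.\<close>

lemma map_to_proj_eq:
  assumes q: "q \<in> nonzero_vectors M L" "bproj L q = x" and s: "\<And>j. s j \<in> carrier \<Gamma>"
  shows "map_to_proj M L s x = line (\<chi> j. point_form L q (s j))"
proof -
  define q0 where "q0 = (SOME q. q \<in> nonzero_vectors M L \<and> bproj L q = x)"
  have q0: "q0 \<in> nonzero_vectors M L" "bproj L q0 = x"
    using someI[of "\<lambda>q. q \<in> nonzero_vectors M L \<and> bproj L q = x" q] q by (auto simp: q0_def)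
  note Q = nonzero_vectors_over[OF q] and Q0 = nonzero_vectors_over[OF q0]
  define d where "d = ratio (fibre L x) q0 q"
  have d: "q = d \<odot>\<^bsub>fibre L x\<^esub> q0" using ratio_smult[OF Q0(4) Q(2)] by (simp add: d_def)
  have "d \<noteq> 0" using d Q(3) fibre_smult_zero_left[OF Q0(1,2)] by auto
  have "point_form L q0 (s j) = d * point_form L q (s j)" for j
  proof -
    have "s j x = ratio (fibre L x) q (s j x) \<odot>\<^bsub>fibre L x\<^esub> (d \<odot>\<^bsub>fibre L x\<^esub> q0)"
      unfolding d[symmetric] using ratio_smult[OF Q(4) section_in_fibre[OF s Q(1)]] by simp
    hence "s j x = (ratio (fibre L x) q (s j x) * d) \<odot>\<^bsub>fibre L x\<^esub> q0"
      by (simp add: fibre_smult_assoc[OF Q0(1,2)])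
    hence "ratio (fibre L x) q0 (s j x) = ratio (fibre L x) q (s j x) * d" by (rule ratio_eqI[OF Q0(4)])
    thus ?thesis by (simp add: point_form_def q(2) q0(2))
  qed
  hence "(\<chi> j. point_form L q0 (s j)) = d *s (\<chi> j. point_form L q (s j))" by (simp add: vec_eq_iff)
  thus ?thesis
    unfolding map_to_proj_def Let_def q0_def[symmetric] using line_scale[OF \<open>d \<noteq> 0\<close>] by metis
qed

end

section \<open>The metric on sections\<close>

context hermitian_line_bundle
begin

lemma metric_scale_left:
  assumes "x \<in> points M" "u \<in> carrier (fibre L x)" "v \<in> carrier (fibre L x)"
  shows "h (a \<odot>\<^bsub>fibre L x\<^esub> u) v = cnj a * h u v"
proof -
  have "h (a \<odot>\<^bsub>fibre L x\<^esub> u) v = cnj (h v (a \<odot>\<^bsub>fibre L x\<^esub> u))"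
    using assms by (intro metric_hermitian) (auto simp: fibre_smult_closed)
  also have "\<dots> = cnj a * cnj (h v u)" using assms by (simp add: metric_scale)
  also have "cnj (h v u) = h u v" using metric_hermitian[OF assms(1,3,2)] by simp
  finally show ?thesis .
qed

text \<open>Near each point a frame expresses the pairing by the two ratios of the sections and
  \<open>h (t x) (t x)\<close>, all continuous in the chart.\<close>

lemma continuous_section_pairing:
  assumes "\<phi> \<in> carrier \<Gamma>" "\<psi> \<in> carrier \<Gamma>"
  shows "continuous_in_charts (\<lambda>x. h (\<phi> x) (\<psi> x))"
  unfolding continuous_in_charts_def
proof (intro ballI continuous_at_imp_continuous_on)
  fix c z assume c: "c \<in> atlas M" and z: "z \<in> snd c ` fst c"
  have "chart_inv c z \<in> points M" using chart_inv_in[OF z] chart_domain_subset[OF c] by auto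
  then obtain U t where t: "(U, t) \<in> frames L" "chart_inv c z \<in> U" using frames_cover by auto
  let ?W = "chart_image c U"
  have W: "open ?W" by (rule open_chart_image[OF c frame_domain[OF t(1)]])
  have zW: "z \<in> ?W" using z t(2) by (simp add: chart_image_eq[OF c])
  have hol: "continuous_on ?W (\<lambda>z. ratio (fibre L (chart_inv c z)) (t (chart_inv c z)) (\<eta> (chart_inv
    c z)))"
    if "\<eta> \<in> carrier \<Gamma>" for \<eta>
    using section_holomorphic[OF that t(1)] c
    by (auto simp: holomorphic_on_mfd_def comp_def dest: holomorphic_fun_on_imp_continuous_on)
  have "continuous_on ?W (\<lambda>z. h (t (chart_inv c z)) (t (chart_inv c z)))"
    using metric_smooth[OF t(1) c] unfolding smooth_fun_on_def by (metis Ck_on.simps(1))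
  hence "continuous_on ?W (\<lambda>z. cnj (ratio (fibre L (chart_inv c z)) (t (chart_inv c z)) (\<phi>
    (chart_inv c z))) *
      (ratio (fibre L (chart_inv c z)) (t (chart_inv c z)) (\<psi> (chart_inv c z)) * h (t (chart_inv c
        z)) (t (chart_inv c z))))"
    by (intro continuous_on_mult continuous_on_cnj hol assms)
  moreover have "cnj (ratio (fibre L x) (t x) (\<phi> x)) * (ratio (fibre L x) (t x) (\<psi> x) * h (t x) (t
    x)) = h (\<phi> x) (\<psi> x)"
    if "x \<in> U" for x
  proof -
    have x: "x \<in> points M" using that frame_domain_subset[OF t(1)] by auto
    note span = frame_spans_fibre[OF t(1) that] and tc = frame_in_fibre[OF t(1) that]
    have "h (\<phi> x) (\<psi> x) = h (ratio (fibre L x) (t x) (\<phi> x) \<odot>\<^bsub>fibre L x\<^esub> t x) (ratio (fibre L x) (t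
      x) (\<psi> x) \<odot>\<^bsub>fibre L x\<^esub> t x)"
      by (simp add: ratio_smult[OF span] section_in_fibre x assms)
    thus ?thesis using x tc by (simp add: metric_scale_left metric_scale fibre_smult_closed)
  qed
  ultimately have "continuous_on ?W (\<lambda>z. h (\<phi> (chart_inv c z)) (\<psi> (chart_inv c z)))"
    by (rule continuous_on_cong[THEN iffD1, OF refl, rotated]) (auto simp: chart_image_eq[OF c])
  thus "isCont (\<lambda>z. h (\<phi> (chart_inv c z)) (\<psi> (chart_inv c z))) z"
    using continuous_on_eq_continuous_at[OF W] zW by blast
qed

end

section \<open>Scalar product and coherent vectors of M\<close>

context quantum_line_bundle
begin

lemma section_inner_add:
  assumes "compact_space (mtop M)" "\<phi> \<in> carrier \<Gamma>" "\<psi> \<in> carrier \<Gamma>" "\<psi>' \<in> carrier \<Gamma>"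
  shows "section_inner M \<omega> h \<phi> (\<psi> \<oplus>\<^bsub>\<Gamma>\<^esub> \<psi>') = section_inner M \<omega> h \<phi> \<psi> + section_inner M \<omega> h \<phi> \<psi>'"
proof -
  have "section_inner M \<omega> h \<phi> (\<psi> \<oplus>\<^bsub>\<Gamma>\<^esub> \<psi>') = liouville_integral M \<omega> (\<lambda>x. h (\<phi> x) (\<psi> x) + h (\<phi> x) (\<psi>' x))"
    unfolding section_inner_def
    by (rule liouville_integral_cong[OF assms(1)]) (simp add: section_add_apply metric_add
      section_in_fibre assms)
  also have "\<dots> = section_inner M \<omega> h \<phi> \<psi> + section_inner M \<omega> h \<phi> \<psi>'"
    unfolding section_inner_def
    by (rule liouville_integral_add[OF assms(1)]) (simp_all add: continuous_section_pairing assms)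
  finally show ?thesis .
qed

lemma section_inner_smult:
  assumes "compact_space (mtop M)" "\<phi> \<in> carrier \<Gamma>" "\<psi> \<in> carrier \<Gamma>"
  shows "section_inner M \<omega> h \<phi> (a \<odot>\<^bsub>\<Gamma>\<^esub> \<psi>) = a * section_inner M \<omega> h \<phi> \<psi>"
  unfolding section_inner_def liouville_integral_mult[symmetric]
  by (rule liouville_integral_cong[OF assms(1)]) (simp add: section_smult_apply metric_scale
    section_in_fibre assms)

lemma section_inner_hermitian:
  assumes "compact_space (mtop M)" "\<phi> \<in> carrier \<Gamma>" "\<psi> \<in> carrier \<Gamma>"
  shows "section_inner M \<omega> h \<phi> \<psi> = cnj (section_inner M \<omega> h \<psi> \<phi>)"
  unfolding section_inner_def liouville_integral_cnj[symmetric]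
  by (rule liouville_integral_cong[OF assms(1)], rule metric_hermitian) (auto intro:
    section_in_fibre assms)

lemma coherent_frame_orthonormal:
  assumes "compact_space (mtop M)" "orthonormal_section_basis M \<omega> L h s"
  shows "coherent_frame M \<omega> L h (\<lambda>a. finsum \<Gamma> (\<lambda>j. a j \<odot>\<^bsub>\<Gamma>\<^esub> s j) UNIV) 1"
proof
  interpret abelian_monoid \<Gamma> by (rule sections_abelian_monoid)
  have s: "s j \<in> carrier \<Gamma>" for j
    using assms(2) by (simp add: orthonormal_section_basis_def section_basis_def)
  have comb: "finsum \<Gamma> (\<lambda>j. a j \<odot>\<^bsub>\<Gamma>\<^esub> s j) UNIV \<in> carrier \<Gamma>" for a
    using s by (intro finsum_closed) (auto simp: section_smult_closed)
  show "carrier \<Gamma> = range (\<lambda>a. finsum \<Gamma> (\<lambda>j. a j \<odot>\<^bsub>\<Gamma>\<^esub> s j) UNIV)"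
    using comb assms(2) by (auto simp: orthonormal_section_basis_def section_basis_def)
  have lin: "section_inner M \<omega> h \<phi> (finsum \<Gamma> (\<lambda>j. b j \<odot>\<^bsub>\<Gamma>\<^esub> s j) UNIV) =
    (\<Sum>j\<in>UNIV. b j * section_inner M \<omega> h \<phi> (s j))"
    if "\<phi> \<in> carrier \<Gamma>" for \<phi> b
    by (rule linear_functional_finsum)
      (simp_all add: section_inner_add section_inner_smult assms(1) that s)
  \<comment> \<open>Linearity is used in the second argument only; a combination in the first
    argument is reached through hermitian symmetry.\<close>
  have sk: "section_inner M \<omega> h (s k) (finsum \<Gamma> (\<lambda>j. a j \<odot>\<^bsub>\<Gamma>\<^esub> s j) UNIV) = a k" for a k
  proof -
    have "section_inner M \<omega> h (s k) (finsum \<Gamma> (\<lambda>j. a j \<odot>\<^bsub>\<Gamma>\<^esub> s j) UNIV) = (\<Sum>j\<in>UNIV. if j =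
      k then a j else 0)"
      unfolding lin[OF s] using assms(2) by (intro sum.cong) (auto simp: orthonormal_section_basis_def)
    thus ?thesis by simp
  qed
  fix a b
  have "section_inner M \<omega> h (finsum \<Gamma> (\<lambda>j. a j \<odot>\<^bsub>\<Gamma>\<^esub> s j) UNIV) (finsum \<Gamma> (\<lambda>j. b j \<odot>\<^bsub>\<Gamma>\<^esub> s j) UNIV)
    = (\<Sum>j\<in>UNIV. b j * section_inner M \<omega> h (finsum \<Gamma> (\<lambda>j. a j \<odot>\<^bsub>\<Gamma>\<^esub> s j) UNIV) (s j))"
    by (rule lin[OF comb])
  also have "\<dots> = (\<Sum>j\<in>UNIV. b j * cnj (a j))"
    by (simp only: section_inner_hermitian[OF assms(1) comb s] sk)
  finally show "section_inner M \<omega> h (finsum \<Gamma> (\<lambda>j. a j \<odot>\<^bsub>\<Gamma>\<^esub> s j) UNIV) (finsum \<Gamma> (\<lambda>j. b j \<odot>\<^bsub>\<Gamma>\<^esub> s j)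
    UNIV)
    = of_real 1 * (\<Sum>j\<in>UNIV. cnj (a j) * b j)"
    by (simp add: mult.commute)
qed simp

lemma inner_coherent_vectors_orthonormal:
  assumes "compact_space (mtop M)" "orthonormal_section_basis M \<omega> L h s"
    and "q \<in> nonzero_vectors M L" "q' \<in> nonzero_vectors M L"
  shows "section_inner M \<omega> h (coherent_vector M \<omega> L h q) (coherent_vector M \<omega> L h q') =
    (\<Sum>j\<in>UNIV. point_form L q (s j) * cnj (point_form L q' (s j)))"
proof -
  interpret coherent_frame M \<omega> L h "\<lambda>a. finsum \<Gamma> (\<lambda>j. a j \<odot>\<^bsub>\<Gamma>\<^esub> s j) UNIV" 1
    by (rule coherent_frame_orthonormal) fact+
  have s: "s j \<in> carrier \<Gamma>" for j
    using assms(2) by (simp add: orthonormal_section_basis_def section_basis_def)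
  have "point_form L r (finsum \<Gamma> (\<lambda>j. b j \<odot>\<^bsub>\<Gamma>\<^esub> s j) UNIV) = (\<Sum>j\<in>UNIV. b j * point_form L r (s j))"
    if "r \<in> nonzero_vectors M L" for r b
    by (rule linear_functional_finsum) (simp_all add: point_form_add point_form_smult that s)
  from inner_coherent_vectors[OF this[OF assms(3)] this[OF assms(4)]] show ?thesis by simp
qed

end

section \<open>Comparison of the two scalar products\<close>

theorem proposition4p4:
  fixes M :: "('a, 'n::finite) complex_mfd"
    and \<omega> :: "('a, 'n) form11"
    and L :: "('a, 'e) line_bundle"
    and h :: "'e \<Rightarrow> 'e \<Rightarrow> complex"
    and s :: "'N::finite option \<Rightarrow> 'a \<Rightarrow> 'e"
    and q q' :: 'e
    and x y :: 'a
    and i :: "'a \<Rightarrow> (complex^'N option) set"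
    and F :: real
    and t\<^sub>0 :: "(complex^'N option) set \<Rightarrow> 'N hyperplane_vector"
  assumes "kaehler_manifold M \<omega>"
    and "compact_space (mtop M)"
    and "connected_space (mtop M)"
    and "quantum_line_bundle M \<omega> L h"
    and "very_ample TYPE('N) M L"
    and "orthonormal_section_basis M \<omega> L h s"
    and "i = map_to_proj M L s"
    and "q \<in> nonzero_vectors M L" and "bproj L q = x"
    and "q' \<in> nonzero_vectors M L" and "bproj L q' = y"
    and "i x \<in> affine_patch None" and "i y \<in> affine_patch None"
    and "F = real (CARD('N) + 1) /
      liouville_volume (projective_space :: ((complex^'N option) set, 'N) complex_mfd) fubini_study"
    and "t\<^sub>0 = form_section (\<lambda>v. v $ None)"
  shows "section_inner M \<omega> h (coherent_vector M \<omega> L h q) (coherent_vector M \<omega> L h q') =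
      point_form L q (s None) * cnj (point_form L q' (s None)) *
      hermitian_inner (homog_rep None (i y)) (homog_rep None (i x)) \<and>
    section_inner M \<omega> h (coherent_vector M \<omega> L h q) (coherent_vector M \<omega> L h q') =
      point_form L q (s None) * cnj (point_form L q' (s None)) / of_real F *
      coherent_inner_along projective_space fubini_study hyperplane_bundle hyperplane_metric
        t\<^sub>0 (i x) (i y)"
proof -
  interpret quantum_line_bundle M \<omega> L h by fact
  have s: "s j \<in> carrier (hol_sections M L)" for j
    using assms(6) by (simp add: orthonormal_section_basis_def section_basis_def)
  define v where "v = (\<chi> j. point_form L q (s j))"
  define w where "w = (\<chi> j. point_form L q' (s j))"
  have ix: "i x = line v" unfolding assms(7) v_def by (rule map_to_proj_eq[OF assms(8,9) s])
  have iy: "i y = line w" unfolding assms(7) w_def by (rule map_to_proj_eq[OF assms(10,11) s])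
  \<comment> \<open>The zero vector is excluded because its line \<open>{0}\<close> is not a
    projective point, hence in no affine patch.\<close>
  have nz: "u $ None \<noteq> 0" if "line u \<in> affine_patch None" for u :: "complex^'N option"
  proof -
    have "u \<noteq> 0" using that by (auto simp: affine_patch_def line_in_proj_points_iff)
    thus ?thesis using that by (simp add: line_in_affine_patch)
  qed
  have v: "v $ None \<noteq> 0" and w: "w $ None \<noteq> 0" using assms(12,13) nz by (auto simp: ix iy)
  have F: "F = real (CARD('N) + 1) / fs_volume TYPE('N)" by (simp add: assms(14) fs_volume_def)
  \<comment> \<open>The second identity divides by \<open>F\<close>, and division by zero would give
    0; positivity of the volume rules this out.\<close>
  have "F \<noteq> 0" using fs_volume_pos[where 'N = 'N] by (simp add: F)
  have along: "coherent_inner_along projective_space fubini_study hyperplane_bundle hyperplane_metric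
        t\<^sub>0 (i x) (i y) = of_real F * (\<Sum>j\<in>UNIV. (v $ j / v $ None) * cnj (w $ j / w $ None))"
    unfolding assms(15) ix iy F by (rule coherent_inner_along_projective[OF v w])
  have herm: "hermitian_inner (homog_rep None (i y)) (homog_rep None (i x)) =
      (\<Sum>j\<in>UNIV. (v $ j / v $ None) * cnj (w $ j / w $ None))"
    by (simp add: ix iy homog_rep_line v w hermitian_inner_def mult.commute)
  have "section_inner M \<omega> h (coherent_vector M \<omega> L h q) (coherent_vector M \<omega> L h q') =
    (\<Sum>j\<in>UNIV. v $ j * cnj (w $ j))"
    using inner_coherent_vectors_orthonormal[OF assms(2,6,8,10)] by (simp add: v_def w_def)
  also have "\<dots> = v $ None * cnj (w $ None) * (\<Sum>j\<in>UNIV. (v $ j / v $ None) * cnj (w $ j / w $ None))"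
    unfolding sum_distrib_left using v w by (intro sum.cong) auto
  finally have "section_inner M \<omega> h (coherent_vector M \<omega> L h q) (coherent_vector M \<omega> L h q') =
    v $ None * cnj (w $ None) * (\<Sum>j\<in>UNIV. (v $ j / v $ None) * cnj (w $ j / w $ None))" .
  thus ?thesis unfolding along herm using \<open>F \<noteq> 0\<close> by (simp add: v_def w_def)
qed

end
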